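(* Let $f(z)=\sum_{j=0}^\infty a_jz^j$ be a transcendental entire function and let $f_\omega(z)=\sum_{j=0}^\infty \chi_j(\omega)a_jz^j$ be the associated random entire function. Put $f^*(z)=\sum_{j=1}^\infty ja_jz^j$ and $f^*_\omega(z)=zf'_\omega(z)=\sum_{j=1}^{\infty}ja_j\chi_j(\omega)z^j$. Suppose that $f_\omega$ and $f^*_\omega$ satisfy Condition Y, and let $A,B>0$ be constants with which Condition Y holds for both. Then, for any constant $C>1$, there exists a set $E$ of finite logarithmic measure such that, for every $a\in\mathbb C$, for almost every $\omega\in\Omega$ there is $r_1=r_1(\omega,a)$ such that, for all $r>r_1$ with $r\notin E$, $$T(r, f)\leq N(r,a, f_\omega)+(C/A)^{\frac1{B}}\bigl(\log T(r,f)\bigr)^{\frac1{B}}+(1+o(1))\log T(r,f)$$ and $$T(r, f_\omega)\leq N(r,a, f_\omega)+(C/A)^{\frac1{B}}\bigl(\log T(r,f_\omega)\bigr)^{\frac1{B}}+(1+o(1))\log T(r,f_\omega).$$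
   Context: $(\Omega,\mathcal F,\mu)$ is a probability space and $\chi_j$ ($j=0,1,2,\dots$) are independent, identically distributed complex-valued random variables on it with mean $0$ and variance $1$ (i.e. $\mathrm{E}(\chi_j)=0$, $\mathrm{E}(|\chi_j|^2)=1$). For almost every $\omega$, $f_\omega$ is an entire function. "Almost every $\omega$" means all $\omega$ outside a $\mu$-null set. For an entire function $g(z)=\sum_{j=0}^\infty b_jz^j$ (not identically zero) with associated random function $g_\omega(z)=\sum_{j=0}^\infty\chi_j(\omega)b_jz^j$, put $\sigma(r,g)=\bigl(\sum_{j=0}^\infty|b_j|^2r^{2j}\bigr)^{1/2}$, $\hat g_\omega(re^{i\theta})=g_\omega(re^{i\theta})/\sigma(r,g)$, and $X_r(\omega)=\frac1{2\pi}\int_0^{2\pi}\bigl|\log|\hat g_\omega(re^{i\theta})|\bigr|\,d\theta$ for $r>0$. Condition Y for $g_\omega$: there are two positive constants $A$ and $B$ such that $\mathrm{E}(\exp(A|X_r|^B))<+\infty$ for all $r>0$. For $f^*_\omega$, Condition Y refers to $g=f^*$, i.e. $b_j=ja_j$. For an entire function $g$, the Nevanlinna characteristic is $T(r,g)=\frac1{2\pi}\int_0^{2\pi}\log^+|g(re^{it})|\,dt$. For $a\in\mathbb C$, $N(r,a,f_\omega)=N(r,0,f_\omega-a)$, where for an entire function $h\not\equiv0$, $N(r,0,h)=\int_0^r\frac{n(t,0,h)-n(0,0,h)}{t}\,dt+n(0,0,h)\log r$, $n(t,0,h)$ is the number of zeros (with multiplicity) of $h$ in the disk of center $0$ and radius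 $t$, and $n(0,0,h)$ is the multiplicity of the zero at the origin. A set $E\subset(0,\infty)$ has finite logarithmic measure if $\int_E\frac{dr}{r}<\infty$. The symbol $o(1)$ denotes a quantity (which may depend on $\omega$ and $a$) tending to $0$ as $r\to\infty$.
   Formalization: Condition Y is strengthened: E(exp(A|X_r|^B)) must also be bounded by a constant independent of r for all large r. With finiteness for each r only, the claim fails, e.g. for a_m=exp(-m^3), B=1/4, χ_j=0 with probability 1/2 and ±√2 with probability 1/4 each. *)

theory Defs
  imports "HOL-Probability.Probability" "HOL-Complex_Analysis.Complex_Analysis"
begin

definition transcendental_entire :: "(complex \<Rightarrow> complex) \<Rightarrow> bool" where
  "transcendental_entire f \<longleftrightarrow>
     f holomorphic_on UNIV \<and> \<not> (\<exists>p :: complex poly. \<forall>z. f z = poly p z)"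

text \<open>The series below converges for all \<open>z\<close> only for almost every \<open>\<omega>\<close>; where it diverges,
  \<open>suminf\<close> returns an arbitrary value.\<close>

definition random_series ::
    "(nat \<Rightarrow> 'w \<Rightarrow> complex) \<Rightarrow> (nat \<Rightarrow> complex) \<Rightarrow> 'w \<Rightarrow> complex \<Rightarrow> complex" where
  "random_series X b \<omega> z = (\<Sum>j. X j \<omega> * b j * z ^ j)"

definition sigma :: "real \<Rightarrow> (nat \<Rightarrow> complex) \<Rightarrow> real" where
  "sigma r b = sqrt (\<Sum>j. (cmod (b j))\<^sup>2 * r ^ (2 * j))"

definition normalized_series ::
    "(nat \<Rightarrow> 'w \<Rightarrow> complex) \<Rightarrow> (nat \<Rightarrow> complex) \<Rightarrow> 'w \<Rightarrow> complex \<Rightarrow> complex" where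
  "normalized_series X b \<omega> z = random_series X b \<omega> z / of_real (sigma (cmod z) b)"

text \<open>Since \<open>ln 0 = 0\<close>, the integrand below vanishes at zeros of the series instead of being
  infinite. This affects finitely many \<open>\<theta>\<close> unless the random function is identically zero, which
  has probability zero when infinitely many \<open>b j\<close> are nonzero and the \<open>X j\<close> are independent and
  identically distributed with variance 1.\<close>

definition log_mean ::
    "(nat \<Rightarrow> 'w \<Rightarrow> complex) \<Rightarrow> (nat \<Rightarrow> complex) \<Rightarrow> real \<Rightarrow> 'w \<Rightarrow> real" where
  "log_mean X b r \<omega> =
     1 / (2 * pi) *
       (LBINT \<theta>:{0..2 * pi}. \<bar>ln (cmod (normalized_series X b \<omega> (of_real r * cis \<theta>)))\<bar>)"

definition exp_moment ::
    "'w measure \<Rightarrow> (nat \<Rightarrow> 'w \<Rightarrow> complex) \<Rightarrow> (nat \<Rightarrow> complex) \<Rightarrow> real \<Rightarrow> real \<Rightarrow> real \<Rightarrow> ennreal"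
  where
  "exp_moment M X b A B r = (\<integral>\<^sup>+\<omega>. ennreal (exp (A * \<bar>log_mean X b r \<omega>\<bar> powr B)) \<partial>M)"

text \<open>Finiteness of the exponential moments is read with a bound that does not depend on \<open>r\<close> as
  \<open>r\<close> tends to infinity. Finiteness for each single \<open>r\<close> is not enough for the theorem: take
  \<open>a m = exp (- m ^ 3)\<close>, \<open>B = 1/4\<close>, any \<open>A > 0\<close>, and \<open>X j\<close> equal to \<open>0\<close> with probability
  \<open>1/2\<close> and to plus or minus \<open>sqrt 2\<close> with probability \<open>1/4\<close> each. All moments are then finite,
  but almost surely \<open>X n = 0\<close> for infinitely many \<open>n\<close>, and for those \<open>n\<close> the difference between
  \<open>T(r, f)\<close> and \<open>N(r, c, f_omega)\<close> is at least \<open>2 n - O(1)\<close> for all \<open>r\<close> with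
  \<open>\<bar>ln r - 3 * n ^ 2\<bar> \<le> n\<close>, whereas \<open>ln T(r, f)\<close> is of order \<open>ln n\<close> there.\<close>

definition condition_Y ::
    "'w measure \<Rightarrow> (nat \<Rightarrow> 'w \<Rightarrow> complex) \<Rightarrow> (nat \<Rightarrow> complex) \<Rightarrow> real \<Rightarrow> real \<Rightarrow> bool" where
  "condition_Y M X b A B \<longleftrightarrow>
     A > 0 \<and> B > 0 \<and>
     (\<forall>r>0. exp_moment M X b A B r < \<infinity>) \<and>
     (\<exists>K::real. \<forall>\<^sub>F r in at_top. exp_moment M X b A B r \<le> ennreal K)"

definition log_plus :: "real \<Rightarrow> real" where
  "log_plus x = max 0 (ln x)"

definition nevanlinna_T :: "real \<Rightarrow> (complex \<Rightarrow> complex) \<Rightarrow> real" where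
  "nevanlinna_T r g =
     1 / (2 * pi) * (LBINT t:{0..2 * pi}. log_plus (cmod (g (of_real r * cis t))))"

text \<open>For \<open>t = 0\<close> the closed disk is \<open>{0}\<close>, so \<open>zero_count 0 h\<close> is the multiplicity of the zero
  of \<open>h\<close> at the origin (\<open>0\<close> if \<open>h 0 \<noteq> 0\<close>).\<close>

definition zero_count :: "real \<Rightarrow> (complex \<Rightarrow> complex) \<Rightarrow> real" where
  "zero_count t h = (\<Sum>z \<in> {z \<in> cball 0 t. h z = 0}. of_int (zorder h z))"

definition nevanlinna_N0 :: "real \<Rightarrow> (complex \<Rightarrow> complex) \<Rightarrow> real" where
  "nevanlinna_N0 r h =
     (LBINT t:{0..r}. (zero_count t h - zero_count 0 h) / t) + zero_count 0 h * ln r"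

definition nevanlinna_N :: "real \<Rightarrow> complex \<Rightarrow> (complex \<Rightarrow> complex) \<Rightarrow> real" where
  "nevanlinna_N r c g = nevanlinna_N0 r (\<lambda>z. g z - c)"

definition finite_log_measure :: "real set \<Rightarrow> bool" where
  "finite_log_measure E \<longleftrightarrow>
     E \<subseteq> {0<..} \<and> E \<in> sets lebesgue \<and>
     (\<integral>\<^sup>+r\<in>E. ennreal (1 / r) \<partial>lebesgue) < \<infinity>"

end

theory Submission
  imports Defs "HOL-Real_Asymp.Real_Asymp"
begin

text \<open>Let \<open>b j = j * a j\<close>, \<open>\<phi> r = ln (sigma r b)\<close> and \<open>g = f_omega\<close>. Both inequalities compare a
  characteristic with the counting function, and the comparison goes through \<open>\<phi>\<close>.

  From above, \<open>T(r, f) \<le> \<phi> r + O(1)\<close> and \<open>T(r, g) \<le> \<phi> r + O(1)\<close>. By concavity of the logarithm a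
  characteristic is at most half the logarithm of 1 plus the quadratic mean on the circle, which
  Parseval's identity expresses by the coefficients. Almost surely the random factors grow at most
  linearly in the index, so the coefficients of \<open>f\<close> and of \<open>g\<close> are both dominated by \<open>b\<close>
  (\<open>nevanlinna_T_upper_bound\<close>).

  From below, put \<open>h = g - c\<close>. Jensen's formula expresses \<open>N(s, c, g)\<close> up to a constant by the mean of
  \<open>ln \<bar>h\<bar>\<close>, which is at least the mean of \<open>ln \<bar>z h'\<bar>\<close> minus the mean of \<open>log_plus \<bar>z h' / h\<bar>\<close>. The
  function \<open>z h' = z g'\<close> does not depend on \<open>c\<close>; it is the random series with coefficients \<open>b\<close>. By
  Condition Y and the Borel-Cantelli lemma the mean of its logarithm is at least
  \<open>n - (C' / A * ln n) powr (1 / B)\<close> on the circles with \<open>\<phi> s = n\<close>, for all large \<open>n\<close> and any fixed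
  \<open>C' > 1\<close> (\<open>AE_log_mean_le\<close>). By the lemma on the logarithmic derivative (\<open>mean_log_deriv_le\<close>) the second
  mean is at most \<open>(1 + o(1)) * ln n\<close>, provided that \<open>\<phi>\<close> does not grow too fast immediately to the right
  of \<open>s\<close>. This condition involves only \<open>\<phi>\<close>, and so does the exceptional set: it consists of the radii
  just to the left of those at which \<open>\<phi>\<close> is a power of 2. The counting function is nondecreasing, so the
  estimates on the circles \<open>\<phi> s = n\<close> extend to all radii outside of the exceptional set at the cost of a
  constant (\<open>nevanlinna_N_lower_bound\<close>).

  Together these give the inequalities with \<open>\<phi>\<close> in the error terms. A case distinction, whether
  \<open>T \<le> \<phi> / 2\<close> or not, replaces \<open>\<phi>\<close> by \<open>T\<close> (\<open>characteristic_bound_of_lower_bound\<close>). Passing from \<open>a\<close> to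
  \<open>b\<close> in both estimates has the effect that Condition Y enters only once, so the error term carries the
  constant \<open>(C / A) powr (1 / B)\<close> and not its double.\<close>

section \<open>Circle means\<close>

text \<open>Circle means are taken with respect to a probability measure on the angle: constants integrate to
  themselves, and the finitely many zeros of an entire function on a circle are absorbed by
  almost-everywhere statements.\<close>
definition circ :: "real measure" where
  "circ = density lborel (\<lambda>\<theta>. ennreal (indicator {0..2*pi} \<theta> / (2*pi)))"

lemma sets_circ [measurable_cong, simp]: "sets circ = sets borel"
  and space_circ [simp]: "space circ = UNIV"
  by (simp_all add: circ_def)

lemma nn_integral_circ:
  assumes [measurable]: "u \<in> borel_measurable borel"
  shows "(\<integral>\<^sup>+\<theta>. u \<theta> \<partial>circ) = ennreal (1/(2*pi)) * (\<integral>\<^sup>+\<theta>. u \<theta> * indicator {0..2*pi} \<theta> \<partial>lborel)"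
  unfolding circ_def
  by (subst nn_integral_density)
     (auto simp: nn_integral_cmult[symmetric] indicator_def intro!: nn_integral_cong)

interpretation circ: prob_space circ
proof
  have "emeasure circ (space circ) = (\<integral>\<^sup>+\<theta>. 1 \<partial>circ)" by simp
  also have "\<dots> = ennreal (1/(2*pi)) * ennreal (2*pi)"
    by (subst nn_integral_circ) auto
  also have "\<dots> = 1" by (subst ennreal_mult[symmetric]) auto
  finally show "emeasure circ (space circ) = 1" .
qed

lemma integrable_circ_iff:
  fixes u :: "real \<Rightarrow> 'b::{banach, second_countable_topology}"
  assumes [measurable]: "u \<in> borel_measurable borel"
  shows "integrable circ u \<longleftrightarrow> set_integrable lborel {0..2*pi} u"
proof -
  have "integrable circ u \<longleftrightarrow> integrable lborel (\<lambda>\<theta>. (indicator {0..2*pi} \<theta> / (2*pi)) *\<^sub>R u \<theta>)"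
    unfolding circ_def by (subst integrable_density) auto
  also have "(\<lambda>\<theta>. (indicator {0..2*pi} \<theta> / (2*pi)) *\<^sub>R u \<theta>)
      = (\<lambda>\<theta>. (1/(2*pi)) *\<^sub>R (indicator {0..2*pi} \<theta> *\<^sub>R u \<theta>))"
    by auto
  also have "integrable lborel \<dots> \<longleftrightarrow> set_integrable lborel {0..2*pi} u"
    unfolding set_integrable_def
  proof (intro iffI integrable_scaleR_right)
    assume "integrable lborel (\<lambda>\<theta>. (1/(2*pi)) *\<^sub>R (indicator {0..2*pi} \<theta> *\<^sub>R u \<theta>))"
    then have "integrable lborel (\<lambda>\<theta>. (2*pi) *\<^sub>R (1/(2*pi)) *\<^sub>R (indicator {0..2*pi} \<theta> *\<^sub>R u \<theta>))"
      by (intro integrable_scaleR_right[where c="2*pi"])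
    moreover have "(\<lambda>\<theta>. (2*pi) *\<^sub>R (1/(2*pi)) *\<^sub>R (indicator {0..2*pi} \<theta> *\<^sub>R u \<theta>))
        = (\<lambda>\<theta>. indicator {0..2*pi} \<theta> *\<^sub>R u \<theta>)" by (intro ext) simp
    ultimately show "integrable lborel (\<lambda>\<theta>. indicator {0..2*pi} \<theta> *\<^sub>R u \<theta>)" by simp
  qed
  finally show ?thesis .
qed

lemma integral_circ:
  fixes u :: "real \<Rightarrow> 'b::{banach, second_countable_topology}"
  assumes [measurable]: "u \<in> borel_measurable borel"
  shows "integral\<^sup>L circ u = (1/(2*pi)) *\<^sub>R (LBINT \<theta>:{0..2*pi}. u \<theta>)"
proof -
  have "integral\<^sup>L circ u = (\<integral>\<theta>. (indicator {0..2*pi} \<theta> / (2*pi)) *\<^sub>R u \<theta> \<partial>lborel)"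
    unfolding circ_def by (subst integral_density) auto
  also have "(\<lambda>\<theta>. (indicator {0..2*pi} \<theta> / (2*pi)) *\<^sub>R u \<theta>)
      = (\<lambda>\<theta>. (1/(2*pi)) *\<^sub>R (indicator {0..2*pi} \<theta> *\<^sub>R u \<theta>))"
    by auto
  finally show ?thesis unfolding set_lebesgue_integral_def by (simp only: integral_scaleR_right)
qed

lemma AE_circ_finite:
  assumes "finite A" shows "AE \<theta> in circ. \<theta> \<notin> A \<and> \<theta> \<in> {0..2*pi}"
proof -
  have "AE \<theta> in lborel. \<theta> \<notin> A"
    using assms by (intro AE_not_in finite_imp_null_set_lborel)
  then show ?thesis unfolding circ_def
    by (subst AE_density) (auto elim!: eventually_mono simp: indicator_def split: if_splits)
qed

lemma integrable_circ_continuous: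
  fixes u :: "real \<Rightarrow> 'b::{banach, second_countable_topology}"
  assumes "continuous_on UNIV u" shows "integrable circ u"
proof -
  have [measurable]: "u \<in> borel_measurable borel" using assms by (rule borel_measurable_continuous_onI)
  show ?thesis
    by (subst integrable_circ_iff)
       (auto intro!: borel_integrable_compact continuous_on_subset[OF assms] simp: set_integrable_def)
qed

lemma measurable_circle_point [measurable]: "(\<lambda>\<theta>. of_real r * cis \<theta>) \<in> borel_measurable borel"
  by (intro borel_measurable_continuous_onI continuous_intros)

lemma mean_value_circle:
  assumes g: "g holomorphic_on ball 0 R" and r: "0 < r" "r < R"
  shows "integrable circ (\<lambda>\<theta>. g (of_real r * cis \<theta>))"
    and "(\<integral>\<theta>. g (of_real r * cis \<theta>) \<partial>circ) = g 0"
proof -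
  let ?u = "\<lambda>\<theta>. g (of_real r * cis \<theta>)"
  have cont: "continuous_on UNIV ?u"
    by (rule continuous_on_compose2[OF holomorphic_on_imp_continuous_on[OF g]])
       (use r in \<open>auto intro!: continuous_intros simp: norm_mult\<close>)
  then have [measurable]: "?u \<in> borel_measurable borel" by (rule borel_measurable_continuous_onI)
  show int: "integrable circ ?u" using cont by (rule integrable_circ_continuous)
  then have si: "set_integrable lborel {0..2*pi} ?u" by (simp add: integrable_circ_iff)
  have "((\<lambda>u. g u/(u-0)) has_contour_integral (2 * of_real pi * \<i> * g 0)) (circlepath 0 r)"
    by (rule Cauchy_integral_circlepath_simple)
       (use r in \<open>auto intro: holomorphic_on_subset[OF g]\<close>)
  then have "((\<lambda>t. g (0 + of_real r * cis t) / (0 + of_real r * cis t - 0) * of_real r * \<i> * cis t)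
      has_integral (2 * of_real pi * \<i> * g 0)) {0..2*pi}"
    unfolding circlepath_def by (subst (asm) has_contour_integral_part_circlepath_iff) auto
  then have "((\<lambda>t. \<i> * ?u t) has_integral (2 * of_real pi * \<i> * g 0)) {0..2*pi}"
    by (rule has_integral_eq[rotated]) (use r in \<open>auto simp: field_simps\<close>)
  then have "((\<lambda>t. (-\<i>) * (\<i> * ?u t)) has_integral ((-\<i>) * (2 * of_real pi * \<i> * g 0))) {0..2*pi}"
    by (rule has_integral_mult_right)
  then have "(?u has_integral (2 * of_real pi * g 0)) {0..2*pi}"
    by (simp flip: mult.assoc) (simp add: mult_ac)
  then have "(LBINT \<theta>:{0..2*pi}. ?u \<theta>) = 2 * of_real pi * g 0"
    using set_borel_integral_eq_integral(2)[OF si] by (simp add: integral_unique)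
  then show "integral\<^sup>L circ ?u = g 0"
    by (subst integral_circ) (auto simp: scaleR_conv_of_real)
qed

lemma abs_sin_ge_half:
  fixes x :: real assumes "\<bar>x\<bar> \<le> pi/2" shows "\<bar>x\<bar> / 2 \<le> \<bar>sin x\<bar>"
proof -
  have *: "y / 2 \<le> sin y" if y: "0 \<le> y" "y \<le> pi/2" for y :: real
  proof (cases "y \<le> pi/3")
    case True
    have "sin 0 - 0/2 \<le> sin y - y/2"
    proof (rule DERIV_nonneg_imp_nondecreasing[OF y(1)])
      fix t assume t: "0 \<le> t" "t \<le> y"
      have "cos (pi/3) \<le> cos t"
        using t y True by (intro cos_monotone_0_pi_le) auto
      then show "\<exists>d. ((\<lambda>t. sin t - t/2) has_real_derivative d) (at t) \<and> 0 \<le> d"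
        by (intro exI[of _ "cos t - 1/2"]) (auto intro!: derivative_eq_intros simp: cos_60)
    qed
    then show ?thesis by simp
  next
    case False
    have "sin (pi/3) \<le> sin y" using False y by (intro sin_monotone_2pi_le) auto
    moreover have "(4/5::real) \<le> sqrt 3 / 2"
      using real_le_rsqrt[of "8/5" 3] by (simp add: power2_eq_square)
    moreover have "y / 2 \<le> 4/5" using y pi_approx by simp
    ultimately show ?thesis by (simp add: sin_60)
  qed
  show ?thesis
    using *[of "\<bar>x\<bar>"] assms by (cases "x \<ge> 0") (auto simp: abs_if)
qed


lemma nn_integral_abs_powr_finite:
  fixes \<alpha> c :: real assumes "0 < \<alpha>" "\<alpha> < 1" "0 \<le> c"
  shows "(\<integral>\<^sup>+y. ennreal (\<bar>y\<bar> powr -\<alpha> * indicator {-c..c} y) \<partial>lborel) < \<infinity>"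
proof -
  let ?f = "\<lambda>y::real. y powr -\<alpha> * indicator {0..c} y"
  have "((\<lambda>y. y powr -\<alpha>) has_integral (c powr (-\<alpha>+1) / (-\<alpha>+1))) {0..c}"
    using assms by (intro has_integral_powr_from_0) auto
  then have "((\<lambda>y. if y \<in> {0..c} then y powr -\<alpha> else 0) has_integral (c powr (-\<alpha>+1) / (-\<alpha>+1))) UNIV"
    by (simp only: has_integral_restrict_UNIV)
  moreover have "(\<lambda>y. if y \<in> {0..c} then y powr -\<alpha> else 0) = ?f" by auto
  ultimately have "(?f has_integral (c powr (-\<alpha>+1) / (-\<alpha>+1))) UNIV" by simp
  then have fin: "(\<integral>\<^sup>+y. ennreal (?f y) \<partial>lborel) = ennreal (c powr (-\<alpha>+1) / (-\<alpha>+1))"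
    by (intro nn_integral_has_integral_lborel) auto
  then have fin2: "(\<integral>\<^sup>+y. ennreal (?f (0 + (-1) * y)) \<partial>lborel) = ennreal (c powr (-\<alpha>+1) / (-\<alpha>+1))"
    using nn_integral_real_affine[of "\<lambda>y. ennreal (?f y)" "-1" 0] by simp
  have "(\<integral>\<^sup>+y. ennreal (\<bar>y\<bar> powr -\<alpha> * indicator {-c..c} y) \<partial>lborel)
      \<le> (\<integral>\<^sup>+y. ennreal (?f y) + ennreal (?f (0 + (-1) * y)) \<partial>lborel)"
    by (intro nn_integral_mono) (auto simp: indicator_def)
  also have "\<dots> = (\<integral>\<^sup>+y. ennreal (?f y) \<partial>lborel) + (\<integral>\<^sup>+y. ennreal (?f (0 + (-1) * y)) \<partial>lborel)"
    by (rule nn_integral_add) auto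
  also have "\<dots> < \<infinity>" unfolding fin fin2 by simp
  finally show ?thesis .
qed

text \<open>On an interval of length \<open>4 * pi\<close> every point is within \<open>pi/2\<close> of one of five zeros of the sine,
  and there the sine is comparable to the distance. This trades the singular integral for translates
  of the integral of a power.\<close>
lemma abs_sin_powr_le_sum:
  fixes x \<alpha> :: real assumes x: "x \<in> {-pi..3*pi}" and "0 < \<alpha>"
  shows "\<bar>sin x\<bar> powr -\<alpha> \<le> (\<Sum>k\<in>{-1..3::int}. 2 powr \<alpha> * \<bar>x - k*pi\<bar> powr -\<alpha>)"
proof (cases "sin x = 0")
  case False
  define k where "k = \<lfloor>x/pi + 1/2\<rfloor>"
  have k: "k \<le> x/pi + 1/2" "x/pi + 1/2 < k + 1" unfolding k_def by linarith+
  then have 1: "k * pi \<le> x + pi/2" "x + pi/2 < k * pi + pi" by (simp_all add: field_simps)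
  have "-1 \<le> x/pi" "x/pi \<le> 3" using x by (auto simp: field_simps)
  then have k3: "k \<in> {-1..3}" unfolding k_def by (auto simp: le_floor_iff floor_le_iff)
  have "\<bar>sin (x - k*pi)\<bar> = \<bar>sin x\<bar>"
  proof -
    have "sin (x - k*pi) = sin x * cos (k*pi)"
      by (simp add: sin_diff sin_int_times_real mult.commute)
    moreover have "\<bar>cos (k*pi)\<bar> = 1"
      using sin_cos_squared_add[of "k*pi"] by (simp add: sin_int_times_real mult.commute abs_square_eq_1)
    ultimately show ?thesis by (simp add: abs_mult)
  qed
  moreover have "\<bar>x - k*pi\<bar>/2 \<le> \<bar>sin (x - k*pi)\<bar>" by (intro abs_sin_ge_half) (use 1 in \<open>simp only: abs_le_iff, linarith\<close>)
  ultimately have le: "\<bar>x - k*pi\<bar>/2 \<le> \<bar>sin x\<bar>" by simp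
  have pos: "0 < \<bar>x - k*pi\<bar>" using False \<open>\<bar>sin (x - k*pi)\<bar> = \<bar>sin x\<bar>\<close> by auto
  have "\<bar>sin x\<bar> powr -\<alpha> \<le> (\<bar>x - k*pi\<bar>/2) powr -\<alpha>"
    using le pos \<open>0 < \<alpha>\<close> by (intro powr_mono2') auto
  also have "\<dots> = 2 powr \<alpha> * \<bar>x - k*pi\<bar> powr -\<alpha>"
    by (simp add: powr_divide powr_minus field_simps)
  also have "\<dots> \<le> (\<Sum>k\<in>{-1..3::int}. 2 powr \<alpha> * \<bar>x - k*pi\<bar> powr -\<alpha>)"
    using k3 by (intro member_le_sum[where f="\<lambda>k::int. 2 powr \<alpha> * \<bar>x - k*pi\<bar> powr -\<alpha>"]) auto
  finally show ?thesis .
qed (auto intro!: sum_nonneg)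

text \<open>The bound has to be uniform in \<open>\<phi>\<close>, since \<open>\<phi>\<close> will be the argument of an arbitrary zero. All
  translates that occur stay inside \<open>[-6 pi, 6 pi]\<close>, so one integral over that interval bounds them.\<close>
lemma mean_sin_powr_bounded:
  fixes \<alpha> :: real assumes \<alpha>: "0 < \<alpha>" "\<alpha> < 1"
  obtains K where "K \<ge> 0"
    "\<And>\<phi>. \<phi> \<in> {-pi..pi} \<Longrightarrow> (\<integral>\<^sup>+\<theta>. ennreal (\<bar>sin (\<theta> - \<phi>)\<bar> powr -\<alpha>) \<partial>circ) \<le> ennreal K"
proof -
  define I where "I = (\<integral>\<^sup>+y. ennreal (\<bar>y\<bar> powr -\<alpha> * indicator {-(6*pi)..6*pi} y) \<partial>lborel)"
  have I: "I < \<infinity>" unfolding I_def using \<alpha> by (intro nn_integral_abs_powr_finite) auto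
  define K where "K = enn2real ((\<Sum>k\<in>{-1..3::int}. ennreal (2 powr \<alpha>) * I))"
  have K: "ennreal K = (\<Sum>k\<in>{-1..3::int}. ennreal (2 powr \<alpha>) * I)"
    unfolding K_def using I by (intro ennreal_enn2real) (auto simp: ennreal_mult_less_top)
  show thesis
  proof (rule that[of K])
    show "K \<ge> 0" unfolding K_def by simp
    fix \<phi> :: real assume \<phi>: "\<phi> \<in> {-pi..pi}"
    have shift: "(\<integral>\<^sup>+\<theta>. ennreal (\<bar>\<theta> - \<phi> - k*pi\<bar> powr -\<alpha> * indicator {-(6*pi)..6*pi} (\<theta> - \<phi> - k*pi)) \<partial>lborel) = I"
      for k :: int
      unfolding I_def
      by (subst (2) nn_integral_real_affine[where c=1 and t="- \<phi> - k*pi"]) (auto simp: algebra_simps)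
    have "(\<integral>\<^sup>+\<theta>. ennreal (\<bar>sin (\<theta> - \<phi>)\<bar> powr -\<alpha>) \<partial>circ)
        \<le> 1 * (\<integral>\<^sup>+\<theta>. ennreal (\<bar>sin (\<theta> - \<phi>)\<bar> powr -\<alpha>) * indicator {0..2*pi} \<theta> \<partial>lborel)"
    proof (subst nn_integral_circ)
      have "ennreal (1/(2*pi)) \<le> 1" using pi_ge_two by (simp add: ennreal_le_1)
      then show "ennreal (1/(2*pi)) * (\<integral>\<^sup>+\<theta>. ennreal (\<bar>sin (\<theta> - \<phi>)\<bar> powr -\<alpha>) * indicator {0..2*pi} \<theta> \<partial>lborel)
        \<le> 1 * (\<integral>\<^sup>+\<theta>. ennreal (\<bar>sin (\<theta> - \<phi>)\<bar> powr -\<alpha>) * indicator {0..2*pi} \<theta> \<partial>lborel)"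
        by (rule mult_right_mono) simp
    qed measurable
    also have "\<dots> \<le> (\<integral>\<^sup>+\<theta>. (\<Sum>k\<in>{-1..3::int}. ennreal (2 powr \<alpha>) *
        ennreal (\<bar>\<theta> - \<phi> - k*pi\<bar> powr -\<alpha> * indicator {-(6*pi)..6*pi} (\<theta> - \<phi> - k*pi))) \<partial>lborel)"
      unfolding mult_1
    proof (intro nn_integral_mono)
      fix \<theta> :: real
      show "ennreal (\<bar>sin (\<theta> - \<phi>)\<bar> powr -\<alpha>) * indicator {0..2*pi} \<theta> \<le> (\<Sum>k\<in>{-1..3::int}. ennreal (2 powr \<alpha>) *
        ennreal (\<bar>\<theta> - \<phi> - k*pi\<bar> powr -\<alpha> * indicator {-(6*pi)..6*pi} (\<theta> - \<phi> - k*pi)))"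
      proof (cases "\<theta> \<in> {0..2*pi}")
        case True
        have ind: "\<theta> - \<phi> - k*pi \<in> {-(6*pi)..6*pi}" if "k \<in> {-1..3::int}" for k
        proof -
          have "real_of_int k * pi \<le> 3 * pi" "-1 * pi \<le> real_of_int k * pi"
            using that by (intro mult_right_mono; simp)+
          then show ?thesis using True \<phi> pi_gt_zero unfolding atLeastAtMost_iff by linarith
        qed
        have "\<bar>sin (\<theta> - \<phi>)\<bar> powr -\<alpha> \<le> (\<Sum>k\<in>{-1..3::int}. 2 powr \<alpha> * \<bar>\<theta> - \<phi> - k*pi\<bar> powr -\<alpha>)"
          using True \<phi> \<alpha> by (intro abs_sin_powr_le_sum) auto
        also have "\<dots> = (\<Sum>k\<in>{-1..3::int}. 2 powr \<alpha> * (\<bar>\<theta> - \<phi> - k*pi\<bar> powr -\<alpha>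
            * indicator {-(6*pi)..6*pi} (\<theta> - \<phi> - k*pi)))"
          using ind by (intro sum.cong refl) simp
        finally have "ennreal (\<bar>sin (\<theta> - \<phi>)\<bar> powr -\<alpha>) \<le> ennreal \<dots>" by (rule ennreal_leI)
        also have "\<dots> = (\<Sum>k\<in>{-1..3::int}. ennreal (2 powr \<alpha>) *
          ennreal (\<bar>\<theta> - \<phi> - k*pi\<bar> powr -\<alpha> * indicator {-(6*pi)..6*pi} (\<theta> - \<phi> - k*pi)))"
          by (subst sum_ennreal[symmetric]) (auto simp: ennreal_mult' intro!: sum.cong)
        finally show ?thesis using True by simp
      qed simp
    qed
    also have "\<dots> = (\<Sum>k\<in>{-1..3::int}. ennreal (2 powr \<alpha>) * I)"
      by (simp add: nn_integral_sum nn_integral_cmult shift del: sum_constant)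
    finally show "(\<integral>\<^sup>+\<theta>. ennreal (\<bar>sin (\<theta> - \<phi>)\<bar> powr -\<alpha>) \<partial>circ) \<le> ennreal K" unfolding K .
  qed
qed

text \<open>After a rotation that makes \<open>a\<close> real and nonnegative, the left-hand side is the modulus of an
  imaginary part.\<close>
lemma sin_shift_le_dist:
  fixes a :: complex assumes "0 \<le> r"
  shows "r * \<bar>sin (\<theta> - Arg a)\<bar> \<le> cmod (of_real r * cis \<theta> - a)"
proof -
  have "cmod (of_real r * cis \<theta> - a) = cmod (cis (- Arg a) * (of_real r * cis \<theta> - a))"
    by (simp add: norm_mult)
  also have "cis (- Arg a) * (of_real r * cis \<theta> - a) = of_real r * cis (\<theta> - Arg a) - of_real (cmod a)"
  proof -
    have "cis (- Arg a) * a = of_real (cmod a) * (cis (- Arg a) * cis (Arg a))"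
      using rcis_cmod_Arg[of a] unfolding rcis_def by (metis mult.assoc mult.commute)
    then show ?thesis by (simp add: algebra_simps cis_mult)
  qed
  finally have "cmod (of_real r * cis \<theta> - a) = cmod (of_real r * cis (\<theta> - Arg a) - of_real (cmod a))" .
  moreover have "\<bar>Im (of_real r * cis (\<theta> - Arg a) - of_real (cmod a))\<bar> = r * \<bar>sin (\<theta> - Arg a)\<bar>"
    using assms by (simp add: abs_mult)
  ultimately show ?thesis by (metis abs_Im_le_cmod)
qed

lemma AE_circ_sin_shift_nz:
  assumes "\<phi> \<in> {-pi..pi}" shows "AE \<theta> in circ. sin (\<theta> - \<phi>) \<noteq> 0"
proof -
  have "finite ((\<lambda>k::int. \<phi> + k * pi) ` {-1..3})" by simp
  from AE_circ_finite[OF this] show ?thesis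
  proof (rule AE_mp, intro AE_I2 impI notI)
    fix \<theta> assume \<theta>: "\<theta> \<notin> (\<lambda>k::int. \<phi> + k * pi) ` {-1..3} \<and> \<theta> \<in> {0..2*pi}" and "sin (\<theta> - \<phi>) = 0"
    then obtain k :: int where k: "\<theta> - \<phi> = k * pi" by (auto simp: sin_zero_iff_int2)
    have "0 \<le> \<theta>" "\<theta> \<le> 2 * pi" "-pi \<le> \<phi>" "\<phi> \<le> pi" using \<theta> assms by simp_all
    then have "(-1) * pi \<le> \<theta> - \<phi>" "\<theta> - \<phi> \<le> 3 * pi" by linarith+
    then have "-1 \<le> real_of_int k" "real_of_int k \<le> 3"
      using mult_right_le_imp_le[OF _ pi_gt_zero, of "-1" "real_of_int k"]
        mult_right_le_imp_le[OF _ pi_gt_zero, of "real_of_int k" 3] unfolding k by blast+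
    then have "k \<in> {-1..3}" by simp
    moreover have "\<theta> = \<phi> + k * pi" using k by simp
    ultimately show False using \<theta> by blast
  qed
qed

lemma AE_circ_ne:
  assumes r: "0 < r" shows "AE \<theta> in circ. of_real r * cis \<theta> \<noteq> a"
proof (rule AE_mp[OF AE_circ_sin_shift_nz[of "Arg a"]])
  show "Arg a \<in> {-pi..pi}" using Arg_bounded[of a] by auto
  show "AE \<theta> in circ. sin (\<theta> - Arg a) \<noteq> 0 \<longrightarrow> of_real r * cis \<theta> \<noteq> a"
  proof (intro AE_I2 impI notI)
    fix \<theta> assume nz: "sin (\<theta> - Arg a) \<noteq> 0" and eq: "of_real r * cis \<theta> = a"
    have "r * \<bar>sin (\<theta> - Arg a)\<bar> \<le> cmod (of_real r * cis \<theta> - a)"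
      using r by (intro sin_shift_le_dist) auto
    moreover have "0 < r * \<bar>sin (\<theta> - Arg a)\<bar>" using nz r by simp
    ultimately show False unfolding eq by simp
  qed
qed

text \<open>For an exponent below 1 the singularity on the circle is integrable, with a bound that depends
  neither on the radius nor on the position of \<open>a\<close>. Hence the mean of a sum of such terms over the
  zeros of a function is bounded by a multiple of their number.\<close>
lemma mean_quotient_powr_bounded:
  fixes \<alpha> :: real assumes \<alpha>: "0 < \<alpha>" "\<alpha> < 1"
  obtains K where "K \<ge> 0"
    "\<And>a r. 0 < r \<Longrightarrow> integrable circ (\<lambda>\<theta>. (r / cmod (of_real r * cis \<theta> - a)) powr \<alpha>)"
    "\<And>a r. 0 < r \<Longrightarrow> (\<integral>\<theta>. (r / cmod (of_real r * cis \<theta> - a)) powr \<alpha> \<partial>circ) \<le> K"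
proof -
  obtain K where K: "K \<ge> 0"
    "\<And>\<phi>. \<phi> \<in> {-pi..pi} \<Longrightarrow> (\<integral>\<^sup>+\<theta>. ennreal (\<bar>sin (\<theta> - \<phi>)\<bar> powr -\<alpha>) \<partial>circ) \<le> ennreal K"
    using mean_sin_powr_bounded[OF \<alpha>] by blast
  have main: "(\<integral>\<^sup>+\<theta>. ennreal ((r / cmod (of_real r * cis \<theta> - a)) powr \<alpha>) \<partial>circ) \<le> ennreal K"
    if r: "0 < r" for a r
  proof -
    have Arg: "Arg a \<in> {-pi..pi}" using Arg_bounded[of a] by auto
    have "(\<integral>\<^sup>+\<theta>. ennreal ((r / cmod (of_real r * cis \<theta> - a)) powr \<alpha>) \<partial>circ)
        \<le> (\<integral>\<^sup>+\<theta>. ennreal (\<bar>sin (\<theta> - Arg a)\<bar> powr -\<alpha>) \<partial>circ)"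
    proof (rule nn_integral_mono_AE, rule AE_mp[OF AE_circ_sin_shift_nz[OF Arg]], intro AE_I2 impI ennreal_leI)
      fix \<theta> assume nz: "sin (\<theta> - Arg a) \<noteq> 0"
      have le: "r * \<bar>sin (\<theta> - Arg a)\<bar> \<le> cmod (of_real r * cis \<theta> - a)"
        using r by (intro sin_shift_le_dist) auto
      moreover have "0 < r * \<bar>sin (\<theta> - Arg a)\<bar>" using nz r by simp
      ultimately have "r / cmod (of_real r * cis \<theta> - a) \<le> r / (r * \<bar>sin (\<theta> - Arg a)\<bar>)"
        using r by (intro divide_left_mono mult_pos_pos) auto
      then have "r / cmod (of_real r * cis \<theta> - a) \<le> 1 / \<bar>sin (\<theta> - Arg a)\<bar>"
        using r by simp
      then have "(r / cmod (of_real r * cis \<theta> - a)) powr \<alpha> \<le> (1 / \<bar>sin (\<theta> - Arg a)\<bar>) powr \<alpha>"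
        using r \<alpha> by (intro powr_mono2) auto
      also have "\<dots> = \<bar>sin (\<theta> - Arg a)\<bar> powr -\<alpha>" by (simp add: powr_divide powr_minus_divide)
      finally show "(r / cmod (of_real r * cis \<theta> - a)) powr \<alpha> \<le> \<bar>sin (\<theta> - Arg a)\<bar> powr -\<alpha>" .
    qed
    also have "\<dots> \<le> ennreal K" using K Arg by blast
    finally show ?thesis .
  qed
  have int: "integrable circ (\<lambda>\<theta>. (r / cmod (of_real r * cis \<theta> - a)) powr \<alpha>)" if "0 < r" for a r
  proof (rule integrableI_bounded)
    show "(\<integral>\<^sup>+\<theta>. ennreal (norm ((r / cmod (of_real r * cis \<theta> - a)) powr \<alpha>)) \<partial>circ) < \<infinity>"
      using main[OF that, of a] by (simp add: order.strict_trans1)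
  qed measurable
  show thesis
  proof (rule that[OF K(1) int])
    fix a :: complex and r :: real assume r: "0 < r"
    have "ennreal (\<integral>\<theta>. (r / cmod (of_real r * cis \<theta> - a)) powr \<alpha> \<partial>circ) \<le> ennreal K"
      using main[OF r, of a] by (subst nn_integral_eq_integral[symmetric]) (auto intro: int[OF r])
    then show "(\<integral>\<theta>. (r / cmod (of_real r * cis \<theta> - a)) powr \<alpha> \<partial>circ) \<le> K" using K by simp
  qed
qed

lemma abs_ln_le_powr_half:
  fixes x :: real assumes "0 \<le> x" shows "\<bar>ln x\<bar> \<le> x + 2 * (1/x) powr (1/2)"
proof (cases "x = 0")
  case False
  then have x: "x > 0" using assms by simp
  have "ln x \<le> x" using ln_le_minus_one[OF x] by simp
  moreover have "- ln x = 2 * ln ((1/x) powr (1/2))" using x by (simp add: ln_powr ln_div)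
  moreover have "ln ((1/x) powr (1/2)) \<le> (1/x) powr (1/2)" using ln_le_minus_one[of "(1/x) powr (1/2)"] x by simp
  moreover have "0 \<le> (1/x) powr (1/2)" by simp
  ultimately show ?thesis using x by linarith
qed simp

lemma integrable_ln_dist:
  assumes r: "0 < r" shows "integrable circ (\<lambda>\<theta>. ln (cmod (of_real r * cis \<theta> - a)))"
proof -
  obtain K where K: "\<And>a r. 0 < r \<Longrightarrow> integrable circ (\<lambda>\<theta>. (r / cmod (of_real r * cis \<theta> - a)) powr (1/2))"
    using mean_quotient_powr_bounded[of "1/2"] by auto
  have "integrable circ (\<lambda>\<theta>. cmod (of_real r * cis \<theta> - a)
      + 2 * (1/r) powr (1/2) * (r / cmod (of_real r * cis \<theta> - a)) powr (1/2))"
    by (intro Bochner_Integration.integrable_add integrable_mult_right K r integrable_circ_continuous continuous_intros)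
  then show ?thesis
  proof (rule Bochner_Integration.integrable_bound, goal_cases)
    case 2
    show ?case
    proof (intro AE_I2)
      fix \<theta>
      have "\<bar>ln (cmod (of_real r * cis \<theta> - a))\<bar> \<le> cmod (of_real r * cis \<theta> - a) + 2 * (1 / cmod (of_real r * cis \<theta> - a)) powr (1/2)"
        by (rule abs_ln_le_powr_half) simp
      also have "(1 / cmod (of_real r * cis \<theta> - a)) powr (1/2) = (1/r) powr (1/2) * (r / cmod (of_real r * cis \<theta> - a)) powr (1/2)"
        using r by (subst powr_mult[symmetric]) auto
      finally show "norm (ln (cmod (of_real r * cis \<theta> - a))) \<le> norm (cmod (of_real r * cis \<theta> - a)
      + 2 * (1/r) powr (1/2) * (r / cmod (of_real r * cis \<theta> - a)) powr (1/2))"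
        by simp
    qed
  qed measurable
qed

text \<open>The integrand is the real part of the principal logarithm, holomorphic on a larger disk, so the mean
  is its value at the centre.\<close>
lemma mean_ln_one_minus:
  assumes r: "0 < r" and b: "cmod b * r < 1"
  shows "integrable circ (\<lambda>\<theta>. ln (cmod (1 - b * (of_real r * cis \<theta>))))"
    and "(\<integral>\<theta>. ln (cmod (1 - b * (of_real r * cis \<theta>))) \<partial>circ) = 0"
proof -
  define R where "R = (if b = 0 then r + 1 else 1 / cmod b)"
  have R: "r < R" using b by (auto simp: R_def field_simps)
  have lt: "cmod (b * z) < 1" if "z \<in> ball 0 R" for z
    using that by (auto simp: R_def norm_mult field_simps split: if_splits)
  have nn: "1 - b * z \<notin> \<real>\<^sub>\<le>\<^sub>0" if "z \<in> ball 0 R" for z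
  proof
    assume "1 - b * z \<in> \<real>\<^sub>\<le>\<^sub>0"
    then have "Re (1 - b * z) \<le> 0" by (auto simp: complex_nonpos_Reals_iff)
    then show False using abs_Re_le_cmod[of "b * z"] lt[OF that] by simp
  qed
  have hol: "(\<lambda>z. Ln (1 - b * z)) holomorphic_on ball 0 R"
    by (intro holomorphic_intros) (use nn in auto)
  have eq: "Re (Ln (1 - b * (of_real r * cis \<theta>))) = ln (cmod (1 - b * (of_real r * cis \<theta>)))" for \<theta>
    using nn[of "of_real r * cis \<theta>"] r R by (subst Re_Ln) (auto simp: norm_mult)
  note mv = mean_value_circle[OF hol r R]
  show "integrable circ (\<lambda>\<theta>. ln (cmod (1 - b * (of_real r * cis \<theta>))))"
    using integrable_Re[OF mv(1)] unfolding eq .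
  show "(\<integral>\<theta>. ln (cmod (1 - b * (of_real r * cis \<theta>))) \<partial>circ) = 0"
    using integral_Re[OF mv(1)] unfolding eq mv(2) by simp
qed

text \<open>Pushing a point of the circle radially outwards increases its distance to every other point of the
  circle. This supplies the dominating function for the limit in the next lemma.\<close>
lemma dist_le_dist_scaled:
  fixes z a :: complex and t :: real
  assumes "cmod z = cmod a" "1 \<le> t" shows "cmod (z - a) \<le> cmod (z - of_real t * a)"
proof (rule power2_le_imp_le)
  have sq: "(cmod (z - of_real s * a))\<^sup>2 = (cmod z)\<^sup>2 - 2 * s * (z \<bullet> a) + s\<^sup>2 * (cmod a)\<^sup>2" for s
  proof -
    have "(cmod (z - s *\<^sub>R a))\<^sup>2 = z \<bullet> z - 2 * s * (z \<bullet> a) + s * s * (a \<bullet> a)"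
      unfolding power2_norm_eq_inner by (simp add: inner_diff inner_commute algebra_simps)
    then show ?thesis by (simp only: scaleR_conv_of_real power2_norm_eq_inner power2_eq_square[of s])
  qed
  have "z \<bullet> a \<le> (cmod a)\<^sup>2"
    using norm_cauchy_schwarz[of z a] assms by (simp add: power2_eq_square)
  then have "2 * (t - 1) * (z \<bullet> a) \<le> 2 * (t - 1) * (cmod a)\<^sup>2" using assms by (intro mult_left_mono) auto
  also have "\<dots> \<le> (t + 1) * (t - 1) * (cmod a)\<^sup>2" using assms by (intro mult_right_mono) auto
  finally have "0 \<le> (t + 1) * (t - 1) * (cmod a)\<^sup>2 - 2 * (t - 1) * (z \<bullet> a)" by simp
  also have "\<dots> = (cmod (z - of_real t * a))\<^sup>2 - (cmod (z - of_real 1 * a))\<^sup>2"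
    unfolding sq by (simp add: algebra_simps power2_eq_square)
  finally show "(cmod (z - a))\<^sup>2 \<le> (cmod (z - of_real t * a))\<^sup>2" by simp
qed simp

text \<open>Inside and outside the circle this is the mean value property. For \<open>a\<close> on the circle the value is
  the limit of the values at \<open>t * a\<close> for \<open>t\<close> decreasing to 1.\<close>
lemma mean_ln_dist:
  assumes r: "0 < r"
  shows "(\<integral>\<theta>. ln (cmod (of_real r * cis \<theta> - a)) \<partial>circ) = ln (max r (cmod a))"
proof -
  have outside: "(\<integral>\<theta>. ln (cmod (of_real r * cis \<theta> - a)) \<partial>circ) = ln (cmod a)" if a: "r < cmod a" for a
  proof -
    have a0: "a \<noteq> 0" using a r by auto
    have nz: "1 - (1/a) * (of_real r * cis \<theta>) \<noteq> 0" for \<theta>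
    proof
      assume "1 - (1/a) * (of_real r * cis \<theta>) = 0"
      then have "a = of_real r * cis \<theta>" using a0 by (simp add: field_simps)
      then have "cmod a = r" using r by (simp add: norm_mult)
      then show False using a by simp
    qed
    have b: "cmod (1/a) * r < 1" using a r a0 by (auto simp: norm_divide field_simps)
    have "ln (cmod (of_real r * cis \<theta> - a)) = ln (cmod a) + ln (cmod (1 - (1/a) * (of_real r * cis \<theta>)))" for \<theta>
    proof -
      have "cmod (of_real r * cis \<theta> - a) = cmod (a * (1 - (1/a) * (of_real r * cis \<theta>)))"
        using a0 by (simp add: right_diff_distrib norm_minus_commute)
      then show ?thesis using nz[of \<theta>] a0 by (simp add: norm_mult ln_mult del: mult_cancel_left1)
    qed
    then show ?thesis using mean_ln_one_minus[OF r b] circ.prob_space by simp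
  qed
  consider "cmod a < r" | "r < cmod a" | "cmod a = r" by linarith
  then show ?thesis
  proof cases
    case 1
    let ?b = "cnj a / of_real r"
    have nz: "1 - ?b * (of_real 1 * cis \<theta>) \<noteq> 0" for \<theta>
    proof
      assume "1 - ?b * (of_real 1 * cis \<theta>) = 0"
      then have "cmod (?b * cis \<theta>) = 1" by (metis eq_iff_diff_eq_0 mult_1 norm_one of_real_1)
      then show False using 1 r by (simp add: norm_mult norm_divide)
    qed
    have b: "cmod ?b * 1 < 1" using 1 r by (simp add: norm_divide)
    have "ln (cmod (of_real r * cis \<theta> - a)) = ln r + ln (cmod (1 - ?b * (of_real 1 * cis \<theta>)))" for \<theta>
    proof -
      have "cmod (of_real r * cis \<theta> - a) = cmod (cis \<theta> * cnj (of_real r * cis \<theta> - a))"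
        by (simp only: norm_mult complex_mod_cnj norm_cis mult_1)
      also have "cis \<theta> * cnj (of_real r * cis \<theta> - a) = of_real r * (1 - ?b * (of_real 1 * cis \<theta>))"
        using r by (simp add: algebra_simps cis_cnj cis_mult)
      finally show ?thesis using nz[of \<theta>] r by (simp add: norm_mult ln_mult)
    qed
    then show ?thesis using mean_ln_one_minus[OF _ b] circ.prob_space 1 by simp
  next
    case 2 then show ?thesis using outside by simp
  next
    case 3
    define t where "t = (\<lambda>i::nat. 1 + 1 / real (Suc i))"
    have t: "1 < t i" "t i \<le> 2" for i by (auto simp: t_def field_simps)
    have tlim: "t \<longlonglongrightarrow> 1 + 0" unfolding t_def by (intro tendsto_intros LIMSEQ_Suc[OF lim_1_over_n])
    have "(\<lambda>i. \<integral>\<theta>. ln (cmod (of_real r * cis \<theta> - of_real (t i) * a)) \<partial>circ)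
        \<longlonglongrightarrow> (\<integral>\<theta>. ln (cmod (of_real r * cis \<theta> - a)) \<partial>circ)"
    proof (rule integral_dominated_convergence[where w="\<lambda>\<theta>. \<bar>ln (cmod (of_real r * cis \<theta> - a))\<bar> + \<bar>ln (3*r)\<bar>"])
      show "integrable circ (\<lambda>\<theta>. \<bar>ln (cmod (of_real r * cis \<theta> - a))\<bar> + \<bar>ln (3*r)\<bar>)"
        using integrable_ln_dist[OF r] by auto
      have ae: "AE \<theta> in circ. of_real r * cis \<theta> \<noteq> a" by (rule AE_circ_ne[OF r])
      then show "AE \<theta> in circ. (\<lambda>i. ln (cmod (of_real r * cis \<theta> - of_real (t i) * a)))
          \<longlonglongrightarrow> ln (cmod (of_real r * cis \<theta> - a))"
      proof (rule AE_mp, intro AE_I2 impI)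
        fix \<theta> assume ne: "of_real r * cis \<theta> \<noteq> a"
        have "(\<lambda>i. ln (cmod (of_real r * cis \<theta> - of_real (t i) * a)))
          \<longlonglongrightarrow> ln (cmod (of_real r * cis \<theta> - of_real (1+0) * a))"
          by (rule tendsto_intros tlim)+ (use ne in auto)
        then show "(\<lambda>i. ln (cmod (of_real r * cis \<theta> - of_real (t i) * a)))
          \<longlonglongrightarrow> ln (cmod (of_real r * cis \<theta> - a))" by simp
      qed
      show "AE \<theta> in circ. norm (ln (cmod (of_real r * cis \<theta> - of_real (t i) * a)))
          \<le> \<bar>ln (cmod (of_real r * cis \<theta> - a))\<bar> + \<bar>ln (3*r)\<bar>" for i
        using ae
      proof (rule AE_mp, intro AE_I2 impI)
        fix \<theta> assume ne: "of_real r * cis \<theta> \<noteq> a"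
        have 1: "cmod (of_real r * cis \<theta> - a) \<le> cmod (of_real r * cis \<theta> - of_real (t i) * a)"
          using 3 t[of i] r by (intro dist_le_dist_scaled) (auto simp: norm_mult)
        have "cmod (of_real r * cis \<theta> - of_real (t i) * a) \<le> cmod (of_real r * cis \<theta>) + cmod (of_real (t i) * a)"
          by (rule norm_triangle_ineq4)
        also have "\<dots> = r + t i * r" using 3 r t(1)[of i] by (simp add: norm_mult)
        also have "\<dots> \<le> 3 * r" using t(2)[of i] r by (simp add: algebra_simps)
        finally have 2: "cmod (of_real r * cis \<theta> - of_real (t i) * a) \<le> 3 * r" .
        have 0: "0 < cmod (of_real r * cis \<theta> - a)" using ne by simp
        have "ln (cmod (of_real r * cis \<theta> - a)) \<le> ln (cmod (of_real r * cis \<theta> - of_real (t i) * a))"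
          using 0 1 by (subst ln_le_cancel_iff) auto
        moreover have "ln (cmod (of_real r * cis \<theta> - of_real (t i) * a)) \<le> ln (3 * r)"
          using 0 1 2 r by (subst ln_le_cancel_iff) auto
        ultimately show "norm (ln (cmod (of_real r * cis \<theta> - of_real (t i) * a)))
          \<le> \<bar>ln (cmod (of_real r * cis \<theta> - a))\<bar> + \<bar>ln (3*r)\<bar>" by simp
      qed
    qed measurable
    moreover have "(\<integral>\<theta>. ln (cmod (of_real r * cis \<theta> - of_real (t i) * a)) \<partial>circ) = ln (t i * r)" for i
      using outside[of "of_real (t i) * a"] t[of i] 3 r by (simp add: norm_mult)
    moreover have "(\<lambda>i. ln (t i * r)) \<longlonglongrightarrow> ln ((1 + 0) * r)"
      using r by (intro tendsto_intros tlim) auto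
    ultimately have "(\<integral>\<theta>. ln (cmod (of_real r * cis \<theta> - a)) \<partial>circ) = ln ((1 + 0) * r)"
      using LIMSEQ_unique by fastforce
    then show ?thesis using 3 by simp
  qed
qed

text \<open>Jensen's inequality for the logarithm, in the form that the argument needs: the tangent of the
  logarithm at \<open>1 + m\<close> lies above it. The exponent \<open>\<alpha>\<close> is 2 for quadratic means and slightly
  below 1 for the logarithmic derivative.\<close>
lemma mean_log_plus_le:
  fixes \<alpha> m :: real
  assumes \<alpha>: "0 < \<alpha>" and [measurable]: "u \<in> borel_measurable borel" and u: "\<And>\<theta>. 0 \<le> u \<theta>"
    and int: "integrable circ (\<lambda>\<theta>. u \<theta> powr \<alpha>)" and m: "(\<integral>\<theta>. u \<theta> powr \<alpha> \<partial>circ) \<le> m"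
  shows "integrable circ (\<lambda>\<theta>. log_plus (u \<theta>))"
    and "(\<integral>\<theta>. log_plus (u \<theta>) \<partial>circ) \<le> 1/\<alpha> * ln (1 + m)"
proof -
  have m0: "0 \<le> m" using m by (rule order_trans[OF integral_nonneg_AE, rotated]) auto
  have ptw: "log_plus (u \<theta>) \<le> 1/\<alpha> * (ln (1 + m) + (u \<theta> powr \<alpha> - m) / (1 + m))" for \<theta>
  proof -
    have p: "1 + u \<theta> powr \<alpha> > 0" "1 + m > 0" using m0 by (auto intro: add_pos_nonneg)
    then have pos: "0 < (1 + u \<theta> powr \<alpha>) / (1 + m)" by simp
    have "ln (1 + u \<theta> powr \<alpha>) = ln (1 + m) + ln ((1 + u \<theta> powr \<alpha>) / (1 + m))"
      using p by (subst ln_div) auto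
    also have "ln ((1 + u \<theta> powr \<alpha>) / (1 + m)) \<le> (1 + u \<theta> powr \<alpha>) / (1 + m) - 1"
      using pos by (rule ln_le_minus_one)
    also have "\<dots> = (u \<theta> powr \<alpha> - m) / (1 + m)" using m0 by (simp add: field_simps)
    finally have 1: "ln (1 + u \<theta> powr \<alpha>) \<le> ln (1 + m) + (u \<theta> powr \<alpha> - m) / (1 + m)" by simp
    have "\<alpha> * log_plus (u \<theta>) \<le> ln (1 + u \<theta> powr \<alpha>)"
    proof (cases "u \<theta> \<le> 1")
      case True
      then have "log_plus (u \<theta>) = 0" using u[of \<theta>] unfolding log_plus_def
        by (cases "u \<theta> = 0") (auto simp: max_def)
      then show ?thesis by simp
    next
      case False
      then have "\<alpha> * log_plus (u \<theta>) = ln (u \<theta> powr \<alpha>)" by (simp add: log_plus_def ln_powr)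
      also have "\<dots> \<le> ln (1 + u \<theta> powr \<alpha>)" using False by (subst ln_le_cancel_iff) (auto intro: add_pos_nonneg)
      finally show ?thesis .
    qed
    then have "\<alpha> * log_plus (u \<theta>) \<le> ln (1 + m) + (u \<theta> powr \<alpha> - m) / (1 + m)" using 1 by simp
    then show ?thesis using \<alpha> by (simp add: field_simps)
  qed
  have nn: "0 \<le> log_plus x" for x by (simp add: log_plus_def)
  have ptw_norm: "norm (log_plus (u \<theta>)) \<le> norm (1/\<alpha> * (ln (1 + m) + (u \<theta> powr \<alpha> - m) / (1 + m)))" for \<theta>
    using ptw[of \<theta>] nn[of "u \<theta>"] unfolding real_norm_def by linarith
  have intr: "integrable circ (\<lambda>\<theta>. 1/\<alpha> * (ln (1 + m) + (u \<theta> powr \<alpha> - m) / (1 + m)))"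
    using int by auto
  show I: "integrable circ (\<lambda>\<theta>. log_plus (u \<theta>))"
    by (rule Bochner_Integration.integrable_bound[OF intr _ AE_I2[OF ptw_norm]])
       (simp add: log_plus_def)
  have "(\<integral>\<theta>. log_plus (u \<theta>) \<partial>circ) \<le> (\<integral>\<theta>. 1/\<alpha> * (ln (1 + m) + (u \<theta> powr \<alpha> - m) / (1 + m)) \<partial>circ)"
    by (rule integral_mono[OF I intr ptw])
  also have "\<dots> = 1/\<alpha> * (ln (1 + m) + ((\<integral>\<theta>. u \<theta> powr \<alpha> \<partial>circ) - m) / (1 + m))"
    using int circ.prob_space by simp
  also have "\<dots> \<le> 1/\<alpha> * (ln (1 + m) + 0)"
    using \<alpha> m m0 by (intro mult_left_mono add_left_mono) (auto simp: divide_le_0_iff)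
  finally show "(\<integral>\<theta>. log_plus (u \<theta>) \<partial>circ) \<le> 1/\<alpha> * ln (1 + m)" by simp
qed

section \<open>Jensen's formula\<close>

lemma entire_eventually_nz:
  assumes "h holomorphic_on UNIV" "h w \<noteq> 0"
  shows "eventually (\<lambda>z. h z \<noteq> 0) (at a)"
  using non_zero_neighbour_alt[of h UNIV a w] assms by auto

lemma entire_finite_zeros:
  assumes "h holomorphic_on UNIV" "h w \<noteq> 0"
  shows "finite {z \<in> cball 0 r. h z = 0}"
proof (cases "h constant_on UNIV")
  case True
  then have "{z \<in> cball 0 r. h z = 0} = {}" using assms(2) by (force simp: constant_on_def)
  then show ?thesis by (simp only: finite.emptyI)
next
  case False
  then show ?thesis using assms by (intro holomorphic_compact_finite_zeros[of h UNIV]) auto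
qed

lemma entire_zorder_nonneg:
  assumes "h holomorphic_on UNIV" "h w \<noteq> 0"
  shows "0 \<le> zorder h a" and "h a \<noteq> 0 \<Longrightarrow> zorder h a = 0" and "h a = 0 \<Longrightarrow> 1 \<le> zorder h a"
proof -
  have *: "if h a = 0 then 0 < zorder h a else zorder h a = 0"
    using zorder_exist_zero[OF assms(1) open_UNIV connected_UNIV UNIV_I, of a, OF bexI[of _ w]] assms(2)
    by (auto split: if_splits)
  then show "0 \<le> zorder h a" "h a \<noteq> 0 \<Longrightarrow> zorder h a = 0" "h a = 0 \<Longrightarrow> 1 \<le> zorder h a"
    by (auto split: if_splits)
qed

text \<open>The factor is glued from the quotient away from \<open>a\<close> and the local factor at \<open>a\<close>.\<close>
lemma entire_divide_zero:
  assumes h: "h holomorphic_on UNIV" "h w \<noteq> 0"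
  obtains H where "H holomorphic_on UNIV" "\<And>z. h z = (z - a) ^ nat (zorder h a) * H z" "H a \<noteq> 0"
proof -
  let ?n = "nat (zorder h a)" and ?g = "zor_poly h a"
  obtain r where r: "r > 0" "?g holomorphic_on cball a r"
    "\<And>z. z \<in> cball a r \<Longrightarrow> h z = ?g z * (z - a) ^ ?n \<and> ?g z \<noteq> 0"
    using zorder_exist_zero[of h UNIV a] h by (metis UNIV_I connected_UNIV open_UNIV)
  define H where "H = (\<lambda>z. if z = a then ?g a else h z / (z - a) ^ ?n)"
  have 1: "H holomorphic_on ball a r"
    by (rule holomorphic_transform[OF holomorphic_on_subset[OF r(2)]]) (use r(3) in \<open>auto simp: H_def\<close>)
  have "(\<lambda>z. h z / (z - a) ^ ?n) holomorphic_on (UNIV - {a})"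
    by (intro holomorphic_intros holomorphic_on_subset[OF h(1)]) auto
  then have 2: "H holomorphic_on (UNIV - {a})"
    by (rule holomorphic_transform) (auto simp: H_def)
  have "H holomorphic_on (ball a r \<union> (UNIV - {a}))"
    using 1 2 by (intro holomorphic_on_Un) (auto intro: open_delete)
  moreover have "ball a r \<union> (UNIV - {a}) = UNIV" using r(1) by auto
  ultimately show thesis
    using r(1,3) by (intro that[of H]) (auto simp: H_def)
qed

lemma entire_factor_zeros:
  assumes h: "h holomorphic_on UNIV" "h w \<noteq> 0" and "finite Z"
  obtains H where "H holomorphic_on UNIV"
    "\<And>z. h z = (\<Prod>a\<in>Z. (z - a) ^ nat (zorder h a)) * H z" "\<And>a. a \<in> Z \<Longrightarrow> H a \<noteq> 0"
  using \<open>finite Z\<close>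
proof (induction Z arbitrary: thesis rule: finite_induct)
  case empty
  show ?case by (rule empty[of h]) (use h in auto)
next
  case (insert b Z)
  obtain H where H: "H holomorphic_on UNIV"
    "\<And>z. h z = (\<Prod>a\<in>Z. (z - a) ^ nat (zorder h a)) * H z" "\<And>a. a \<in> Z \<Longrightarrow> H a \<noteq> 0"
    using insert.IH by blast
  let ?P = "\<lambda>z. \<Prod>a\<in>Z. (z - a) ^ nat (zorder h a)"
  have Hw: "H w \<noteq> 0" using H(2)[of w] h(2) by auto
  have P: "?P holomorphic_on UNIV" by (intro holomorphic_intros)
  have Pb: "?P b \<noteq> 0" using insert.hyps by auto
  have "zorder (\<lambda>z. ?P z * H z) b = zorder ?P b + zorder H b"
  proof (rule zorder_times_analytic)
    show "eventually (\<lambda>z. ?P z * H z \<noteq> 0) (at b)"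
      using entire_eventually_nz[OF h, of b] by (simp only: H(2)[symmetric])
  qed (use P H(1) in \<open>auto simp: analytic_on_open holomorphic_on_imp_analytic_at\<close>)
  moreover have "(\<lambda>z. ?P z * H z) = h" using H(2) by auto
  ultimately have zo: "zorder H b = zorder h b"
    using entire_zorder_nonneg(2)[OF P Pb Pb] by simp
  obtain H' where H': "H' holomorphic_on UNIV" "\<And>z. H z = (z - b) ^ nat (zorder H b) * H' z" "H' b \<noteq> 0"
    using entire_divide_zero[OF H(1) Hw] by metis
  show ?case
  proof (rule insert.prems[of H'])
    show "h z = (\<Prod>a\<in>insert b Z. (z - a) ^ nat (zorder h a)) * H' z" for z
      using insert.hyps H(2)[of z] H'(2)[of z] by (simp add: zo mult_ac)
    show "H' a \<noteq> 0" if "a \<in> insert b Z" for a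
      using that H'(2,3) H(3) by (metis insertE mult_zero_right)
  qed fact
qed

text \<open>The logarithm of the modulus of the first nonvanishing Taylor coefficient at the origin, the
  constant in Jensen's formula.\<close>
definition ln_lead_coeff :: "(complex \<Rightarrow> complex) \<Rightarrow> real" where
  "ln_lead_coeff h = ln (cmod (zor_poly h 0 0))"

text \<open>Away from the origin, divide the factorization by the power of \<open>z\<close> that belongs to the zero at the
  origin and let \<open>z\<close> tend to 0. Because \<open>ln 0 = 0\<close>, a zero at the origin drops out of the sum.\<close>
lemma ln_lead_coeff_factor:
  assumes h: "h holomorphic_on UNIV" "h w \<noteq> 0" and Z: "finite Z"
    and H: "H holomorphic_on UNIV" "\<And>z. h z = (\<Prod>a\<in>Z. (z - a) ^ nat (zorder h a)) * H z" "H 0 \<noteq> 0"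
  shows "ln_lead_coeff h = (\<Sum>a\<in>Z. of_int (zorder h a) * ln (cmod a)) + ln (cmod (H 0))"
proof -
  let ?n = "nat (zorder h 0)" and ?g = "zor_poly h 0"
  obtain r where r: "r > 0" "?g holomorphic_on cball 0 r"
    "\<And>z. z \<in> cball 0 r \<Longrightarrow> h z = ?g z * (z - 0) ^ ?n \<and> ?g z \<noteq> 0"
    using zorder_exist_zero[of h UNIV 0] h by (metis UNIV_I connected_UNIV open_UNIV)
  define P where "P = (\<lambda>z. \<Prod>a\<in>Z-{0}. (z - a) ^ nat (zorder h a))"
  have split: "(\<Prod>a\<in>Z. (z - a) ^ nat (zorder h a)) = z ^ ?n * P z" for z
  proof (cases "0 \<in> Z")
    case True
    then show ?thesis using Z by (simp add: P_def prod.remove)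
  next
    case False
    then have "h 0 \<noteq> 0" using H(2)[of 0] H(3) Z by simp
    then have "?n = 0" using entire_zorder_nonneg(2)[OF h] by simp
    then show ?thesis using False by (simp add: P_def)
  qed
  have eq: "P z * H z = ?g z" if "z \<in> cball 0 r - {0}" for z
    using r(3)[of z] H(2)[of z] that unfolding split by simp
  have "P 0 * H 0 = ?g 0"
  proof (rule tendsto_unique)
    have "continuous_on UNIV (\<lambda>z. P z * H z)" unfolding P_def
      by (intro continuous_intros holomorphic_on_imp_continuous_on[OF H(1)])
    then have lim1: "((\<lambda>z. P z * H z) \<longlongrightarrow> P 0 * H 0) (at 0)"
      by (auto simp: continuous_on_eq_continuous_at isCont_def)
    have "isCont ?g 0"
      using holomorphic_on_imp_continuous_on[OF r(2)] r(1) by (intro continuous_on_interior) auto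
    then show "(?g \<longlongrightarrow> ?g 0) (at 0)" by (rule isContD)
    have "eventually (\<lambda>z. z \<in> ball 0 r - {0}) (at 0)"
      using r(1) by (intro eventually_at_in_open) auto
    then have "eventually (\<lambda>z. P z * H z = ?g z) (at 0)"
      by eventually_elim (use eq in auto)
    with lim1 show "(?g \<longlongrightarrow> P 0 * H 0) (at 0)" by (rule Lim_transform_eventually)
  qed simp
  then have "ln_lead_coeff h = ln (cmod (P 0)) + ln (cmod (H 0))"
    using H(3) Z by (simp add: ln_lead_coeff_def norm_mult ln_mult P_def flip: \<open>P 0 * H 0 = ?g 0\<close>)
  also have "ln (cmod (P 0)) = (\<Sum>a\<in>Z-{0}. ln (cmod ((0 - a) ^ nat (zorder h a))))"
    unfolding P_def prod_norm[symmetric] using Z by (subst ln_prod) auto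
  also have "\<dots> = (\<Sum>a\<in>Z-{0}. of_int (zorder h a) * ln (cmod a))"
    using entire_zorder_nonneg(1)[OF h] by (intro sum.cong) (auto simp: norm_power ln_realpow)
  also have "\<dots> = (\<Sum>a\<in>Z. of_int (zorder h a) * ln (cmod a))"
    using Z by (intro sum.mono_neutral_left) auto
  finally show ?thesis .
qed

lemma entire_AE_circ_nz:
  assumes h: "h holomorphic_on UNIV" "h w \<noteq> 0" and r: "0 < r"
  shows "AE \<theta> in circ. h (of_real r * cis \<theta>) \<noteq> 0"
proof -
  have "AE \<theta> in circ. \<forall>a\<in>{z \<in> cball 0 r. h z = 0}. of_real r * cis \<theta> \<noteq> a"
    by (intro AE_finite_allI entire_finite_zeros[OF h] AE_circ_ne r)
  moreover have "of_real r * cis \<theta> \<in> cball 0 r" for \<theta> using r by (simp add: norm_mult)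
  ultimately show ?thesis by (elim eventually_mono) blast
qed

lemma entire_circle_measurable:
  assumes "h holomorphic_on UNIV" shows "(\<lambda>\<theta>. h (of_real r * cis \<theta>)) \<in> borel_measurable borel"
  by (intro borel_measurable_continuous_onI continuous_on_compose2[OF holomorphic_on_imp_continuous_on[OF assms]]
      continuous_intros) auto

text \<open>Jensen's counting function as a finite sum. By the convention \<open>ln 0 = 0\<close> a zero of order \<open>m\<close> at the
  origin contributes \<open>m * ln r\<close>, which is its contribution in the classical definition.\<close>
definition zero_sum :: "(complex \<Rightarrow> complex) \<Rightarrow> real \<Rightarrow> real" where
  "zero_sum h r = (\<Sum>a\<in>{z \<in> cball 0 r. h z = 0}. of_int (zorder h a) * (ln r - ln (cmod a)))"

text \<open>Factor out the zeros in the disk of radius \<open>r + 1\<close>. What remains has a holomorphic logarithm there,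
  so its mean is its value at the origin; the linear factors have the means computed above. Zeros on
  the circle itself are covered by the boundary case of those means.\<close>
lemma Jensen_formula:
  assumes h: "h holomorphic_on UNIV" "h w \<noteq> 0" and r: "0 < r"
  shows "integrable circ (\<lambda>\<theta>. ln (cmod (h (of_real r * cis \<theta>))))"
    and "(\<integral>\<theta>. ln (cmod (h (of_real r * cis \<theta>))) \<partial>circ) = zero_sum h r + ln_lead_coeff h"
proof -
  let ?z = "\<lambda>\<theta>. of_real r * cis \<theta>"
  define Z where "Z = {z \<in> cball 0 (r+1). h z = 0}"
  have Z: "finite Z" unfolding Z_def by (rule entire_finite_zeros[OF h])
  obtain H where H: "H holomorphic_on UNIV"
    "\<And>z. h z = (\<Prod>a\<in>Z. (z - a) ^ nat (zorder h a)) * H z" "\<And>a. a \<in> Z \<Longrightarrow> H a \<noteq> 0"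
    using entire_factor_zeros[OF h Z] by blast
  have Hnz: "H z \<noteq> 0" if "z \<in> cball 0 (r+1)" for z
    using that H(2)[of z] H(3)[of z] by (auto simp: Z_def)
  obtain q where q: "q holomorphic_on ball 0 (r+1)" "\<And>z. z \<in> ball 0 (r+1) \<Longrightarrow> exp (q z) = H z"
    by (rule holomorphic_logarithm_exists[of "ball 0 (r+1)" H 0])
       (use r Hnz in \<open>auto intro: holomorphic_on_subset[OF H(1)]\<close>)
  have lnH: "ln (cmod (H z)) = Re (q z)" if "z \<in> ball 0 (r+1)" for z
    using q(2)[OF that] by (metis ln_exp norm_exp_eq_Re)
  note mv = mean_value_circle[OF q(1) r, simplified]
  have zin: "?z \<theta> \<in> ball 0 (r+1)" for \<theta> using r by (simp add: norm_mult)
  define F where "F = (\<lambda>\<theta>. (\<Sum>a\<in>Z. of_int (zorder h a) * ln (cmod (?z \<theta> - a))) + Re (q (?z \<theta>)))"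
  have intF: "integrable circ F" unfolding F_def
    by (intro Bochner_Integration.integrable_add Bochner_Integration.integrable_sum
        integrable_mult_right integrable_ln_dist r integrable_Re mv)
  have ae: "AE \<theta> in circ. ln (cmod (h (?z \<theta>))) = F \<theta>"
    using entire_AE_circ_nz[OF h r]
  proof eventually_elim
    case (elim \<theta>)
    have P: "(\<Prod>a\<in>Z. (?z \<theta> - a) ^ nat (zorder h a)) \<noteq> 0" using H(2)[of "?z \<theta>"] elim by auto
    then have fac: "(?z \<theta> - a) ^ nat (zorder h a) \<noteq> 0" if "a \<in> Z" for a using that Z by (metis prod_zero_iff)
    have nz: "H (?z \<theta>) \<noteq> 0" using H(2)[of "?z \<theta>"] elim by auto
    have "ln (cmod (h (?z \<theta>))) = ln (cmod (\<Prod>a\<in>Z. (?z \<theta> - a) ^ nat (zorder h a))) + ln (cmod (H (?z \<theta>)))"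
      using P nz by (subst H(2)) (simp add: norm_mult ln_mult del: prod_zero_iff)
    also have "ln (cmod (H (?z \<theta>))) = Re (q (?z \<theta>))" by (rule lnH[OF zin])
    also have "ln (cmod (\<Prod>a\<in>Z. (?z \<theta> - a) ^ nat (zorder h a)))
        = (\<Sum>a\<in>Z. ln (cmod ((?z \<theta> - a) ^ nat (zorder h a))))"
      unfolding prod_norm[symmetric] using Z fac by (subst ln_prod) auto
    also have "\<dots> = (\<Sum>a\<in>Z. of_int (zorder h a) * ln (cmod (?z \<theta> - a)))"
    proof (intro sum.cong refl)
      fix a assume a: "a \<in> Z"
      then have "1 \<le> zorder h a" using entire_zorder_nonneg(3)[OF h] by (simp add: Z_def)
      then have "?z \<theta> - a \<noteq> 0" using fac[OF a] by (auto simp: power_0_left)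
      then show "ln (cmod ((?z \<theta> - a) ^ nat (zorder h a))) = of_int (zorder h a) * ln (cmod (?z \<theta> - a))"
        using \<open>1 \<le> zorder h a\<close> by (simp add: norm_power ln_realpow)
    qed
    finally show ?case unfolding F_def .
  qed
  have [measurable]: "(\<lambda>\<theta>. h (?z \<theta>)) \<in> borel_measurable borel" by (rule entire_circle_measurable[OF h(1)])
  have [measurable]: "F \<in> borel_measurable borel" using intF by (auto dest: borel_measurable_integrable)
  show "integrable circ (\<lambda>\<theta>. ln (cmod (h (?z \<theta>))))"
    using intF by (subst integrable_cong_AE[OF _ _ ae]) auto
  have "(\<integral>\<theta>. ln (cmod (h (?z \<theta>))) \<partial>circ) = (\<integral>\<theta>. F \<theta> \<partial>circ)"
    by (rule integral_cong_AE[OF _ _ ae]) auto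
  also have "\<dots> = (\<Sum>a\<in>Z. of_int (zorder h a) * (\<integral>\<theta>. ln (cmod (?z \<theta> - a)) \<partial>circ)) + Re (\<integral>\<theta>. q (?z \<theta>) \<partial>circ)"
    unfolding F_def using integrable_ln_dist[OF r] mv(1) by (simp add: integral_Re)
  also have "\<dots> = (\<Sum>a\<in>Z. of_int (zorder h a) * ln (max r (cmod a))) + ln (cmod (H 0))"
    using r lnH[of 0] by (simp add: mean_ln_dist mv(2))
  also have "(\<Sum>a\<in>Z. of_int (zorder h a) * ln (max r (cmod a)))
    = (\<Sum>a\<in>Z. (if cmod a \<le> r then of_int (zorder h a) * (ln r - ln (cmod a)) else 0) + of_int (zorder h a) * ln (cmod a))"
    by (intro sum.cong) (auto simp: max_def algebra_simps)
  also have "\<dots> = zero_sum h r + (\<Sum>a\<in>Z. of_int (zorder h a) * ln (cmod a))"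
    unfolding sum.distrib zero_sum_def
    by (rule arg_cong2[of _ _ _ _ "(+)", OF sum.mono_neutral_cong_right[OF Z]]) (auto simp: Z_def)
  also have "\<dots> + ln (cmod (H 0)) = zero_sum h r + ln_lead_coeff h"
    using ln_lead_coeff_factor[OF h Z H(1,2)] Hnz[of 0] r by simp
  finally show "(\<integral>\<theta>. ln (cmod (h (?z \<theta>))) \<partial>circ) = zero_sum h r + ln_lead_coeff h" .
qed

lemma zero_sum_mono:
  assumes h: "h holomorphic_on UNIV" "h w \<noteq> 0" and r: "0 < r" "r \<le> s"
  shows "zero_sum h r \<le> zero_sum h s"
proof -
  let ?Z = "\<lambda>r. {z \<in> cball 0 r. h z = 0}"
  have "zero_sum h r \<le> (\<Sum>a\<in>?Z r. of_int (zorder h a) * (ln s - ln (cmod a)))"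
    unfolding zero_sum_def using r entire_zorder_nonneg(1)[OF h] by (intro sum_mono mult_left_mono) auto
  also have "\<dots> \<le> zero_sum h s" unfolding zero_sum_def
  proof (rule sum_mono2[OF entire_finite_zeros[OF h]])
    fix a assume a: "a \<in> ?Z s - ?Z r"
    then have "0 < cmod a" "cmod a \<le> s" using r by auto
    then have "ln (cmod a) \<le> ln s" using r by (subst ln_le_cancel_iff) auto
    then show "0 \<le> of_int (zorder h a) * (ln s - ln (cmod a))"
      using entire_zorder_nonneg(1)[OF h] by (intro mult_nonneg_nonneg) auto
  qed (use r in auto)
  finally show ?thesis .
qed

text \<open>Each zero in the smaller disk contributes at least \<open>ln (s / r)\<close>; for the origin this uses
  \<open>1 \<le> r\<close>.\<close>
lemma zero_sum_ge_count:
  assumes h: "h holomorphic_on UNIV" "h w \<noteq> 0" and r: "1 \<le> r" "r \<le> s"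
  shows "zero_count r h * ln (s / r) \<le> zero_sum h s"
proof -
  let ?Z = "\<lambda>r. {z \<in> cball 0 r. h z = 0}"
  have "zero_count r h * ln (s / r) \<le> (\<Sum>a\<in>?Z r. of_int (zorder h a) * (ln s - ln (cmod a)))"
    unfolding zero_count_def sum_distrib_right
  proof (intro sum_mono mult_left_mono)
    fix a assume a: "a \<in> ?Z r"
    have "ln (cmod a) \<le> ln r" using a r by (cases "a = 0") auto
    then show "ln (s / r) \<le> ln s - ln (cmod a)" using r by (simp add: ln_div)
  qed (use entire_zorder_nonneg(1)[OF h] in auto)
  also have "\<dots> \<le> zero_sum h s" unfolding zero_sum_def
  proof (rule sum_mono2[OF entire_finite_zeros[OF h]])
    fix a assume a: "a \<in> ?Z s - ?Z r"
    then have "0 < cmod a" "cmod a \<le> s" using r by auto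
    then have "ln (cmod a) \<le> ln s" using r by (subst ln_le_cancel_iff) auto
    then show "0 \<le> of_int (zorder h a) * (ln s - ln (cmod a))"
      using entire_zorder_nonneg(1)[OF h] by (intro mult_nonneg_nonneg) auto
  qed (use r in auto)
  finally show ?thesis .
qed

lemma set_integral_inverse_from:
  fixes \<rho> r :: real assumes "0 < \<rho>" "\<rho> \<le> r"
  shows "set_integrable lborel {0..r} (\<lambda>t. if \<rho> \<le> t then 1 / t else 0)"
    and "(LBINT t:{0..r}. (if \<rho> \<le> t then 1 / t else 0)) = ln r - ln \<rho>"
proof -
  have eq: "(\<lambda>t. indicat_real {0..r} t *\<^sub>R (if \<rho> \<le> t then 1 / t else 0)) = (\<lambda>t. indicat_real {\<rho>..r} t *\<^sub>R (1/t))"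
    using assms by (auto simp: indicator_def)
  have c: "continuous_on {\<rho>..r} (\<lambda>t. 1/t)" using assms by (intro continuous_intros) auto
  have si: "set_integrable lborel {\<rho>..r} (\<lambda>t. 1/t)"
    unfolding set_integrable_def using c by (intro borel_integrable_compact) auto
  then show "set_integrable lborel {0..r} (\<lambda>t. if \<rho> \<le> t then 1 / t else 0)"
    unfolding set_integrable_def eq .
  have "((\<lambda>t. 1/t) has_integral (ln r - ln \<rho>)) {\<rho>..r}"
    using assms by (intro fundamental_theorem_of_calculus)
      (auto simp: has_real_derivative_iff_has_vector_derivative[symmetric] intro!: derivative_eq_intros)
  then have "(LBINT t:{\<rho>..r}. 1/t) = ln r - ln \<rho>"
    using set_borel_integral_eq_integral(2)[OF si] by (simp add: integral_unique)
  then show "(LBINT t:{0..r}. (if \<rho> \<le> t then 1 / t else 0)) = ln r - ln \<rho>"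
    unfolding set_lebesgue_integral_def eq .
qed

text \<open>The counting function is a step function; integrate it zero by zero.\<close>
lemma nevanlinna_N0_eq_zero_sum:
  assumes h: "h holomorphic_on UNIV" "h w \<noteq> 0" and r: "0 < r"
  shows "nevanlinna_N0 r h = zero_sum h r"
proof -
  let ?Z = "\<lambda>r. {z \<in> cball 0 r. h z = 0}"
  let ?f = "\<lambda>a t. of_int (zorder h a) * (if cmod a \<le> t then 1 / t else 0)"
  have fin: "finite (?Z r - {0})" using entire_finite_zeros[OF h] by auto
  have count: "zero_count t h = zero_count 0 h + (\<Sum>a\<in>?Z t - {0}. of_int (zorder h a))" if "0 \<le> t" for t
  proof (cases "h 0 = 0")
    case True
    then show ?thesis using that unfolding zero_count_def
      using entire_finite_zeros[OF h, of t]
      by (subst sum.remove[of _ 0]) (auto cong: conj_cong)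
  next
    case False
    then have Z: "?Z 0 = {}" "?Z t - {0} = ?Z t" by auto
    show ?thesis unfolding zero_count_def Z by simp
  qed
  have "(LBINT t:{0..r}. (zero_count t h - zero_count 0 h) / t) = (LBINT t:{0..r}. (\<Sum>a\<in>?Z r - {0}. ?f a t))"
  proof (rule set_lebesgue_integral_cong)
    show "\<forall>t. t \<in> {0..r} \<longrightarrow> (zero_count t h - zero_count 0 h) / t = (\<Sum>a\<in>?Z r - {0}. ?f a t)"
    proof (intro allI impI)
      fix t assume t: "t \<in> {0..r}"
      have "(zero_count t h - zero_count 0 h) / t = (\<Sum>a\<in>?Z t - {0}. of_int (zorder h a) * (1/t))"
        using t count[of t] by (simp add: sum_divide_distrib)
      also have "\<dots> = (\<Sum>a\<in>?Z r - {0}. ?f a t)"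
        by (intro sum.mono_neutral_cong_left fin) (use t in auto)
      finally show "(zero_count t h - zero_count 0 h) / t = (\<Sum>a\<in>?Z r - {0}. ?f a t)" .
    qed
  qed simp
  also have "\<dots> = (\<Sum>a\<in>?Z r - {0}. LBINT t:{0..r}. ?f a t)"
    using set_integral_inverse_from(1)[of "cmod _" r]
    unfolding set_lebesgue_integral_def set_integrable_def
    by (simp add: scaleR_sum_right del: real_scaleR_def)
       (subst Bochner_Integration.integral_sum, auto simp: mult.left_commute)
  also have "\<dots> = (\<Sum>a\<in>?Z r - {0}. of_int (zorder h a) * (ln r - ln (cmod a)))"
    using set_integral_inverse_from(2)[of "cmod _" r] by (intro sum.cong) auto
  also have "\<dots> + zero_count 0 h * ln r = zero_sum h r"
  proof (cases "h 0 = 0")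
    case True
    then have Z: "?Z 0 = {0}" by auto
    have "zero_sum h r = of_int (zorder h 0) * (ln r - ln (cmod 0))
        + (\<Sum>a\<in>?Z r - {0}. of_int (zorder h a) * (ln r - ln (cmod a)))"
      unfolding zero_sum_def by (rule sum.remove[OF entire_finite_zeros[OF h]]) (use True r in auto)
    then show ?thesis unfolding zero_count_def Z by simp
  next
    case False
    then have Z: "?Z 0 = {}" "?Z r - {0} = ?Z r" by auto
    show ?thesis unfolding zero_count_def zero_sum_def Z by simp
  qed
  finally show ?thesis unfolding nevanlinna_N0_def .
qed

section \<open>The logarithmic derivative on a circle\<close>

text \<open>A one-sided bound for the real part controls the derivative. With \<open>Q = q - q 0\<close> the function
  \<open>Q / (2 * \<Lambda> - Q)\<close> maps the disk into the unit disk and vanishes at the origin, so Schwarz's lemma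
  bounds \<open>Q\<close>; Cauchy's estimate on circles of radius \<open>(R - r) / 2\<close> then bounds the derivative.\<close>
lemma Borel_Caratheodory_deriv:
  assumes q: "q holomorphic_on ball 0 R" and r: "0 < r" "r < R"
    and Re: "\<And>z. z \<in> ball 0 R \<Longrightarrow> Re (q z - q 0) < \<Lambda>" and z: "cmod z \<le> r"
  shows "cmod (deriv q z) \<le> 8 * \<Lambda> * R / (R - r)\<^sup>2"
proof -
  have R: "0 < R" using r by simp
  have \<Lambda>: "0 < \<Lambda>" using Re[of 0] R by simp
  let ?Q = "\<lambda>z. q z - q 0"
  have ne: "of_real (2 * \<Lambda>) - ?Q z \<noteq> 0" if "z \<in> ball 0 R" for z
  proof
    assume "of_real (2 * \<Lambda>) - ?Q z = 0"
    then have "Re (?Q z) = 2 * \<Lambda>" by (metis Re_complex_of_real eq_iff_diff_eq_0)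
    then show False using Re[OF that] \<Lambda> by simp
  qed
  have less: "cmod (?Q z) < cmod (of_real (2 * \<Lambda>) - ?Q z)" if "z \<in> ball 0 R" for z
  proof (rule power2_less_imp_less)
    have "(cmod (of_real (2 * \<Lambda>) - ?Q z))\<^sup>2 - (cmod (?Q z))\<^sup>2 = 4 * \<Lambda> * (\<Lambda> - Re (?Q z))"
      unfolding cmod_power2 by (simp add: power2_eq_square algebra_simps)
    also have "\<dots> > 0" using Re[OF that] \<Lambda> by simp
    finally show "(cmod (?Q z))\<^sup>2 < (cmod (of_real (2 * \<Lambda>) - ?Q z))\<^sup>2" by simp
  qed simp
  define \<phi> where "\<phi> = (\<lambda>w. ?Q (of_real R * w) / (of_real (2 * \<Lambda>) - ?Q (of_real R * w)))"
  have in_ball: "of_real R * w \<in> ball 0 R" if "w \<in> ball 0 1" for w :: complex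
    using that R by (simp add: norm_mult)
  have "(\<lambda>w. q (of_real R * w)) holomorphic_on ball 0 1"
    by (rule holomorphic_on_compose_gen[of "\<lambda>w. of_real R * w" _ q "ball 0 R", unfolded o_def])
       (use q in_ball in \<open>auto intro!: holomorphic_intros\<close>)
  then have hol: "\<phi> holomorphic_on ball 0 1" unfolding \<phi>_def
    by (intro holomorphic_intros) (use ne[OF in_ball] in auto)
  have Schwarz: "cmod (\<phi> w) \<le> cmod w" if "cmod w < 1" for w
  proof (rule Schwarz_Lemma(1)[OF hol _ _ that])
    show "\<phi> 0 = 0" by (simp add: \<phi>_def)
    show "cmod (\<phi> w) < 1" if "cmod w < 1" for w
      using less[OF in_ball, of w] ne[OF in_ball, of w] that by (simp add: \<phi>_def norm_divide divide_less_eq)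
  qed
  have Qle: "cmod (?Q z) \<le> 2 * \<Lambda> * R / (R - cmod z)" if z: "cmod z < R" for z
  proof -
    define s where "s = cmod z / R"
    have s: "0 \<le> s" "s < 1" using z R by (auto simp: s_def)
    have "cmod (\<phi> (z / of_real R)) \<le> s"
      using Schwarz[of "z / of_real R"] z R by (simp add: s_def norm_divide)
    then have "cmod (?Q z) \<le> s * cmod (of_real (2 * \<Lambda>) - ?Q z)"
      using R ne[of z] z by (simp add: \<phi>_def norm_divide divide_le_eq)
    also have "\<dots> \<le> s * (2 * \<Lambda> + cmod (?Q z))"
      using s \<Lambda> norm_triangle_ineq4[of "of_real (2 * \<Lambda>)" "?Q z"] by (intro mult_left_mono) auto
    finally have "cmod (?Q z) * (1 - s) \<le> 2 * \<Lambda> * s" by (simp add: algebra_simps)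
    also have "\<dots> \<le> 2 * \<Lambda> * 1" using s \<Lambda> by (intro mult_left_mono) auto
    finally have "cmod (?Q z) \<le> 2 * \<Lambda> / (1 - s)" using s by (simp add: field_simps)
    also have "\<dots> = 2 * \<Lambda> * R / (R - cmod z)" using R z by (simp add: s_def field_simps)
    finally show ?thesis .
  qed
  define \<rho> where "\<rho> = (R - r) / 2"
  have \<rho>: "\<rho> > 0" using r by (simp add: \<rho>_def)
  have sub: "cball z \<rho> \<subseteq> ball 0 R"
  proof
    fix x assume "x \<in> cball z \<rho>"
    then have "cmod x \<le> r + \<rho>" using z norm_triangle_ineq2[of x z] by (simp add: dist_norm norm_minus_commute)
    then show "x \<in> ball 0 R" using r by (simp add: \<rho>_def field_simps)
  qed
  have holQ: "?Q holomorphic_on ball 0 R" using q by (intro holomorphic_intros)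
  have "cmod ((deriv ^^ 1) ?Q z) \<le> fact 1 * (4 * \<Lambda> * R / (R - r)) / \<rho> ^ 1"
  proof (rule Cauchy_inequality[OF _ _ \<rho>])
    show "?Q holomorphic_on ball z \<rho>"
      using holQ by (rule holomorphic_on_subset) (use sub in force)
    show "continuous_on (cball z \<rho>) ?Q"
      using holomorphic_on_imp_continuous_on[OF holQ] sub by (rule continuous_on_subset)
    fix x assume x: "cmod (z - x) = \<rho>"
    then have "cmod x \<le> r + \<rho>" using z norm_triangle_ineq2[of x z] by (simp add: norm_minus_commute)
    then have le: "(R - r) / 2 \<le> R - cmod x" by (simp add: \<rho>_def field_simps)
    have "cmod (?Q x) \<le> 2 * \<Lambda> * R / (R - cmod x)" using le r by (intro Qle) auto
    also have "\<dots> \<le> 2 * \<Lambda> * R / ((R - r) / 2)"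
      using le r \<Lambda> by (intro divide_left_mono mult_pos_pos) auto
    finally show "cmod (?Q x) \<le> 4 * \<Lambda> * R / (R - r)" by simp
  qed
  also have "(deriv ^^ 1) ?Q z = deriv q z"
  proof -
    have "q field_differentiable at z"
      using q z r by (auto intro: holomorphic_on_imp_differentiable_at)
    then show ?thesis by simp
  qed
  finally show ?thesis using r by (simp add: \<rho>_def power2_eq_square field_simps)
qed

text \<open>With \<open>s = x + y\<close>, a proportion \<open>t / s\<close> is at most its power with exponent at most 1.\<close>
lemma powr_add_le:
  fixes x y \<alpha> :: real assumes "0 \<le> x" "0 \<le> y" "0 < \<alpha>" "\<alpha> \<le> 1"
  shows "(x + y) powr \<alpha> \<le> x powr \<alpha> + y powr \<alpha>"
proof (cases "x + y = 0")
  case False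
  define s where "s = x + y"
  have s: "s > 0" using False assms by (simp add: s_def)
  have *: "t / s * s powr \<alpha> \<le> t powr \<alpha>" if "0 \<le> t" "t \<le> s" for t
  proof -
    have "t / s = (t / s) powr 1" using that s by simp
    also have "\<dots> \<le> (t / s) powr \<alpha>" using that s assms by (intro powr_mono') auto
    finally have "t / s * s powr \<alpha> \<le> (t / s) powr \<alpha> * s powr \<alpha>" by (intro mult_right_mono) auto
    also have "\<dots> = t powr \<alpha>" using that s by (simp add: powr_divide)
    finally show ?thesis .
  qed
  have "s powr \<alpha> = x / s * s powr \<alpha> + y / s * s powr \<alpha>"
    using s by (simp add: s_def flip: distrib_right add_divide_distrib)
  also have "\<dots> \<le> x powr \<alpha> + y powr \<alpha>"
    using assms by (intro add_mono *) (auto simp: s_def)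
  finally show ?thesis by (simp add: s_def)
qed (use assms in simp)

lemma powr_sum_le:
  fixes \<alpha> :: real assumes "finite Z" "\<And>a. a \<in> Z \<Longrightarrow> 0 \<le> x a" "0 < \<alpha>" "\<alpha> \<le> 1"
  shows "(\<Sum>a\<in>Z. x a) powr \<alpha> \<le> (\<Sum>a\<in>Z. x a powr \<alpha>)"
  using assms(1,2)
proof (induction rule: finite_induct)
  case (insert a Z)
  have "(\<Sum>a\<in>insert a Z. x a) powr \<alpha> \<le> x a powr \<alpha> + (\<Sum>a\<in>Z. x a) powr \<alpha>"
    using insert assms by (simp, intro powr_add_le sum_nonneg) auto
  then show ?case using insert by fastforce
qed simp

lemma has_field_derivative_prod_powers:
  assumes "finite Z" "z \<notin> Z"
  shows "((\<lambda>z::complex. \<Prod>a\<in>Z. (z - a) ^ n a) has_field_derivative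
      (\<Prod>a\<in>Z. (z - a) ^ n a) * (\<Sum>a\<in>Z. of_nat (n a) / (z - a))) (at z)"
  using assms
proof (induction rule: finite_induct)
  case (insert b Z)
  have zb: "z - b \<noteq> 0" using insert.prems by auto
  have IH: "((\<lambda>z::complex. \<Prod>a\<in>Z. (z - a) ^ n a) has_field_derivative
      (\<Prod>a\<in>Z. (z - a) ^ n a) * (\<Sum>a\<in>Z. of_nat (n a) / (z - a))) (at z)"
    using insert by auto
  have b: "((\<lambda>z. (z - b) ^ n b) has_field_derivative (z - b) ^ n b * (of_nat (n b) / (z - b))) (at z)"
    by (rule derivative_eq_intros refl)+ (use zb in \<open>cases "n b"; simp add: field_simps\<close>)
  have eq: "(\<lambda>z. \<Prod>a\<in>insert b Z. (z - a) ^ n a) = (\<lambda>z. (z - b) ^ n b * (\<Prod>a\<in>Z. (z - a) ^ n a))"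
    using insert by simp
  show ?case unfolding eq using DERIV_mult[OF b IH] insert by (simp add: algebra_simps)
qed simp

text \<open>A form of the lemma on the logarithmic derivative. In the disk of radius
  \<open>r * exp (\<delta> / 2)\<close> write \<open>h\<close> as a product over its zeros times a zero-free function \<open>exp q\<close>. Jensen's formula bounds the
  number of zeros by a multiple of \<open>L / \<delta>\<close>, the maximum principle together with the
  Borel-Caratheodory estimate bounds the derivative of \<open>q\<close>, and in the mean of the power with exponent
  \<open>\<alpha>\<close> every zero costs a constant. Taking the logarithm leaves \<open>1 / \<alpha>\<close> times \<open>ln L\<close> plus lower order
  terms. As \<open>\<alpha>\<close> may be taken close to 1, the coefficient of \<open>ln L\<close> is as close to 1 as desired.\<close>
lemma mean_log_deriv_le:
  fixes \<alpha> :: real assumes \<alpha>: "0 < \<alpha>" "\<alpha> < 1"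
  obtains D where "D \<ge> 1"
    "\<And>h w r \<delta> L. \<lbrakk>h holomorphic_on UNIV; h w \<noteq> 0; 1 \<le> r; 0 < \<delta>; \<delta> \<le> 1; 1 \<le> L;
        \<And>z. z \<in> cball 0 (r * exp \<delta>) \<Longrightarrow> cmod (h z) \<le> exp L; - L \<le> ln_lead_coeff h\<rbrakk> \<Longrightarrow>
      integrable circ (\<lambda>\<theta>. log_plus (cmod (of_real r * cis \<theta> * deriv h (of_real r * cis \<theta>) / h (of_real r * cis \<theta>)))) \<and>
      (\<integral>\<theta>. log_plus (cmod (of_real r * cis \<theta> * deriv h (of_real r * cis \<theta>) / h (of_real r * cis \<theta>))) \<partial>circ)
        \<le> 1/\<alpha> * ln (D * L / \<delta>^4)"
proof -
  obtain K where K: "K \<ge> 0"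
    "\<And>a r. 0 < r \<Longrightarrow> integrable circ (\<lambda>\<theta>. (r / cmod (of_real r * cis \<theta> - a)) powr \<alpha>)"
    "\<And>a r. 0 < r \<Longrightarrow> (\<integral>\<theta>. (r / cmod (of_real r * cis \<theta> - a)) powr \<alpha> \<partial>circ) \<le> K"
    using mean_quotient_powr_bounded[OF \<alpha>] by blast
  \<comment> \<open>\<open>4 * K\<close> comes from at most \<open>4 * L / \<delta>\<close> zeros, 1408 from \<open>q\<close>, and 1 from the summand 1 under the logarithm.\<close>
  define D where "D = 4 * K + 1409"
  show thesis
  proof (rule that[of D])
    show "D \<ge> 1" using K by (simp add: D_def)
  next
    fix h w r \<delta> L
    assume h: "h holomorphic_on UNIV" "h w \<noteq> 0" and r: "1 \<le> r" and \<delta>: "0 < \<delta>" "\<delta> \<le> 1" and L: "1 \<le> L"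
      and bound: "\<And>z. z \<in> cball 0 (r * exp \<delta>) \<Longrightarrow> cmod (h z) \<le> exp L" and lead: "- L \<le> ln_lead_coeff h"
    let ?z = "\<lambda>\<theta>. of_real r * cis \<theta>"
    define x where "x = exp (\<delta>/2)"
    define R1 where "R1 = r * x"
    define R where "R = R1 * x"
    have x: "1 + \<delta>/2 \<le> x" "x \<le> 2"
    proof -
      show "1 + \<delta>/2 \<le> x" unfolding x_def by (rule exp_ge_add_one_self)
      have "x \<le> exp (1/2)" using \<delta> by (simp add: x_def)
      also have "\<dots> \<le> 2" by (rule exp_half_le2)
      finally show "x \<le> 2" .
    qed
    have x1: "1 < x" using x \<delta> by simp
    have R_eq: "R = r * exp \<delta>" by (simp add: R_def R1_def x_def flip: exp_add)
    have R1: "r < R1" "1 < R1" using r x1 unfolding R1_def by (auto intro: less_le_trans[OF x1] simp: mult_ge1_I)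
    have R: "R1 < R" "1 < R" using R1 x1 unfolding R_def by (auto intro: less_trans[OF R1(2)])
    have gap1: "R1 / (R - R1) \<le> 2 / \<delta>"
    proof -
      have "R1 / (R - R1) = 1 / (x - 1)" using R1 x1 by (simp add: R_def field_simps)
      also have "\<dots> \<le> 1 / (\<delta>/2)" using x \<delta> by (intro divide_left_mono) auto
      finally show ?thesis by simp
    qed
    have gap2: "R1 / (R1 - r) \<le> 4 / \<delta>"
    proof -
      have "R1 / (R1 - r) = x / (x - 1)" using r x1 by (simp add: R1_def field_simps)
      also have "\<dots> \<le> 2 / (\<delta>/2)" using x \<delta> by (intro frac_le) auto
      finally show ?thesis by simp
    qed
    \<comment> \<open>Jensen's formula at radius \<open>R\<close>, read from above, bounds the number of zeros in the disk of radius \<open>R1\<close>.\<close>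
    have "(\<integral>\<theta>. ln (cmod (h (of_real R * cis \<theta>))) \<partial>circ) \<le> (\<integral>\<theta>. L \<partial>circ)"
    proof (rule integral_mono)
      show "integrable circ (\<lambda>\<theta>. ln (cmod (h (of_real R * cis \<theta>))))"
        using R by (intro Jensen_formula(1)[OF h]) auto
      show "ln (cmod (h (of_real R * cis \<theta>))) \<le> L" for \<theta>
      proof (cases "h (of_real R * cis \<theta>) = 0")
        case False
        have "cmod (h (of_real R * cis \<theta>)) \<le> exp L"
          using R r by (intro bound) (auto simp: norm_mult R_eq)
        then show ?thesis using False by (metis ln_exp ln_le_cancel_iff exp_gt_zero zero_less_norm_iff)
      qed (use L in simp)
    qed simp
    then have "zero_sum h R + ln_lead_coeff h \<le> L"
      using Jensen_formula(2)[OF h, of R] R circ.prob_space by simp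
    then have zs: "zero_sum h R \<le> 2 * L" using lead by simp
    define Z where "Z = {z \<in> cball 0 R1. h z = 0}"
    define N where "N = zero_count R1 h"
    have Z: "finite Z" unfolding Z_def by (rule entire_finite_zeros[OF h])
    have ord1: "1 \<le> zorder h a" if "a \<in> Z" for a
      using that entire_zorder_nonneg(3)[OF h] by (simp add: Z_def)
    have N_eq: "N = (\<Sum>a\<in>Z. real (nat (zorder h a)))" unfolding N_def zero_count_def Z_def[symmetric]
    proof (intro sum.cong refl)
      fix a assume "a \<in> Z"
      then show "real_of_int (zorder h a) = real (nat (zorder h a))" using ord1[of a] by simp
    qed
    have "N * ln (R / R1) \<le> zero_sum h R" unfolding N_def
      using R1 R by (intro zero_sum_ge_count[OF h]) auto
    moreover have "ln (R / R1) = \<delta>/2" using R1 by (simp add: R_def x_def)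
    ultimately have N: "N \<le> 4 * L / \<delta>" using zs \<delta> by (simp add: field_simps)
    have N0: "0 \<le> N" unfolding N_eq by (intro sum_nonneg) auto
    \<comment> \<open>The maximum principle bounds the zero-free factor from above; its value at 0 is bounded from below by the leading coefficient of \<open>h\<close>.\<close>
    obtain H where H: "H holomorphic_on UNIV"
      "\<And>z. h z = (\<Prod>a\<in>Z. (z - a) ^ nat (zorder h a)) * H z" "\<And>a. a \<in> Z \<Longrightarrow> H a \<noteq> 0"
      using entire_factor_zeros[OF h Z] by blast
    let ?P = "\<lambda>z. \<Prod>a\<in>Z. (z - a) ^ nat (zorder h a)"
    have Hnz: "H z \<noteq> 0" if "z \<in> cball 0 R1" for z
      using that H(2)[of z] H(3)[of z] by (auto simp: Z_def)
    define n where "n = (\<Sum>a\<in>Z. nat (zorder h a))"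
    have Nn: "N = real n" unfolding N_eq n_def by simp
    have Hmax: "cmod (H z) \<le> exp L / (R - R1) ^ n" if "z \<in> cball 0 R" for z
    proof (rule maximum_modulus_frontier[of H "cball 0 R"])
      show "H holomorphic_on interior (cball 0 R)" "continuous_on (closure (cball 0 R)) H"
        using H(1) by (auto intro: holomorphic_on_subset holomorphic_on_imp_continuous_on)
      fix z :: complex assume "z \<in> frontier (cball 0 R)"
      then have z: "cmod z = R" using R by simp
      have "(R - R1) ^ n = (\<Prod>a\<in>Z. (R - R1) ^ nat (zorder h a))" by (simp add: n_def power_sum)
      also have "\<dots> \<le> cmod (?P z)" unfolding prod_norm[symmetric]
      proof (intro prod_mono conjI)
        fix a assume "a \<in> Z"
        then have "R - R1 \<le> cmod (z - a)" using z norm_triangle_ineq2[of z a] by (simp add: Z_def)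
        then show "(R - R1) ^ nat (zorder h a) \<le> cmod ((z - a) ^ nat (zorder h a))"
          unfolding norm_power using R by (intro power_mono) auto
      qed (use R in auto)
      finally have "cmod (H z) * (R - R1) ^ n \<le> cmod (H z) * cmod (?P z)" by (intro mult_left_mono) auto
      also have "\<dots> = cmod (h z)" by (subst H(2)) (simp add: norm_mult mult.commute)
      also have "\<dots> \<le> exp L" using z by (intro bound) (simp add: R_eq)
      finally show "cmod (H z) \<le> exp L / (R - R1) ^ n" using R by (simp add: field_simps)
    qed (use that in auto)
    have lnHmax: "ln (cmod (H z)) \<le> L - N * ln (R - R1)" if z: "z \<in> cball 0 R1" for z
    proof -
      have "ln (cmod (H z)) \<le> ln (exp L / (R - R1) ^ n)"
        using Hmax[of z] Hnz[OF z] z R R1 by (subst ln_le_cancel_iff) auto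
      also have "\<dots> = L - N * ln (R - R1)" using R by (simp add: ln_div ln_realpow Nn)
      finally show ?thesis .
    qed
    have "ln_lead_coeff h = (\<Sum>a\<in>Z. of_int (zorder h a) * ln (cmod a)) + ln (cmod (H 0))"
      by (rule ln_lead_coeff_factor[OF h Z H(1,2)]) (use Hnz[of 0] R1 in auto)
    also have "(\<Sum>a\<in>Z. of_int (zorder h a) * ln (cmod a)) \<le> (\<Sum>a\<in>Z. of_int (zorder h a) * ln R1)"
    proof (intro sum_mono mult_left_mono)
      fix a assume a: "a \<in> Z"
      show "ln (cmod a) \<le> ln R1" using a R1 by (cases "a = 0") (auto simp: Z_def)
      show "0 \<le> real_of_int (zorder h a)" using ord1[OF a] by simp
    qed
    also have "\<dots> = N * ln R1" unfolding N_def zero_count_def Z_def sum_distrib_right ..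
    finally have lnH0: "- L - N * ln R1 \<le> ln (cmod (H 0))" using lead by simp
    obtain q where q: "q holomorphic_on ball 0 R1" "\<And>z. z \<in> ball 0 R1 \<Longrightarrow> exp (q z) = H z"
      by (rule holomorphic_logarithm_exists[of "ball 0 R1" H 0])
         (use R1 Hnz in \<open>auto intro: holomorphic_on_subset[OF H(1)]\<close>)
    have lnH: "ln (cmod (H z)) = Re (q z)" if "z \<in> ball 0 R1" for z
      using q(2)[OF that] by (metis ln_exp norm_exp_eq_Re)
    \<comment> \<open>The estimate below gives 10; the strict inequality required by the Borel-Caratheodory estimate gives 11.\<close>
    define \<Lambda> where "\<Lambda> = 11 * L / \<delta>\<^sup>2"
    have Re: "Re (q z - q 0) < \<Lambda>" if z: "z \<in> ball 0 R1" for z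
    proof -
      have "Re (q z - q 0) = ln (cmod (H z)) - ln (cmod (H 0))" using lnH[OF z] lnH[of 0] R1 by simp
      also have "\<dots> \<le> (L - N * ln (R - R1)) - (- L - N * ln R1)" using lnHmax[of z] lnH0 z by simp
      also have "\<dots> = 2 * L + N * ln (R1 / (R - R1))" using R R1 by (simp add: ln_div algebra_simps)
      also have "\<dots> \<le> 2 * L + (4 * L / \<delta>) * (2 / \<delta>)"
      proof (intro add_left_mono)
        have "ln (R1 / (R - R1)) \<le> R1 / (R - R1)"
          using ln_le_minus_one[of "R1 / (R - R1)"] R R1 by simp
        then have "N * ln (R1 / (R - R1)) \<le> N * (2 / \<delta>)"
          using gap1 N0 by (intro mult_left_mono) auto
        also have "\<dots> \<le> (4 * L / \<delta>) * (2 / \<delta>)" using N \<delta> by (intro mult_right_mono) auto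
        finally show "N * ln (R1 / (R - R1)) \<le> (4 * L / \<delta>) * (2 / \<delta>)" .
      qed
      also have "2 * L \<le> 2 * (L / \<delta>\<^sup>2)"
      proof -
        have "\<delta>\<^sup>2 \<le> 1" using \<delta> by (simp add: power_le_one)
        then have "L / 1 \<le> L / \<delta>\<^sup>2" using \<delta> L by (intro divide_left_mono) auto
        then show ?thesis by simp
      qed
      also have "2 * (L / \<delta>\<^sup>2) + (4 * L / \<delta>) * (2 / \<delta>) = 10 * (L / \<delta>\<^sup>2)"
        by (simp add: power2_eq_square)
      also have "\<dots> < \<Lambda>" using L \<delta> by (simp add: \<Lambda>_def field_simps)
      finally show ?thesis by simp
    qed
    define Q where "Q = 1408 * L / \<delta>^4"
    have Q1: "1 \<le> Q"
    proof -
      have "\<delta>^4 \<le> 1" using \<delta> by (simp add: power_le_one)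
      then have "\<delta>^4 \<le> 1408 * L" using L by linarith
      then show ?thesis using \<delta> by (simp add: Q_def)
    qed
    have dq: "r * cmod (deriv q z) \<le> Q" if z: "cmod z = r" for z
    proof -
      have "cmod (deriv q z) \<le> 8 * \<Lambda> * R1 / (R1 - r)\<^sup>2"
        by (rule Borel_Caratheodory_deriv[OF q(1) _ _ Re]) (use r R1 z in auto)
      then have "r * cmod (deriv q z) \<le> R1 * (8 * \<Lambda> * R1 / (R1 - r)\<^sup>2)"
        using R1 r by (intro mult_mono) auto
      also have "\<dots> = 8 * \<Lambda> * (R1 / (R1 - r))\<^sup>2" by (simp add: power2_eq_square)
      also have "\<dots> \<le> 8 * \<Lambda> * (4 / \<delta>)\<^sup>2"
        using gap2 R1 r L \<delta> by (intro mult_left_mono power_mono) (auto simp: \<Lambda>_def)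
      also have "\<dots> = Q" using \<delta> by (simp add: \<Lambda>_def Q_def field_simps power2_eq_square power4_eq_xxxx)
      finally show ?thesis .
    qed
    \<comment> \<open>Subadditivity of the power with exponent \<open>\<alpha>\<close> separates the contributions of the zeros and of \<open>q\<close>.\<close>
    define u where "u = (\<lambda>\<theta>. cmod (?z \<theta> * deriv h (?z \<theta>) / h (?z \<theta>)))"
    define G where "G = (\<lambda>\<theta>. (\<Sum>a\<in>Z. real (nat (zorder h a)) * (r / cmod (?z \<theta> - a)) powr \<alpha>) + Q)"
    have uG: "u \<theta> powr \<alpha> \<le> G \<theta>" if nz: "h (?z \<theta>) \<noteq> 0" for \<theta>
    proof -
      let ?w = "?z \<theta>"
      have w: "cmod ?w = r" using r by (simp add: norm_mult)
      have wb: "?w \<in> ball 0 R1" using w R1 by simp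
      have wZ: "?w \<notin> Z" using nz by (auto simp: Z_def)
      have Pw: "?P ?w \<noteq> 0" using nz H(2)[of ?w] by auto
      have Hw: "H ?w \<noteq> 0" using nz H(2)[of ?w] by auto
      have "(q has_field_derivative deriv q ?w) (at ?w)"
        using q(1) wb by (intro holomorphic_derivI[of q "ball 0 R1"]) auto
      then have "((\<lambda>z. exp (q z)) has_field_derivative exp (q ?w) * deriv q ?w) (at ?w)"
        by (rule DERIV_fun_exp)
      then have dH: "(H has_field_derivative H ?w * deriv q ?w) (at ?w)"
        unfolding q(2)[OF wb]
        by (rule has_field_derivative_transform_within_open[of _ _ _ "ball 0 R1"]) (use wb q(2) in auto)
      have "((\<lambda>z. ?P z * H z) has_field_derivative
          (?P ?w * (\<Sum>a\<in>Z. of_nat (nat (zorder h a)) / (?w - a))) * H ?w + H ?w * deriv q ?w * ?P ?w) (at ?w)"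
        by (rule DERIV_mult[OF has_field_derivative_prod_powers[OF Z wZ] dH])
      moreover have "(\<lambda>z. ?P z * H z) = h" using H(2) by auto
      ultimately have "deriv h ?w = (?P ?w * (\<Sum>a\<in>Z. of_nat (nat (zorder h a)) / (?w - a))) * H ?w + H ?w * deriv q ?w * ?P ?w"
        by (simp add: DERIV_imp_deriv)
      then have "deriv h ?w = ((\<Sum>a\<in>Z. of_nat (nat (zorder h a)) / (?w - a)) + deriv q ?w) * h ?w"
        by (subst H(2)) (simp add: algebra_simps)
      then have "?w * deriv h ?w / h ?w = ?w * ((\<Sum>a\<in>Z. of_nat (nat (zorder h a)) / (?w - a)) + deriv q ?w)"
        using nz by simp
      then have "u \<theta> = cmod (?w * ((\<Sum>a\<in>Z. of_nat (nat (zorder h a)) / (?w - a)) + deriv q ?w))"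
        by (simp add: u_def)
      also have "\<dots> = r * cmod ((\<Sum>a\<in>Z. of_nat (nat (zorder h a)) / (?w - a)) + deriv q ?w)"
        unfolding norm_mult[of ?w] w ..
      also have "\<dots> \<le> r * ((\<Sum>a\<in>Z. real (nat (zorder h a)) / cmod (?w - a)) + cmod (deriv q ?w))"
        using r by (intro mult_left_mono norm_triangle_le add_right_mono sum_norm_le) (auto simp: norm_divide)
      also have "\<dots> = (\<Sum>a\<in>Z. real (nat (zorder h a)) * (r / cmod (?w - a))) + r * cmod (deriv q ?w)"
        by (simp add: distrib_left sum_distrib_left mult_ac)
      also have "\<dots> \<le> (\<Sum>a\<in>Z. real (nat (zorder h a)) * (r / cmod (?w - a))) + Q"
        using dq[OF w] by simp
      finally have "u \<theta> powr \<alpha> \<le> ((\<Sum>a\<in>Z. real (nat (zorder h a)) * (r / cmod (?w - a))) + Q) powr \<alpha>"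
        using \<alpha> by (intro powr_mono2) (auto simp: u_def)
      also have "\<dots> \<le> (\<Sum>a\<in>Z. real (nat (zorder h a)) * (r / cmod (?w - a))) powr \<alpha> + Q powr \<alpha>"
        using \<alpha> Q1 r by (intro powr_add_le sum_nonneg) auto
      also have "\<dots> \<le> (\<Sum>a\<in>Z. (real (nat (zorder h a)) * (r / cmod (?w - a))) powr \<alpha>) + Q powr 1"
        using \<alpha> Q1 r Z by (intro add_mono powr_sum_le powr_mono) auto
      also have "\<dots> \<le> G \<theta>" unfolding G_def
      proof (intro add_mono sum_mono)
        fix a assume a: "a \<in> Z"
        have "real (nat (zorder h a)) powr \<alpha> \<le> real (nat (zorder h a)) powr 1"
          using ord1[OF a] \<alpha> by (intro powr_mono) auto
        then show "(real (nat (zorder h a)) * (r / cmod (?w - a))) powr \<alpha>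
            \<le> real (nat (zorder h a)) * (r / cmod (?w - a)) powr \<alpha>"
          using r by (subst powr_mult) (auto intro: mult_right_mono)
      qed (use Q1 in simp)
      finally show ?thesis .
    qed
    have dh: "deriv h holomorphic_on UNIV" using h(1) by (intro holomorphic_deriv) auto
    have [measurable]: "(\<lambda>\<theta>. h (?z \<theta>)) \<in> borel_measurable borel" "(\<lambda>\<theta>. deriv h (?z \<theta>)) \<in> borel_measurable borel"
      by (rule entire_circle_measurable[OF h(1)], rule entire_circle_measurable[OF dh])
    have um [measurable]: "u \<in> borel_measurable borel" unfolding u_def by measurable
    have Gint: "integrable circ G" unfolding G_def using K(2) r by auto
    have Gnn: "0 \<le> G \<theta>" for \<theta> unfolding G_def using Q1 by (intro add_nonneg_nonneg sum_nonneg) auto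
    have ae: "AE \<theta> in circ. u \<theta> powr \<alpha> \<le> G \<theta>"
      using entire_AE_circ_nz[OF h, of r] r uG by (auto elim!: eventually_mono)
    have uint: "integrable circ (\<lambda>\<theta>. u \<theta> powr \<alpha>)"
      by (rule Bochner_Integration.integrable_bound[OF Gint]) (use ae Gnn in \<open>auto elim!: eventually_mono\<close>)
    define m where "m = (4 * K + 1408) * (L / \<delta>^4)"
    have "(\<integral>\<theta>. u \<theta> powr \<alpha> \<partial>circ) \<le> (\<integral>\<theta>. G \<theta> \<partial>circ)"
      by (rule integral_mono_AE[OF uint Gint ae])
    also have "\<dots> = (\<Sum>a\<in>Z. real (nat (zorder h a)) * (\<integral>\<theta>. (r / cmod (?z \<theta> - a)) powr \<alpha> \<partial>circ)) + Q"
      unfolding G_def using K(2) r circ.prob_space by simp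
    also have "\<dots> \<le> (\<Sum>a\<in>Z. real (nat (zorder h a)) * K) + Q"
      using K(3) r by (intro add_right_mono sum_mono mult_left_mono) auto
    also have "\<dots> = N * K + Q" by (simp add: N_eq sum_distrib_right)
    also have "N * K \<le> (4 * L / \<delta>) * K" using N K by (intro mult_right_mono) auto
    also have "\<dots> \<le> 4 * K * (L / \<delta>^4)"
    proof -
      have "\<delta>^4 \<le> \<delta>^1" using \<delta> by (intro power_decreasing) auto
      then have "L / \<delta> \<le> L / \<delta>^4" using \<delta> L by (intro divide_left_mono) auto
      then have "4 * K * (L / \<delta>) \<le> 4 * K * (L / \<delta>^4)" using K by (intro mult_left_mono) auto
      then show ?thesis by (simp add: mult_ac)
    qed
    also have "4 * K * (L / \<delta>^4) + Q = m" by (simp add: m_def Q_def algebra_simps)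
    finally have um_le: "(\<integral>\<theta>. u \<theta> powr \<alpha> \<partial>circ) \<le> m" by simp
    have L1: "1 \<le> L / \<delta>^4"
    proof -
      have "\<delta>^4 \<le> 1" using \<delta> by (simp add: power_le_one)
      then show ?thesis using \<delta> L by simp
    qed
    have "0 \<le> L / \<delta>^4" using L1 by linarith
    then have "0 \<le> m" unfolding m_def using K(1) by (intro mult_nonneg_nonneg) auto
    have "1 + m \<le> L / \<delta>^4 + m" using L1 by simp
    also have "\<dots> = D * (L / \<delta>^4)" unfolding m_def D_def by (simp only: distrib_right)
    finally have "1 + m \<le> D * L / \<delta>^4" by simp
    then have "ln (1 + m) \<le> ln (D * L / \<delta>^4)" using \<open>0 \<le> m\<close> by (subst ln_le_cancel_iff) auto
    then have "1/\<alpha> * ln (1 + m) \<le> 1/\<alpha> * ln (D * L / \<delta>^4)" using \<alpha> by (intro mult_left_mono) auto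
    moreover note mean_log_plus_le[OF \<alpha>(1) um _ uint um_le]
    ultimately show "integrable circ (\<lambda>\<theta>. log_plus (cmod (?z \<theta> * deriv h (?z \<theta>) / h (?z \<theta>)))) \<and>
      (\<integral>\<theta>. log_plus (cmod (?z \<theta> * deriv h (?z \<theta>) / h (?z \<theta>))) \<partial>circ)
        \<le> 1/\<alpha> * ln (D * L / \<delta>^4)"
      unfolding u_def by force
  qed
qed

section \<open>Power series and their quadratic means\<close>

definition entire_coeffs :: "(nat \<Rightarrow> complex) \<Rightarrow> bool" where
  "entire_coeffs c \<longleftrightarrow> (\<forall>r\<ge>0. summable (\<lambda>j. cmod (c j) * r ^ j))"

lemma entire_coeffsD: "entire_coeffs c \<Longrightarrow> 0 \<le> r \<Longrightarrow> summable (\<lambda>j. cmod (c j) * r ^ j)"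
  by (simp add: entire_coeffs_def)

lemma entire_coeffs_summable:
  assumes "entire_coeffs c" shows "summable (\<lambda>j. c j * z ^ j)"
  by (rule summable_norm_cancel) (use entire_coeffsD[OF assms, of "cmod z"] in \<open>simp add: norm_mult norm_power\<close>)

lemma entire_coeffs_sq_summable:
  assumes c: "entire_coeffs c" and r: "0 \<le> r"
  shows "summable (\<lambda>j. (cmod (c j))\<^sup>2 * r ^ (2 * j))"
proof -
  let ?x = "\<lambda>j. cmod (c j) * r ^ j"
  have s: "summable ?x" by (rule entire_coeffsD[OF c r])
  have le: "?x j \<le> suminf ?x" for j
    using sum_le_suminf[OF s, of "{j}"] r by simp
  have "summable (\<lambda>j. (?x j)\<^sup>2)"
  proof (rule summable_comparison_test_ev[OF always_eventually, OF allI])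
    show "norm ((?x j)\<^sup>2) \<le> suminf ?x * ?x j" for j
      using le[of j] r by (simp add: power2_eq_square mult_right_mono del: mult_le_cancel_right)
  qed (intro summable_mult s)
  then show ?thesis by (simp add: power_mult_distrib power_even_eq)
qed

lemma entire_coeffs_of_sums:
  assumes "\<And>z. (\<lambda>j. a j * z ^ j) sums f z" shows "entire_coeffs a"
  unfolding entire_coeffs_def
proof (intro allI impI)
  fix r :: real assume r: "0 \<le> r"
  have "summable (\<lambda>j. a j * of_real (r+1) ^ j)" using assms by (rule sums_summable)
  then have "summable (\<lambda>j. norm (a j * of_real r ^ j))" by (rule powser_insidea) (use r in \<open>simp del: of_real_add\<close>)
  then show "summable (\<lambda>j. cmod (a j) * r ^ j)" using r by (simp add: norm_mult norm_power)
qed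

text \<open>The factor \<open>2 ^ j\<close> absorbs polynomial weights such as the index \<open>j\<close> itself.\<close>
lemma entire_coeffs_dominated:
  assumes a: "entire_coeffs a" and le: "\<And>j. cmod (d j) \<le> K * 2 ^ j * cmod (a j)" shows "entire_coeffs d"
  unfolding entire_coeffs_def
proof (intro allI impI)
  fix r :: real assume r: "0 \<le> r"
  show "summable (\<lambda>j. cmod (d j) * r ^ j)"
  proof (rule summable_comparison_test_ev[OF always_eventually, OF allI])
    show "norm (cmod (d j) * r ^ j) \<le> K * (cmod (a j) * (2 * r) ^ j)" for j
      using mult_right_mono[OF le[of j], of "r ^ j"] r by (simp add: power_mult_distrib mult_ac)
    show "summable (\<lambda>j. K * (cmod (a j) * (2 * r) ^ j))" using r by (intro summable_mult entire_coeffsD a) auto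
  qed
qed

lemma of_nat_le_two_power: "real j \<le> 2 ^ j"
  using less_exp[of j] by (metis less_imp_le of_nat_le_iff of_nat_numeral of_nat_power)

lemma entire_coeffs_index_mult:
  assumes "entire_coeffs a" shows "entire_coeffs (\<lambda>j. of_nat j * a j)"
  by (rule entire_coeffs_dominated[OF assms, of _ 1])
     (simp add: norm_mult mult_right_mono of_nat_le_two_power)

lemma powser_entire:
  assumes d: "entire_coeffs d"
  shows "(\<lambda>z. \<Sum>j. d j * z ^ j) holomorphic_on UNIV"
    and "z * deriv (\<lambda>z. \<Sum>j. d j * z ^ j) z = (\<Sum>j. of_nat j * d j * z ^ j)"
proof -
  let ?g = "\<lambda>z. \<Sum>j. d j * z ^ j"
  have D: "(?g has_field_derivative (\<Sum>j. diffs d j * z ^ j)) (at z)" for z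
    by (intro termdiffs_strong_converges_everywhere entire_coeffs_summable d)
  then show "?g holomorphic_on UNIV"
    by (auto simp: holomorphic_on_def field_differentiable_def intro: DERIV_subset)
  have "summable (\<lambda>j. (of_nat j * d j) * z ^ j)"
    by (intro entire_coeffs_summable entire_coeffs_index_mult d)
  then have "(\<Sum>j. of_nat j * d j * z ^ j) = (\<Sum>j. of_nat (Suc j) * d (Suc j) * z ^ Suc j)"
    by (subst suminf_split_head) (auto simp: mult_ac)
  also have "\<dots> = (\<Sum>j. z * (diffs d j * z ^ j))" by (simp add: diffs_def mult_ac)
  also have "\<dots> = z * (\<Sum>j. diffs d j * z ^ j)"
    by (intro suminf_mult termdiff_converges_all entire_coeffs_summable d)
  finally show "z * deriv ?g z = (\<Sum>j. of_nat j * d j * z ^ j)" using DERIV_imp_deriv[OF D] by simp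
qed

text \<open>On the circle \<open>z * cnj z\<close> is constant, so the integrand is a constant times a power of \<open>z\<close> or of its
  conjugate, and the mean value property applies.\<close>
lemma mean_power_cnj_power:
  assumes r: "0 < r"
  shows "integrable circ (\<lambda>\<theta>. (of_real r * cis \<theta>) ^ i * cnj ((of_real r * cis \<theta>) ^ j))"
    and "(\<integral>\<theta>. (of_real r * cis \<theta>) ^ i * cnj ((of_real r * cis \<theta>) ^ j) \<partial>circ) = (if i = j then of_real (r ^ (2 * i)) else 0)"
proof -
  let ?z = "\<lambda>\<theta>. of_real r * cis \<theta>"
  have zz: "?z \<theta> * cnj (?z \<theta>) = of_real (r\<^sup>2)" for \<theta>
    unfolding complex_norm_square[symmetric] using r by (simp add: norm_mult)
  have mean_power_integrable: "integrable circ (\<lambda>\<theta>. ?z \<theta> ^ i * cnj (?z \<theta> ^ j))" for i j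
    by (intro integrable_circ_continuous continuous_intros)
  then show "integrable circ (\<lambda>\<theta>. ?z \<theta> ^ i * cnj (?z \<theta> ^ j))" .
  have power_split: "z ^ (j + k) * cnj (z ^ j) = (z * cnj z) ^ j * z ^ k" for z :: complex and j k
    by (simp add: power_add power_mult_distrib)
  have main: "(\<integral>\<theta>. ?z \<theta> ^ (j + k) * cnj (?z \<theta> ^ j) \<partial>circ) = (if k = 0 then of_real (r ^ (2 * j)) else 0)" for j k
  proof -
    have "?z \<theta> ^ (j + k) * cnj (?z \<theta> ^ j) = of_real (r ^ (2 * j)) * ?z \<theta> ^ k" for \<theta>
    proof -
      have "?z \<theta> ^ (j + k) * cnj (?z \<theta> ^ j) = (?z \<theta> * cnj (?z \<theta>)) ^ j * ?z \<theta> ^ k"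
        by (rule power_split)
      also have "\<dots> = of_real (r ^ (2 * j)) * ?z \<theta> ^ k" unfolding zz by (simp add: power_mult)
      finally show ?thesis .
    qed
    moreover have "(\<integral>\<theta>. of_real (r ^ (2 * j)) * ?z \<theta> ^ k \<partial>circ) = of_real (r ^ (2 * j)) * 0 ^ k"
      using mean_value_circle(2)[OF holomorphic_on_power[OF holomorphic_on_ident], of r "r+1" k] r
      by (subst integral_mult_right_zero) simp
    ultimately show ?thesis using r circ.prob_space by (cases "k = 0") auto
  qed
  show "(\<integral>\<theta>. ?z \<theta> ^ i * cnj (?z \<theta> ^ j) \<partial>circ) = (if i = j then of_real (r ^ (2 * i)) else 0)"
  proof (cases "j \<le> i")
    case True
    then show ?thesis using main[of j "i - j"] by auto
  next
    case False
    have "(\<integral>\<theta>. ?z \<theta> ^ i * cnj (?z \<theta> ^ j) \<partial>circ) = (\<integral>\<theta>. cnj (?z \<theta> ^ j * cnj (?z \<theta> ^ i)) \<partial>circ)"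
      by (simp add: mult.commute)
    also have "\<dots> = cnj (\<integral>\<theta>. ?z \<theta> ^ j * cnj (?z \<theta> ^ i) \<partial>circ)" by (rule integral_bounded_linear[OF bounded_linear_cnj mean_power_integrable])
    finally show ?thesis using main[of i "j - i"] False by auto
  qed
qed

lemma mean_square_partial_sum:
  assumes r: "0 < r"
  shows "(\<integral>\<theta>. (cmod (\<Sum>j<n. c j * (of_real r * cis \<theta>) ^ j))\<^sup>2 \<partial>circ) = (\<Sum>j<n. (cmod (c j))\<^sup>2 * r ^ (2 * j))"
proof -
  let ?z = "\<lambda>\<theta>. of_real r * cis \<theta>"
  have eq: "complex_of_real ((cmod (\<Sum>j<n. c j * ?z \<theta> ^ j))\<^sup>2)
      = (\<Sum>i<n. \<Sum>j<n. c i * cnj (c j) * (?z \<theta> ^ i * cnj (?z \<theta> ^ j)))" for \<theta>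
    unfolding complex_norm_square by (simp add: sum_product cnj_sum mult_ac)
  have "complex_of_real (\<integral>\<theta>. (cmod (\<Sum>j<n. c j * ?z \<theta> ^ j))\<^sup>2 \<partial>circ)
      = (\<integral>\<theta>. complex_of_real ((cmod (\<Sum>j<n. c j * ?z \<theta> ^ j))\<^sup>2) \<partial>circ)"
    by (rule integral_complex_of_real[symmetric])
  also have "\<dots> = (\<integral>\<theta>. (\<Sum>i<n. \<Sum>j<n. c i * cnj (c j) * (?z \<theta> ^ i * cnj (?z \<theta> ^ j))) \<partial>circ)"
    unfolding eq ..
  also have "\<dots> = (\<Sum>i<n. \<Sum>j<n. c i * cnj (c j) * (\<integral>\<theta>. (?z \<theta> ^ i * cnj (?z \<theta> ^ j)) \<partial>circ))"
  proof -
    have I: "integrable circ (\<lambda>\<theta>. c i * cnj (c j) * (?z \<theta> ^ i * cnj (?z \<theta> ^ j)))" for i j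
      by (intro integrable_mult_right mean_power_cnj_power r)
    have J: "integrable circ (\<lambda>\<theta>. \<Sum>j<n. c i * cnj (c j) * (?z \<theta> ^ i * cnj (?z \<theta> ^ j)))" for i
      by (intro Bochner_Integration.integrable_sum I)
    show ?thesis by (simp only: Bochner_Integration.integral_sum[OF J] Bochner_Integration.integral_sum[OF I] integral_mult_right_zero)
  qed
  also have "\<dots> = (\<Sum>i<n. \<Sum>j<n. c i * cnj (c j) * (if i = j then of_real (r ^ (2 * i)) else 0))"
    by (simp only: mean_power_cnj_power(2)[OF r])
  also have "\<dots> = (\<Sum>i<n. c i * cnj (c i) * of_real (r ^ (2 * i)))"
    by (intro sum.cong refl) (simp add: if_distrib cong: if_cong)
  also have "\<dots> = complex_of_real (\<Sum>j<n. (cmod (c j))\<^sup>2 * r ^ (2 * j))"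
    by (simp add: complex_norm_square[symmetric] del: of_real_power)
  finally show ?thesis by (simp only: of_real_eq_iff)
qed

lemma Parseval_circle:
  assumes c: "entire_coeffs c" and r: "0 < r"
  shows "integrable circ (\<lambda>\<theta>. (cmod (\<Sum>j. c j * (of_real r * cis \<theta>) ^ j))\<^sup>2)"
    and "(\<integral>\<theta>. (cmod (\<Sum>j. c j * (of_real r * cis \<theta>) ^ j))\<^sup>2 \<partial>circ) = (sigma r c)\<^sup>2"
proof -
  let ?z = "\<lambda>\<theta>. of_real r * cis \<theta>"
  let ?s = "\<lambda>n \<theta>. (cmod (\<Sum>j<n. c j * ?z \<theta> ^ j))\<^sup>2"
  let ?g = "\<lambda>\<theta>. (cmod (\<Sum>j. c j * ?z \<theta> ^ j))\<^sup>2"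
  define B where "B = (\<Sum>j. cmod (c j) * r ^ j)"
  have sB: "summable (\<lambda>j. cmod (c j) * r ^ j)" using entire_coeffsD[OF c] r by simp
  have meas: "(\<lambda>\<theta>. \<Sum>j. c j * ?z \<theta> ^ j) \<in> borel_measurable borel"
    by (rule entire_circle_measurable[OF powser_entire(1)[OF c]])
  have lim: "(\<lambda>n. ?s n \<theta>) \<longlonglongrightarrow> ?g \<theta>" for \<theta>
    by (intro tendsto_intros summable_LIMSEQ entire_coeffs_summable c)
  have bd: "norm (?s n \<theta>) \<le> B\<^sup>2" for n \<theta>
  proof -
    have "cmod (\<Sum>j<n. c j * ?z \<theta> ^ j) \<le> (\<Sum>j<n. cmod (c j) * r ^ j)"
      using r by (intro sum_norm_le) (auto simp: norm_mult norm_power)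
    also have "\<dots> \<le> B" unfolding B_def using r by (intro sum_le_suminf sB) auto
    finally show ?thesis by (simp add: power_mono)
  qed
  have msr: "?s n \<in> borel_measurable circ" for n by measurable
  have g: "?g \<in> borel_measurable circ" using meas by simp
  show "integrable circ ?g"
    by (rule integrable_dominated_convergence[OF g msr _ AE_I2[OF lim] AE_I2[OF bd]]) simp
  have "(\<lambda>n. \<integral>\<theta>. ?s n \<theta> \<partial>circ) \<longlonglongrightarrow> (\<integral>\<theta>. ?g \<theta> \<partial>circ)"
    by (rule integral_dominated_convergence[OF g msr _ AE_I2[OF lim] AE_I2[OF bd]]) simp
  then have "(\<lambda>n. \<Sum>j<n. (cmod (c j))\<^sup>2 * r ^ (2 * j)) \<longlonglongrightarrow> (\<integral>\<theta>. ?g \<theta> \<partial>circ)"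
    unfolding mean_square_partial_sum[OF r] .
  moreover have "(\<lambda>n. \<Sum>j<n. (cmod (c j))\<^sup>2 * r ^ (2 * j)) \<longlonglongrightarrow> (\<Sum>j. (cmod (c j))\<^sup>2 * r ^ (2 * j))"
    using r by (intro summable_LIMSEQ entire_coeffs_sq_summable c) auto
  ultimately have "(\<integral>\<theta>. ?g \<theta> \<partial>circ) = (\<Sum>j. (cmod (c j))\<^sup>2 * r ^ (2 * j))" by (rule LIMSEQ_unique)
  also have "\<dots> = (sigma r c)\<^sup>2" unfolding sigma_def
    using r by (subst real_sqrt_pow2) (auto intro!: suminf_nonneg entire_coeffs_sq_summable c)
  finally show "(\<integral>\<theta>. ?g \<theta> \<partial>circ) = (sigma r c)\<^sup>2" .
qed

lemma nevanlinna_T_eq_mean: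
  assumes g: "g holomorphic_on UNIV"
  shows "nevanlinna_T r g = (\<integral>\<theta>. log_plus (cmod (g (of_real r * cis \<theta>))) \<partial>circ)"
proof -
  have [measurable]: "(\<lambda>\<theta>. g (of_real r * cis \<theta>)) \<in> borel_measurable borel"
    by (rule entire_circle_measurable[OF g])
  show ?thesis unfolding nevanlinna_T_def log_plus_def by (subst integral_circ) auto
qed

lemma nevanlinna_T_le_sigma:
  assumes c: "entire_coeffs c" and r: "0 < r"
  shows "nevanlinna_T r (\<lambda>z. \<Sum>j. c j * z ^ j) \<le> 1/2 * ln (1 + (sigma r c)\<^sup>2)"
proof -
  let ?u = "\<lambda>\<theta>. cmod (\<Sum>j. c j * (of_real r * cis \<theta>) ^ j)"
  have hol: "(\<lambda>z. \<Sum>j. c j * z ^ j) holomorphic_on UNIV" by (rule powser_entire(1)[OF c])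
  have meas: "(\<lambda>\<theta>. \<Sum>j. c j * (of_real r * cis \<theta>) ^ j) \<in> borel_measurable borel"
    by (rule entire_circle_measurable[OF hol])
  have pw: "?u \<theta> powr 2 = (?u \<theta>)\<^sup>2" for \<theta> by (rule powr_numeral) simp
  show ?thesis unfolding nevanlinna_T_eq_mean[OF hol]
    by (rule mean_log_plus_le(2)[of 2 ?u, unfolded pw]) (use Parseval_circle[OF c r] meas in auto)
qed

lemma sigma_nonneg: "0 \<le> sigma r c" if "entire_coeffs c" "0 \<le> r"
  unfolding sigma_def using that by (auto intro!: suminf_nonneg entire_coeffs_sq_summable)

lemma coeff_le_sigma:
  assumes c: "entire_coeffs c" and r: "0 \<le> r" shows "cmod (c j) * r ^ j \<le> sigma r c"
proof -
  have "(cmod (c j))\<^sup>2 * r ^ (2 * j) \<le> (\<Sum>j. (cmod (c j))\<^sup>2 * r ^ (2 * j))"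
    using sum_le_suminf[OF entire_coeffs_sq_summable[OF c r], of "{j}"] r by simp
  moreover have "(cmod (c j))\<^sup>2 * r ^ (2 * j) = (cmod (c j) * r ^ j)\<^sup>2"
    by (simp add: power_mult_distrib power_even_eq)
  ultimately show ?thesis unfolding sigma_def by (simp add: real_le_rsqrt)
qed

text \<open>Each term of the series at radius \<open>R\<close> is at most \<open>sigma R c\<close>, so the series at radius \<open>r\<close> is
  dominated by a geometric one.\<close>
lemma abs_series_le_sigma:
  assumes c: "entire_coeffs c" and r: "0 \<le> r" "r < R"
  shows "(\<Sum>j. cmod (c j) * r ^ j) \<le> sigma R c / (1 - r / R)"
proof -
  have q: "0 \<le> r / R" "r / R < 1" using r by auto
  have "(\<Sum>j. cmod (c j) * r ^ j) \<le> (\<Sum>j. sigma R c * (r / R) ^ j)"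
  proof (intro suminf_le entire_coeffsD c r summable_mult summable_geometric)
    fix j
    have "cmod (c j) * r ^ j = (cmod (c j) * R ^ j) * (r / R) ^ j" using r by (simp add: power_divide)
    also have "\<dots> \<le> sigma R c * (r / R) ^ j" using r by (intro mult_right_mono coeff_le_sigma c) auto
    finally show "cmod (c j) * r ^ j \<le> sigma R c * (r / R) ^ j" .
  qed (use q in auto)
  also have "\<dots> = sigma R c / (1 - r / R)"
    using q by (simp add: suminf_mult suminf_geometric summable_geometric)
  finally show ?thesis .
qed

lemma sigma_strict_mono:
  assumes c: "entire_coeffs c" and m: "c m \<noteq> 0" "0 < m" and r: "0 \<le> r" "r < s"
  shows "sigma r c < sigma s c"
  unfolding sigma_def
proof (rule real_sqrt_less_mono)
  let ?f = "\<lambda>r j. (cmod (c j))\<^sup>2 * r ^ (2 * j)"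
  have S: "summable (?f r)" "summable (?f s)" using r by (auto intro!: entire_coeffs_sq_summable c)
  have "0 < (\<Sum>j. ?f s j - ?f r j)"
  proof (rule suminf_pos2[of _ m])
    show "summable (\<lambda>j. ?f s j - ?f r j)" using S by (intro summable_diff)
    show "0 \<le> ?f s j - ?f r j" for j using r by (simp add: mult_left_mono power_mono)
    have "r ^ (2*m) < s ^ (2*m)" using r m by (intro power_strict_mono) auto
    then show "0 < ?f s m - ?f r m" using m by simp
  qed
  also have "\<dots> = suminf (?f s) - suminf (?f r)" using S by (intro suminf_diff[symmetric])
  finally show "suminf (?f r) < suminf (?f s)" by simp
qed

lemma continuous_on_sigma:
  assumes c: "entire_coeffs c" shows "continuous_on {0..} (\<lambda>r. sigma r c)"
proof -
  have "isCont (\<lambda>x::real. \<Sum>j. (cmod (c j))\<^sup>2 * x ^ j) x" for x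
  proof (rule isCont_powser)
    have "summable (\<lambda>j. (cmod (c j))\<^sup>2 * (sqrt (\<bar>x\<bar> + 1)) ^ (2 * j))"
      by (rule entire_coeffs_sq_summable[OF c]) simp
    then show "summable (\<lambda>j. (cmod (c j))\<^sup>2 * (\<bar>x\<bar> + 1) ^ j)" by (simp add: power_mult)
    show "norm x < norm (\<bar>x\<bar> + 1)" by simp
  qed
  then have cont: "continuous_on UNIV (\<lambda>x::real. \<Sum>j. (cmod (c j))\<^sup>2 * x ^ j)"
    by (simp add: continuous_on_eq_continuous_at)
  have sq: "continuous_on {0..} (\<lambda>r::real. r\<^sup>2)" by (intro continuous_intros)
  have "continuous_on {0..} (\<lambda>r. sqrt (\<Sum>j. (cmod (c j))\<^sup>2 * (r\<^sup>2) ^ j))"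
    by (rule continuous_on_real_sqrt, rule continuous_on_compose2[OF cont sq subset_UNIV])
  then show ?thesis unfolding sigma_def by (simp add: power_mult)
qed

lemma sigma_attains_exp:
  assumes c: "entire_coeffs c" "c 0 = 0" and m: "c m \<noteq> 0" "0 < m"
  obtains \<rho> where "\<And>y. 0 < \<rho> y" "\<And>y. sigma (\<rho> y) c = exp y"
proof -
  have "\<exists>r>0. sigma r c = exp y" for y
  proof -
    define R where "R = max 1 (exp y / cmod (c m))"
    have R: "1 \<le> R" by (simp add: R_def)
    have "exp y = cmod (c m) * (exp y / cmod (c m))" using m by simp
    also have "\<dots> \<le> cmod (c m) * R" by (intro mult_left_mono) (auto simp: R_def)
    also have "\<dots> \<le> cmod (c m) * R ^ m"
      using R m self_le_power[of R m] by (intro mult_left_mono) auto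
    also have "\<dots> \<le> sigma R c" using R by (intro coeff_le_sigma c) auto
    finally have up: "exp y \<le> sigma R c" .
    have "(\<lambda>j. (cmod (c j))\<^sup>2 * 0 ^ (2 * j)) = (\<lambda>j. 0)"
      using c(2) by (intro ext) (auto simp: power_0_left)
    then have z: "sigma 0 c = 0" unfolding sigma_def by simp
    have "\<exists>r\<ge>0. r \<le> R \<and> sigma r c = exp y"
      by (rule IVT') (use up z R in \<open>auto intro: continuous_on_subset[OF continuous_on_sigma[OF c(1)]]\<close>)
    then obtain r where r: "0 \<le> r" "sigma r c = exp y" by blast
    then have "r \<noteq> 0" using z by (metis exp_not_eq_zero)
    with r show ?thesis by (intro exI[of _ r]) auto
  qed
  then show thesis using that by metis
qed

section \<open>The characteristic of a power series\<close>

lemma transcendental_coeffs_nonzero: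
  assumes "transcendental_entire f" and sums: "\<And>z. (\<lambda>j. a j * z ^ j) sums f z"
  shows "infinite {j. a j \<noteq> 0}"
proof
  assume fin: "finite {j. a j \<noteq> 0}"
  have "f z = poly (\<Sum>j\<in>{j. a j \<noteq> 0}. monom (a j) j) z" for z
  proof -
    have "(\<lambda>j. a j * z ^ j) sums (\<Sum>j\<in>{j. a j \<noteq> 0}. a j * z ^ j)"
      by (rule sums_finite[OF fin]) auto
    then show ?thesis using sums[of z] by (simp add: sums_unique2 poly_sum poly_monom)
  qed
  then show False using assms(1) unfolding transcendental_entire_def by blast
qed

lemma powser_deriv_nonzero:
  assumes d: "entire_coeffs d" and m: "d m \<noteq> 0" "0 < m"
  obtains w where "w * deriv (\<lambda>z. \<Sum>j. d j * z ^ j) w \<noteq> 0"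
proof -
  let ?F = "\<lambda>z. \<Sum>j. of_nat j * d j * z ^ j"
  have "(\<lambda>j. of_nat j * d j * (z - 0) ^ j) sums ?F z" for z
    using entire_coeffs_summable[OF entire_coeffs_index_mult[OF d], of z] by (simp add: summable_sums)
  moreover have "?F 0 = 0"
    using powser_zero[of "\<lambda>j. of_nat j * d j"] by simp
  ultimately obtain s where s: "0 < s" "\<And>z. z \<in> cball 0 s - {0} \<Longrightarrow> ?F z \<noteq> 0"
    using powser_0_nonzero[of 1 0 "\<lambda>j. of_nat j * d j" ?F m] m by auto
  have "?F (of_real s) \<noteq> 0" using s by (intro s(2)) auto
  then show thesis using that powser_entire(2)[OF d, of "of_real s"] by metis
qed

lemma log_plus_eq_ln_max: "0 \<le> x \<Longrightarrow> log_plus x = ln (max 1 x)"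
  by (cases "x = 0") (auto simp: log_plus_def max_def)

lemma integrable_log_plus_entire:
  assumes g: "g holomorphic_on UNIV"
  shows "integrable circ (\<lambda>\<theta>. log_plus (cmod (g (of_real r * cis \<theta>))))"
proof -
  have gc: "continuous_on UNIV (\<lambda>\<theta>. g (of_real r * cis \<theta>))"
    by (rule continuous_on_compose2[OF holomorphic_on_imp_continuous_on[OF g] _ subset_UNIV])
       (intro continuous_intros)
  show ?thesis unfolding log_plus_eq_ln_max[OF norm_ge_zero]
    by (rule integrable_circ_continuous, intro continuous_intros gc) auto
qed

text \<open>By Jensen's formula the mean of \<open>ln \<bar>g - g 0\<bar>\<close> is at least \<open>ln r\<close> plus a constant, because
  \<open>g - g 0\<close> vanishes at the origin.\<close>
lemma nevanlinna_T_at_top: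
  assumes d: "entire_coeffs d" and m: "d m \<noteq> 0" "0 < m"
  shows "filterlim (\<lambda>r. nevanlinna_T r (\<lambda>z. \<Sum>j. d j * z ^ j)) at_top at_top"
proof -
  define g where "g = (\<lambda>z. \<Sum>j. d j * z ^ j)"
  define h where "h = (\<lambda>z. g z - g 0)"
  have g: "g holomorphic_on UNIV" unfolding g_def by (rule powser_entire(1)[OF d])
  have h: "h holomorphic_on UNIV" unfolding h_def by (intro holomorphic_intros g)
  obtain w where w: "w * deriv g w \<noteq> 0" unfolding g_def using powser_deriv_nonzero[OF d m] .
  obtain w1 where w1: "h w1 \<noteq> 0"
  proof (rule ccontr)
    assume "\<not> thesis"
    then have "g = (\<lambda>_. g 0)" using that unfolding h_def by (intro ext) auto
    then have "deriv g w = 0" by (metis deriv_const)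
    then show False using w by simp
  qed
  have h0: "h 0 = 0" by (simp add: h_def)
  have count: "1 \<le> zero_count 1 h"
  proof -
    have "1 \<le> real_of_int (zorder h 0)" using entire_zorder_nonneg(3)[OF h w1 h0] by simp
    also have "\<dots> \<le> zero_count 1 h" unfolding zero_count_def
      using entire_finite_zeros[OF h w1, of 1] entire_zorder_nonneg(1)[OF h w1] h0
      by (intro member_le_sum[where f="\<lambda>z. real_of_int (zorder h z)"]) auto
    finally show ?thesis .
  qed
  define K where "K = ln 2 + log_plus (cmod (g 0)) - ln_lead_coeff h"
  have low: "ln r - K \<le> nevanlinna_T r g" if r: "1 \<le> r" for r
  proof -
    have r0: "0 < r" using r by simp
    have "1 * ln r \<le> zero_count 1 h * ln r" using count r by (intro mult_right_mono) auto
    also have "\<dots> \<le> zero_sum h r" using zero_sum_ge_count[OF h w1, of 1 r] r by simp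
    finally have "ln r + ln_lead_coeff h \<le> (\<integral>\<theta>. ln (cmod (h (of_real r * cis \<theta>))) \<partial>circ)"
      using Jensen_formula(2)[OF h w1 r0] by simp
    also have "\<dots> \<le> (\<integral>\<theta>. log_plus (cmod (g (of_real r * cis \<theta>))) + (ln 2 + log_plus (cmod (g 0))) \<partial>circ)"
    proof (rule integral_mono)
      show "ln (cmod (h (of_real r * cis \<theta>))) \<le> log_plus (cmod (g (of_real r * cis \<theta>))) + (ln 2 + log_plus (cmod (g 0)))" for \<theta>
      proof (cases "h (of_real r * cis \<theta>) = 0")
        case True
        then show ?thesis by (simp add: log_plus_def add_nonneg_nonneg)
      next
        case False
        let ?a = "max 1 (cmod (g (of_real r * cis \<theta>)))" and ?b = "max 1 (cmod (g 0))"
        have "cmod (h (of_real r * cis \<theta>)) \<le> ?a + ?b"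
          unfolding h_def by (rule order_trans[OF norm_triangle_ineq4]) auto
        also have "\<dots> \<le> ?a * ?b + ?a * ?b"
          using mult_left_mono[of 1 ?b ?a] mult_right_mono[of 1 ?a ?b] by (intro add_mono) auto
        finally have "ln (cmod (h (of_real r * cis \<theta>))) \<le> ln (2 * ?a * ?b)"
          using False by (subst ln_le_cancel_iff) (auto simp: mult_ac)
        also have "\<dots> = ln 2 + ln ?a + ln ?b"
        proof -
          have "0 < ?a" "0 < ?b" by (simp_all add: less_max_iff_disj)
          then show ?thesis by (simp add: ln_mult del: max_less_iff_conj less_max_iff_disj)
        qed
        finally show ?thesis by (simp add: log_plus_eq_ln_max)
      qed
    qed (intro Jensen_formula(1)[OF h w1 r0], intro Bochner_Integration.integrable_add integrable_log_plus_entire[OF g], simp_all)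
    also have "\<dots> = nevanlinna_T r g + (ln 2 + log_plus (cmod (g 0)))"
      unfolding nevanlinna_T_eq_mean[OF g] using integrable_log_plus_entire[OF g] circ.prob_space by simp
    finally show ?thesis by (simp add: K_def)
  qed
  have "filterlim (\<lambda>r::real. ln r - K) at_top at_top" by real_asymp
  then show ?thesis unfolding g_def[symmetric]
    by (rule filterlim_at_top_mono) (use low in \<open>auto intro: eventually_mono[OF eventually_ge_at_top[of 1]]\<close>)
qed

lemma sigma_dominated_sq:
  assumes d: "entire_coeffs d" and b: "entire_coeffs b" and K: "0 \<le> K" "\<And>j. 0 < j \<Longrightarrow> cmod (d j) \<le> K * cmod (b j)"
    and r: "0 \<le> r"
  shows "(sigma r d)\<^sup>2 \<le> (cmod (d 0))\<^sup>2 + K\<^sup>2 * (sigma r b)\<^sup>2"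
proof -
  let ?d = "\<lambda>j. (cmod (d j))\<^sup>2 * r ^ (2 * j)" and ?b = "\<lambda>j. (cmod (b j))\<^sup>2 * r ^ (2 * j)"
  have S: "summable ?d" "summable ?b" using r by (auto intro!: entire_coeffs_sq_summable d b)
  have d0: "(\<Sum>j. if j = 0 then (cmod (d 0))\<^sup>2 else 0) = (cmod (d 0))\<^sup>2" "summable (\<lambda>j. if j = 0 then (cmod (d 0))\<^sup>2 else 0 :: real)"
    using sums_If_finite[of "\<lambda>j. j = 0" "\<lambda>_. (cmod (d 0))\<^sup>2"] by (auto simp: sums_iff)
  have sq: "(sigma r c)\<^sup>2 = (\<Sum>j. (cmod (c j))\<^sup>2 * r ^ (2 * j))" if "entire_coeffs c" for c
    unfolding sigma_def using r that by (subst real_sqrt_pow2) (auto intro!: suminf_nonneg entire_coeffs_sq_summable)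
  have "(sigma r d)\<^sup>2 \<le> (\<Sum>j. (if j = 0 then (cmod (d 0))\<^sup>2 else 0) + K\<^sup>2 * ?b j)"
    unfolding sq[OF d]
  proof (rule suminf_le)
    fix j show "?d j \<le> (if j = 0 then (cmod (d 0))\<^sup>2 else 0) + K\<^sup>2 * ?b j"
    proof (cases "j = 0")
      case False
      have "(cmod (d j))\<^sup>2 \<le> (K * cmod (b j))\<^sup>2" using K False by (intro power_mono) auto
      then have "?d j \<le> (K * cmod (b j))\<^sup>2 * r ^ (2 * j)" using r by (intro mult_right_mono) auto
      then show ?thesis using False by (simp add: power_mult_distrib mult.assoc)
    qed simp
  qed (intro S summable_add d0 summable_mult)+
  also have "\<dots> = (cmod (d 0))\<^sup>2 + K\<^sup>2 * (\<Sum>j. ?b j)"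
    using d0 S by (subst suminf_add[symmetric]) (auto simp: suminf_mult intro: summable_mult)
  finally show ?thesis unfolding sq[OF b] .
qed

text \<open>This is applied with \<open>b j = j * a j\<close> both to \<open>d = a\<close> and to \<open>d j = X j omega * a j\<close>: the factor \<open>j\<close>
  absorbs the linear growth of the random factors, so that \<open>f\<close> and almost every sample obey the same
  bound up to a constant.\<close>
lemma nevanlinna_T_upper_bound:
  assumes d: "entire_coeffs d" and b: "entire_coeffs b" and K: "0 \<le> K" "\<And>j. 0 < j \<Longrightarrow> cmod (d j) \<le> K * cmod (b j)"
    and r: "0 < r" "1 \<le> sigma r b"
  shows "nevanlinna_T r (\<lambda>z. \<Sum>j. d j * z ^ j) \<le> ln (sigma r b) + 1/2 * ln (1 + (cmod (d 0))\<^sup>2 + K\<^sup>2)"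
proof -
  let ?c = "1 + (cmod (d 0))\<^sup>2 + K\<^sup>2"
  have c: "0 < ?c" by (intro add_pos_nonneg) auto
  have "1 + (sigma r d)\<^sup>2 \<le> 1 + ((cmod (d 0))\<^sup>2 + K\<^sup>2 * (sigma r b)\<^sup>2)"
    using sigma_dominated_sq[OF d b K] r by simp
  also have "\<dots> \<le> ?c * (sigma r b)\<^sup>2"
  proof -
    have "1 \<le> (sigma r b)\<^sup>2" using r by (simp add: one_le_power)
    then have "(1 + (cmod (d 0))\<^sup>2) * 1 \<le> (1 + (cmod (d 0))\<^sup>2) * (sigma r b)\<^sup>2" by (intro mult_left_mono) auto
    then show ?thesis by (simp add: algebra_simps)
  qed
  finally have "ln (1 + (sigma r d)\<^sup>2) \<le> ln (?c * (sigma r b)\<^sup>2)"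
    by (subst ln_le_cancel_iff) (use c r in \<open>auto intro!: add_pos_nonneg mult_pos_pos\<close>)
  also have "\<dots> = ln ?c + 2 * ln (sigma r b)" using c r by (simp add: ln_mult ln_realpow)
  finally show ?thesis using nevanlinna_T_le_sigma[OF d r(1)] by simp
qed

section \<open>A lower bound for the counting function\<close>

text \<open>For \<open>\<rho>\<close> inverse to \<open>\<lambda>r. ln (sigma r b)\<close> these are the radii slightly to the left of a radius at which
  \<open>ln (sigma r b)\<close> equals a power of 2. A radius outside of the set can be increased by the factor
  \<open>exp (1 / (k + 1)\<^sup>2)\<close>, where \<open>2 ^ k\<close> is the next of these powers, without passing its radius, so that \<open>ln (sigma r b)\<close>, once it is at least 1, at most doubles.\<close>
definition exceptional_set :: "(real \<Rightarrow> real) \<Rightarrow> real set" where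
  "exceptional_set \<rho> = (\<Union>k::nat. {\<rho> (2^k) * exp (- 1 / (real k + 1)\<^sup>2) .. \<rho> (2^k)})"

text \<open>The logarithmic lengths of the intervals are \<open>1 / (k + 1)\<^sup>2\<close>, hence summable.\<close>
lemma finite_log_measure_exceptional_set:
  assumes \<rho>: "\<And>y. 0 < \<rho> y" shows "finite_log_measure (exceptional_set \<rho>)"
proof -
  define I where "I = (\<lambda>k::nat. {\<rho> (2^k) * exp (- 1 / (real k + 1)\<^sup>2) .. \<rho> (2^k)})"
  have E: "exceptional_set \<rho> = (\<Union>k. I k)" by (simp add: exceptional_set_def I_def)
  have pos: "0 < x" if "x \<in> I k" for x k
    using that \<rho>[of "2^k"] by (auto simp: I_def intro: less_le_trans[rotated])
  have I: "(\<integral>\<^sup>+r. ennreal (1 / r) * indicator (I k) r \<partial>lborel) = ennreal (1 / (real k + 1)\<^sup>2)" for k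
  proof -
    have le: "\<rho> (2^k) * exp (- 1 / (real k + 1)\<^sup>2) \<le> \<rho> (2^k)" using \<rho>[of "2^k"] by simp
    have "(\<integral>\<^sup>+r. ennreal (1 / r) * indicator (I k) r \<partial>lborel)
        = ennreal (ln (\<rho> (2^k)) - ln (\<rho> (2^k) * exp (- 1 / (real k + 1)\<^sup>2)))"
      unfolding I_def
    proof (rule nn_integral_FTC_Icc[OF _ _ _ le])
      fix x assume "x \<in> {\<rho> (2^k) * exp (- 1 / (real k + 1)\<^sup>2) .. \<rho> (2^k)}"
      then have "0 < x" using pos[of x k] by (simp add: I_def)
      then show "(ln has_real_derivative 1 / x) (at x)"
        "0 \<le> 1 / x" by (auto intro!: derivative_eq_intros)
    qed measurable
    also have "ln (\<rho> (2^k)) - ln (\<rho> (2^k) * exp (- 1 / (real k + 1)\<^sup>2)) = 1 / (real k + 1)\<^sup>2"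
      using \<rho>[of "2^k"] by (simp add: ln_mult)
    finally show ?thesis .
  qed
  have sets: "I k \<in> sets borel" for k by (simp add: I_def)
  have "(\<integral>\<^sup>+r. ennreal (1 / r) * indicator (\<Union>k. I k) r \<partial>lebesgue)
      = (\<integral>\<^sup>+r. ennreal (1 / r) * indicator (\<Union>k. I k) r \<partial>lborel)"
    by (rule nn_integral_completion)
  also have "\<dots> \<le> (\<integral>\<^sup>+r. (\<Sum>k. ennreal (1 / r) * indicator (I k) r) \<partial>lborel)"
  proof (intro nn_integral_mono)
    fix r
    show "ennreal (1 / r) * indicator (\<Union>k. I k) r \<le> (\<Sum>k. ennreal (1 / r) * indicator (I k) r)"
    proof (cases "r \<in> (\<Union>k. I k)")
      case True
      then obtain k where "r \<in> I k" by blast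
      then have "ennreal (1 / r) * indicator (\<Union>k. I k) r = (\<Sum>k\<in>{k}. ennreal (1 / r) * indicator (I k) r)"
        using True by simp
      also have "\<dots> \<le> (\<Sum>k. ennreal (1 / r) * indicator (I k) r)" by (rule sum_le_suminf) auto
      finally show ?thesis .
    qed simp
  qed
  also have "\<dots> = (\<Sum>k. \<integral>\<^sup>+r. ennreal (1 / r) * indicator (I k) r \<partial>lborel)"
    using sets by (intro nn_integral_suminf) (auto intro!: borel_measurable_times_ennreal borel_measurable_indicator)
  also have "\<dots> = (\<Sum>k. ennreal (1 / (real k + 1)\<^sup>2))" unfolding I ..
  also have "\<dots> < \<infinity>"
  proof -
    have "summable (\<lambda>k. 1 / real (Suc k) ^ 2)"
      using inverse_power_summable[of 2, where 'a=real] by (subst summable_Suc_iff) (simp add: field_simps)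
    then have "summable (\<lambda>k. 1 / (real k + 1)\<^sup>2)" by (simp add: add.commute)
    then show ?thesis by (subst suminf_ennreal2) auto
  qed
  finally have "(\<integral>\<^sup>+r\<in>(\<Union>k. I k). ennreal (1 / r) \<partial>lebesgue) < \<infinity>" .
  moreover have "(\<Union>k. I k) \<in> sets lebesgue" using sets by (intro sets.countable_UN) auto
  ultimately show ?thesis unfolding finite_log_measure_def E using pos by auto
qed

lemma ln_le_linear:
  fixes x \<epsilon> :: real assumes "0 < x" "0 < \<epsilon>" shows "ln x \<le> \<epsilon> * x - ln \<epsilon>"
  using ln_le_minus_one[of "\<epsilon> * x"] assms by (simp add: ln_mult)

lemma power_of_two_bracket:
  fixes x :: real assumes "1 \<le> x" obtains k :: nat where "x < 2 ^ k" "2 ^ k \<le> 2 * x"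
proof -
  define k where "k = (LEAST k::nat. x < 2 ^ k)"
  have ex: "\<exists>k::nat. x < 2 ^ k" using real_arch_pow[of 2 x] by auto
  have 1: "x < 2 ^ k" unfolding k_def by (rule LeastI_ex[OF ex])
  have "k \<noteq> 0" using 1 assms by (intro notI) simp
  then obtain l where l: "k = Suc l" using not0_implies_Suc by blast
  then have "\<not> x < 2 ^ l" using not_less_Least[of l "\<lambda>k. x < 2 ^ k"] by (simp add: k_def)
  then have "2 ^ k \<le> 2 * x" by (simp add: l)
  with 1 show thesis by (rule that)
qed

lemma one_minus_exp_ge:
  fixes x :: real assumes "0 \<le> x" "x \<le> 1" shows "x / 2 \<le> 1 - exp (- x)"
proof -
  have "1 / exp x \<le> 1 / (1 + x)" using assms exp_ge_add_one_self[of x] by (intro divide_left_mono) auto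
  then have "exp (- x) \<le> 1 / (1 + x)" by (simp add: exp_minus field_simps)
  moreover have "1 - 1 / (1 + x) = x / (1 + x)" using assms by (simp add: field_simps)
  moreover have "x / 2 \<le> x / (1 + x)" using assms by (intro divide_left_mono) auto
  ultimately show ?thesis by linarith
qed

text \<open>The powers of \<open>k + 1\<close> come from the distances \<open>\<delta>\<close>; as \<open>k\<close> is at most of order \<open>ln y\<close>, their
  logarithm costs only a small multiple of \<open>ln y\<close> and a constant.\<close>
lemma log_deriv_remainder_bound:
  fixes D M \<eta> :: real
  assumes \<eta>: "0 < \<eta>" and D: "1 \<le> D" "1 \<le> M"
  obtains K where "\<And>k y. 1 \<le> y \<Longrightarrow> 2 ^ k \<le> 2 * y \<Longrightarrow>
    (1 + \<eta>/2) * ln (D * (M * 2 ^ k) / (1 / (2 * (real k + 1)\<^sup>2)) ^ 4) \<le> (1 + \<eta>) * ln y + K"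
proof -
  define \<epsilon> where "\<epsilon> = \<eta> * ln 2 / (16 * (1 + \<eta>/2))"
  have \<epsilon>: "\<epsilon> > 0" using \<eta> by (simp add: \<epsilon>_def)
  define K where "K = (1 + \<eta>/2) * (ln (16 * D * M) - 8 * ln \<epsilon>) + \<eta>/2 * ln 2 + (1 + \<eta>) * ln 2"
  show thesis
  proof (rule that[of K])
    fix k :: nat and y :: real assume y: "1 \<le> y" "2 ^ k \<le> 2 * y"
    have "ln (2 ^ k) \<le> ln (2 * y)" using y by (subst ln_le_cancel_iff) auto
    then have ky: "k * ln 2 \<le> ln 2 + ln y" using y by (simp add: ln_realpow ln_mult)
    have "D * (M * 2 ^ k) / (1 / (2 * (real k + 1)\<^sup>2)) ^ 4 = (16 * D * M) * 2 ^ k * (real k + 1) ^ 8"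
      by (simp add: power_divide power_mult_distrib flip: power_mult)
    also have "ln \<dots> = ln (16 * D * M) + k * ln 2 + 8 * ln (real k + 1)"
      using D by (simp add: ln_mult ln_realpow)
    also have "8 * ln (real k + 1) \<le> 8 * (\<epsilon> * (real k + 1) - ln \<epsilon>)"
      using ln_le_linear[of "real k + 1" \<epsilon>] \<epsilon> by simp
    finally have "(1 + \<eta>/2) * ln (D * (M * 2 ^ k) / (1 / (2 * (real k + 1)\<^sup>2)) ^ 4)
      \<le> (1 + \<eta>/2) * (ln (16 * D * M) + k * ln 2 + 8 * (\<epsilon> * (real k + 1) - ln \<epsilon>))"
      using \<eta> by (intro mult_left_mono) auto
    also have "\<dots> = (1 + \<eta>/2) * (ln (16 * D * M) - 8 * ln \<epsilon>) + (1 + \<eta>/2) * (k * ln 2)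
        + 8 * ((1 + \<eta>/2) * \<epsilon>) * (real k + 1)"
      by (simp add: algebra_simps)
    also have "8 * ((1 + \<eta>/2) * \<epsilon>) = \<eta>/2 * ln 2" using \<eta> by (simp add: \<epsilon>_def field_simps)
    also have "(1 + \<eta>/2) * (ln (16 * D * M) - 8 * ln \<epsilon>) + (1 + \<eta>/2) * (k * ln 2) + \<eta>/2 * ln 2 * (real k + 1)
      = (1 + \<eta>/2) * (ln (16 * D * M) - 8 * ln \<epsilon>) + \<eta>/2 * ln 2 + (1 + \<eta>) * (k * ln 2)"
      by (simp add: field_simps)
    also have "(1 + \<eta>) * (k * ln 2) \<le> (1 + \<eta>) * (ln 2 + ln y)" using ky \<eta> by (intro mult_left_mono) auto
    finally show "(1 + \<eta>/2) * ln (D * (M * 2 ^ k) / (1 / (2 * (real k + 1)\<^sup>2)) ^ 4) \<le> (1 + \<eta>) * ln y + K"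
      by (simp add: K_def algebra_simps)
  qed
qed

text \<open>With \<open>h = g - c\<close> the derivative of \<open>h\<close> does not depend on \<open>c\<close>, and pointwise
  \<open>ln \<bar>h\<bar> \<ge> ln \<bar>z h'\<bar> - log_plus \<bar>z h' / h\<bar>\<close>. Averaging over the circle of radius \<open>\<rho> n\<close>, Jensen's formula
  turns the left-hand side into the counting function, the first term on the right is \<open>n\<close> up to the
  integral in the statement, and the second costs \<open>(1 + \<eta>) * ln n\<close>. The counting function is
  nondecreasing, so the bound at \<open>\<rho> n\<close> serves for all \<open>r\<close> up to \<open>\<rho> (n + 1)\<close> at the cost of 1. This is
  what reduces the probabilistic input to a sequence of radii. The radius \<open>r\<close> outside of the
  exceptional set guarantees room to the right of \<open>\<rho> n\<close>, too.\<close>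
lemma nevanlinna_N_lower_bound:
  fixes b d :: "nat \<Rightarrow> complex" and \<rho> :: "real \<Rightarrow> real" and c :: complex
  assumes b: "entire_coeffs b" and m: "b m \<noteq> 0" "0 < m"
    and \<rho>: "\<And>y. 0 < \<rho> y" "\<And>y. sigma (\<rho> y) b = exp y"
    and d: "entire_coeffs d" and K: "0 \<le> K" "\<And>j. 0 < j \<Longrightarrow> cmod (d j) \<le> K * cmod (b j)"
    and G: "w * deriv (\<lambda>z. \<Sum>j. d j * z ^ j) w \<noteq> 0" and \<eta>: "0 < \<eta>"
  defines "g \<equiv> \<lambda>z. \<Sum>j. d j * z ^ j"
  obtains K' where "\<And>r n. \<lbrakk>r \<notin> exceptional_set \<rho>; 0 < r; n = nat \<lfloor>ln (sigma r b)\<rfloor>; 1 \<le> n; 1 \<le> \<rho> n\<rbrakk> \<Longrightarrow>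
    ln (sigma r b) - (\<integral>\<theta>. \<bar>ln (cmod (of_real (\<rho> n) * cis \<theta> * deriv g (of_real (\<rho> n) * cis \<theta>) / of_real (exp n)))\<bar> \<partial>circ)
      - (1 + \<eta>) * ln (ln (sigma r b)) - K' \<le> nevanlinna_N r c g"
proof -
  define h where "h = (\<lambda>z. g z - c)"
  have g: "g holomorphic_on UNIV" unfolding g_def by (rule powser_entire(1)[OF d])
  have h: "h holomorphic_on UNIV" unfolding h_def by (intro holomorphic_intros g)
  have dg: "deriv g holomorphic_on UNIV" using g by (intro holomorphic_deriv) auto
  have dh: "deriv h = deriv g"
  proof
    fix z
    have "g field_differentiable at z" using g by (intro holomorphic_on_imp_differentiable_at) auto
    then show "deriv h z = deriv g z" unfolding h_def by simp
  qed
  obtain w1 where w1: "h w1 \<noteq> 0"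
  proof (rule ccontr)
    assume "\<not> thesis"
    then have "h = (\<lambda>_. 0)" using that by auto
    then have "deriv h w = 0" by simp
    then show False using G dh unfolding g_def[symmetric] by simp
  qed
  let ?G = "\<lambda>z. z * deriv g z"
  have holG: "?G holomorphic_on UNIV" by (intro holomorphic_intros dg)
  have Gw: "?G w \<noteq> 0" using G unfolding g_def .
  \<comment> \<open>The reciprocal of this exponent is the coefficient \<open>1 + \<eta>/2\<close>; the other half of \<open>\<eta>\<close> absorbs terms of lower order.\<close>
  have \<alpha>: "0 < 1 / (1 + \<eta>/2)" "1 / (1 + \<eta>/2) < 1" using \<eta> by auto
  define M0 where "M0 = 1 + cmod (d 0) + cmod c + 4 * K"
  \<comment> \<open>\<open>M * 2 ^ k\<close> bounds \<open>ln \<bar>h\<bar>\<close> on a disk on which the coefficients are controlled by \<open>sigma t b = exp (2 ^ k)\<close>: two of the three units pay for the factor \<open>(k + 1)\<^sup>2\<close>.\<close>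
  define M where "M = ln M0 + 3 + \<bar>ln_lead_coeff h\<bar>"
  have M0: "1 \<le> M0" using K(1) by (simp add: M0_def)
  have M: "1 \<le> M" "3 \<le> M" using M0 by (auto simp: M_def)
  show thesis
  proof (rule mean_log_deriv_le[OF \<alpha>], goal_cases)
    case D: (1 D)
    obtain K1 where K1: "\<And>k y. 1 \<le> y \<Longrightarrow> 2 ^ k \<le> 2 * y \<Longrightarrow>
      (1 + \<eta>/2) * ln (D * (M * 2 ^ k) / (1 / (2 * (real k + 1)\<^sup>2)) ^ 4) \<le> (1 + \<eta>) * ln y + K1"
      by (rule log_deriv_remainder_bound[OF \<eta> D(1) M(1)]) (rule that)
    have mono_le: "x \<le> y" if "sigma x b \<le> sigma y b" "0 \<le> x" "0 \<le> y" for x y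
    proof (rule ccontr)
      assume "\<not> x \<le> y"
      then show False using sigma_strict_mono[OF b m, of y x] that by simp
    qed
    have mono: "x < y" if "sigma x b < sigma y b" "0 \<le> x" "0 \<le> y" for x y
      using mono_le[of x y] that by (cases "x = y") auto
    show thesis
    proof (rule that[of "1 + K1 + ln_lead_coeff h"])
      fix r :: real and n :: nat
      assume rE: "r \<notin> exceptional_set \<rho>" and r: "0 < r" and n: "n = nat \<lfloor>ln (sigma r b)\<rfloor>" "1 \<le> n" and \<rho>n: "1 \<le> \<rho> n"
      define y where "y = ln (sigma r b)"
      define s where "s = \<rho> n"
      let ?z = "\<lambda>\<theta>. of_real s * cis \<theta>"
      have ny: "real n \<le> y" "y < real n + 1" using n unfolding y_def[symmetric] by linarith+
      then have y1: "1 \<le> y" using n(2) by linarith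
      have "0 < sigma r b" using sigma_strict_mono[OF b m, of 0 r] sigma_nonneg[OF b, of 0] r by simp
      then have sig_r: "sigma r b = exp y" by (simp add: y_def)
      have s: "1 \<le> s" "sigma s b = exp n" using \<rho>n \<rho>(2) by (auto simp: s_def)
      have sr: "s \<le> r" by (rule mono_le) (use s r ny in \<open>auto simp: sig_r\<close>)
      obtain k :: nat where k: "y < 2 ^ k" "2 ^ k \<le> 2 * y" using power_of_two_bracket[OF y1] by blast
      define t where "t = \<rho> (2^k)"
      \<comment> \<open>Half of the available room enlarges the circle of radius \<open>s\<close>; the other half makes the geometric series in the bound for \<open>h\<close> converge.\<close>
      define \<delta> where "\<delta> = 1 / (2 * (real k + 1)\<^sup>2)"
      have "1 \<le> (real k + 1)\<^sup>2" by simp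
      then have k1: "1 \<le> 2 * (real k + 1)\<^sup>2" by linarith
      have \<delta>: "0 < \<delta>" "\<delta> \<le> 1" "2 * \<delta> = 1 / (real k + 1)\<^sup>2"
        using k1 by (auto simp: \<delta>_def divide_le_eq)
      have t: "0 < t" "sigma t b = exp (2^k)" using \<rho> by (auto simp: t_def)
      have "r < t" by (rule mono) (use r t k in \<open>auto simp: sig_r\<close>)
      moreover have "r \<notin> {t * exp (- (2 * \<delta>)) .. t}"
        using rE unfolding \<delta>(3) t_def exceptional_set_def by auto
      ultimately have rt: "r < t * exp (- (2 * \<delta>))" by auto
      have st: "s * exp \<delta> \<le> t * exp (- \<delta>)"
      proof -
        have "s * exp \<delta> \<le> (t * exp (- (2 * \<delta>))) * exp \<delta>" using sr rt by (intro mult_right_mono) auto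
        also have "\<dots> = t * exp (- \<delta>)" by (simp flip: exp_add)
        finally show ?thesis .
      qed
      have st': "s * exp \<delta> < t"
        using st t \<delta> by (intro le_less_trans[OF st]) auto
      define L where "L = M * 2 ^ k"
      have L: "1 \<le> L" unfolding L_def using M mult_mono[of 1 M 1 "2^k::real"] by simp
      have hbound: "cmod (h z) \<le> exp L" if z: "z \<in> cball 0 (s * exp \<delta>)" for z
      proof -
        define R where "R = s * exp \<delta>"
        have R: "0 \<le> R" "R < t" "cmod z \<le> R" "R / t \<le> exp (- \<delta>)"
          using s z st st' t by (auto simp: R_def field_simps)
        have sd: "summable (\<lambda>j. cmod (d j) * cmod z ^ j)" by (intro entire_coeffsD d) simp
        have sb: "summable (\<lambda>j. cmod (b j) * R ^ j)" using R by (intro entire_coeffsD b) simp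
        have sd': "summable (\<lambda>j. cmod (d (Suc j)) * cmod z ^ Suc j)"
          using sd by (subst summable_Suc_iff)
        have sb': "summable (\<lambda>j. cmod (b (Suc j)) * R ^ Suc j)"
          using sb by (subst summable_Suc_iff)
        have "cmod (g z) \<le> (\<Sum>j. cmod (d j) * cmod z ^ j)" unfolding g_def
          using summable_norm[of "\<lambda>j. d j * z ^ j"] sd by (simp add: norm_mult norm_power)
        also have "\<dots> = cmod (d 0) + (\<Sum>j. cmod (d (Suc j)) * cmod z ^ Suc j)"
          using suminf_split_head[OF sd] by simp
        also have "(\<Sum>j. cmod (d (Suc j)) * cmod z ^ Suc j) \<le> (\<Sum>j. K * (cmod (b (Suc j)) * R ^ Suc j))"
        proof (rule suminf_le)
          show "cmod (d (Suc j)) * cmod z ^ Suc j \<le> K * (cmod (b (Suc j)) * R ^ Suc j)" for j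
            using mult_mono[OF K(2)[of "Suc j"] power_mono[of "cmod z" R "Suc j"]] R K(1) by (simp add: mult.assoc)
        qed (intro summable_mult sd' sb')+
        also have "\<dots> = K * (\<Sum>j. cmod (b (Suc j)) * R ^ Suc j)"
          by (rule suminf_mult[OF sb'])
        also have "\<dots> \<le> K * (\<Sum>j. cmod (b j) * R ^ j)"
          using suminf_split_head[OF sb] K(1) by (intro mult_left_mono) auto
        also have "\<dots> \<le> K * (exp (2^k) / (1 - R / t))"
          using abs_series_le_sigma[OF b R(1,2)] K(1) t by (intro mult_left_mono) auto
        also have "\<dots> \<le> K * (exp (2^k) / (\<delta> / 2))"
        proof (intro mult_left_mono divide_left_mono mult_pos_pos K(1))
          show gap: "\<delta> / 2 \<le> 1 - R / t" using one_minus_exp_ge[of \<delta>] \<delta> R(4) by linarith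
          show "0 < \<delta> / 2" using \<delta> by simp
          with gap show "0 < 1 - R / t" by linarith
        qed simp
        also have "\<dots> = 4 * K * (real k + 1)\<^sup>2 * exp (2^k)" by (simp add: \<delta>_def)
        finally have "cmod (h z) \<le> cmod (d 0) + cmod c + 4 * K * (real k + 1)\<^sup>2 * exp (2^k)"
          unfolding h_def using norm_triangle_ineq4[of "g z" c] by simp
        also have "\<dots> \<le> (cmod (d 0) + cmod c) * (exp (2^k) ^ 3) + 4 * K * (exp (2^k) ^ 3)"
        proof (intro add_mono)
          have "1 \<le> exp (2^k :: real)" by simp
          then have "1 \<le> exp (2^k :: real) ^ 3" by (rule one_le_power)
          then show "cmod (d 0) + cmod c \<le> (cmod (d 0) + cmod c) * (exp (2^k) ^ 3)"
            using mult_left_mono[of 1 "exp (2^k :: real) ^ 3" "cmod (d 0) + cmod c"] by simp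
          have "real k + 1 \<le> 2 ^ k + 1" using of_nat_le_two_power[of k] by simp
          also have "\<dots> \<le> exp (2^k)" using exp_ge_add_one_self[of "2^k"] by (simp add: add.commute)
          finally have "(real k + 1)\<^sup>2 \<le> exp (2^k) ^ 2" by (intro power_mono) auto
          then have "(real k + 1)\<^sup>2 * exp (2^k) \<le> exp (2^k) ^ 2 * exp (2^k)" by (intro mult_right_mono) auto
          also have "\<dots> = exp (2^k) ^ 3" by (simp add: power2_eq_square power3_eq_cube)
          finally have "4 * K * ((real k + 1)\<^sup>2 * exp (2^k)) \<le> 4 * K * (exp (2^k) ^ 3)"
            using K(1) by (intro mult_left_mono) auto
          then show "4 * K * (real k + 1)\<^sup>2 * exp (2^k) \<le> 4 * K * (exp (2^k) ^ 3)" by (simp add: mult.assoc)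
        qed
        also have "\<dots> = (cmod (d 0) + cmod c + 4 * K) * (exp (2^k) ^ 3)" by (simp add: algebra_simps)
        also have "\<dots> \<le> M0 * (exp (2^k) ^ 3)" by (intro mult_right_mono) (auto simp: M0_def)
        also have "\<dots> = exp (ln M0 + 3 * 2^k)" using M0 by (simp add: exp_add exp_of_nat_mult[of 3, simplified])
        also have "\<dots> \<le> exp L"
        proof -
          have "ln M0 * 1 \<le> ln M0 * 2^k" using M0 by (intro mult_left_mono) auto
          then have "ln M0 + 3 * 2^k \<le> (ln M0 + 3) * 2^k" by (simp add: algebra_simps)
          also have "\<dots> \<le> L" unfolding L_def M_def by (intro mult_right_mono) auto
          finally show ?thesis by simp
        qed
        finally show ?thesis .
      qed
      have lead: "- L \<le> ln_lead_coeff h"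
      proof -
        have "\<bar>ln_lead_coeff h\<bar> * 1 \<le> M * 2^k" using M0 by (intro mult_mono) (auto simp: M_def)
        then show ?thesis by (simp add: L_def)
      qed
      let ?q = "\<lambda>\<theta>. log_plus (cmod (?z \<theta> * deriv h (?z \<theta>) / h (?z \<theta>)))"
      have q: "integrable circ ?q" "(\<integral>\<theta>. ?q \<theta> \<partial>circ) \<le> (1 + \<eta>/2) * ln (D * L / \<delta>^4)"
        using D(2)[OF h w1 s(1) \<delta>(1,2) L hbound lead] by auto
      have "(1 + \<eta>/2) * ln (D * L / \<delta>^4) \<le> (1 + \<eta>) * ln y + K1"
        unfolding L_def \<delta>_def by (rule K1[OF y1 k(2)])
      with q have qle: "(\<integral>\<theta>. ?q \<theta> \<partial>circ) \<le> (1 + \<eta>) * ln y + K1" by simp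
      define A where "A = (\<lambda>\<theta>. \<bar>ln (cmod (?z \<theta> * deriv g (?z \<theta>) / of_real (exp n)))\<bar>)"
      have s0: "0 < s" using s by simp
      have lnG: "AE \<theta> in circ. ln (cmod (?z \<theta> * deriv g (?z \<theta>) / of_real (exp n))) = ln (cmod (?G (?z \<theta>))) - n"
        using entire_AE_circ_nz[OF holG Gw s0]
        by eventually_elim (simp add: norm_divide norm_mult ln_div)
      have mG: "(\<lambda>\<theta>. ?G (?z \<theta>)) \<in> borel_measurable borel" by (rule entire_circle_measurable[OF holG])
      have Aint: "integrable circ A" unfolding A_def
      proof (rule integrable_abs)
        have "integrable circ (\<lambda>\<theta>. ln (cmod (?G (?z \<theta>))) - n)"
          by (intro Bochner_Integration.integrable_diff Jensen_formula(1)[OF holG Gw s0]) auto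
        then show "integrable circ (\<lambda>\<theta>. ln (cmod (?z \<theta> * deriv g (?z \<theta>) / of_real (exp n))))"
          using lnG mG by (subst integrable_cong_AE) auto
      qed
      have hint: "integrable circ (\<lambda>\<theta>. ln (cmod (h (?z \<theta>))))" by (rule Jensen_formula(1)[OF h w1 s0])
      have "(\<integral>\<theta>. n - A \<theta> - ?q \<theta> \<partial>circ) \<le> (\<integral>\<theta>. ln (cmod (h (?z \<theta>))) \<partial>circ)"
      proof (rule integral_mono_AE)
        show "AE \<theta> in circ. n - A \<theta> - ?q \<theta> \<le> ln (cmod (h (?z \<theta>)))"
          using lnG entire_AE_circ_nz[OF holG Gw s0] entire_AE_circ_nz[OF h w1 s0]
        proof eventually_elim
          case (elim \<theta>)
          have "ln (cmod (?G (?z \<theta>))) = ln (cmod (h (?z \<theta>))) + ln (cmod (?z \<theta> * deriv h (?z \<theta>) / h (?z \<theta>)))"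
            using elim(2,3) by (simp add: dh norm_divide norm_mult ln_div)
          moreover have "ln (cmod (?z \<theta> * deriv h (?z \<theta>) / h (?z \<theta>))) \<le> ?q \<theta>" by (simp add: log_plus_def)
          moreover have "- A \<theta> \<le> ln (cmod (?G (?z \<theta>))) - n" unfolding A_def elim(1) by simp
          ultimately show ?case by linarith
        qed
        show "integrable circ (\<lambda>\<theta>. n - A \<theta> - ?q \<theta>)"
          by (intro Bochner_Integration.integrable_diff Aint q(1)) simp
      qed (rule hint)
      also have "(\<integral>\<theta>. n - A \<theta> - ?q \<theta> \<partial>circ) = n - (\<integral>\<theta>. A \<theta> \<partial>circ) - (\<integral>\<theta>. ?q \<theta> \<partial>circ)"
        using Aint q circ.prob_space by simp
      also have "(\<integral>\<theta>. ln (cmod (h (?z \<theta>))) \<partial>circ) = zero_sum h s + ln_lead_coeff h"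
        by (rule Jensen_formula(2)[OF h w1 s0])
      also have "zero_sum h s \<le> zero_sum h r" by (rule zero_sum_mono[OF h w1 s0 sr])
      also have "zero_sum h r = nevanlinna_N r c g"
        unfolding nevanlinna_N_def using nevanlinna_N0_eq_zero_sum[OF h w1 r] by (simp add: h_def)
      finally have "y - (\<integral>\<theta>. A \<theta> \<partial>circ) - (1 + \<eta>) * ln y - (1 + K1 + ln_lead_coeff h) \<le> nevanlinna_N r c g"
        using qle ny by linarith
      then show "ln (sigma r b) - (\<integral>\<theta>. \<bar>ln (cmod (of_real (\<rho> n) * cis \<theta> * deriv g (of_real (\<rho> n) * cis \<theta>) / of_real (exp n)))\<bar> \<partial>circ)
        - (1 + \<eta>) * ln (ln (sigma r b)) - (1 + K1 + ln_lead_coeff h) \<le> nevanlinna_N r c g"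
        unfolding A_def y_def s_def .
    qed
  qed
qed

section \<open>Asymptotic comparison of the bounds\<close>

lemma log_power_negligible:
  fixes a p q K :: real assumes "0 < a" "0 < p"
  shows "eventually (\<lambda>x. (a * ln x) powr p + q * ln x + K \<le> x / 2) at_top"
proof -
  have 1: "((\<lambda>x. (a * ln x) powr p / x) \<longlongrightarrow> 0) at_top" using assms by real_asymp
  have 2: "((\<lambda>x::real. ln x / x) \<longlongrightarrow> 0) at_top" by real_asymp
  have 3: "((\<lambda>x::real. K / x) \<longlongrightarrow> 0) at_top" by real_asymp
  have "((\<lambda>x. (a * ln x) powr p / x + q * (ln x / x) + K / x) \<longlongrightarrow> 0 + q * 0 + 0) at_top"
    by (intro tendsto_intros 1 2 3)
  then have "eventually (\<lambda>x. (a * ln x) powr p / x + q * (ln x / x) + K / x < 1 / 2) at_top"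
    by (rule order_tendstoD) simp
  then show ?thesis using eventually_gt_at_top[of 0]
  proof eventually_elim
    case (elim x)
    then have "((a * ln x) powr p / x + q * (ln x / x) + K / x) * x \<le> 1 / 2 * x"
      by (intro mult_right_mono) auto
    then show ?case using elim by (simp add: field_simps)
  qed
qed

text \<open>The error terms in \<open>ln \<phi>\<close> are to be replaced by error terms in \<open>ln T\<close>, although \<open>T\<close> may be much
  smaller than \<open>\<phi>\<close>. Where \<open>T\<close> is at most \<open>\<phi> / 2\<close> the lower bound for \<open>N\<close> exceeds \<open>T\<close> anyway; elsewhere
  \<open>ln \<phi> \<le> ln 2 + ln T\<close>, and the gaps between \<open>C'\<close> and \<open>C\<close> and between \<open>\<eta> / 2\<close> and \<open>\<eta>\<close> absorb the constants.\<close>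
lemma characteristic_bound_of_lower_bound:
  fixes T \<phi> N :: "real \<Rightarrow> real"
  assumes AB: "0 < A" "0 < B" and C: "1 < C'" "C' < C"
    and \<phi>: "filterlim \<phi> at_top at_top" and T: "filterlim T at_top at_top"
    and up: "eventually (\<lambda>r. T r \<le> \<phi> r + K) at_top"
    and low: "\<And>\<eta>. 0 < \<eta> \<Longrightarrow> \<exists>K'. eventually (\<lambda>r. r \<notin> E \<longrightarrow>
        \<phi> r - (C' / A * ln (\<phi> r)) powr (1 / B) - (1 + \<eta>) * ln (\<phi> r) - K' \<le> N r) at_top"
  obtains \<epsilon> :: "real \<Rightarrow> real" where "(\<epsilon> \<longlongrightarrow> 0) at_top"
    "eventually (\<lambda>r. r \<notin> E \<longrightarrow>
      T r \<le> N r + (C / A) powr (1 / B) * ln (T r) powr (1 / B) + (1 + \<epsilon> r) * ln (T r)) at_top"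
proof -
  define P where "P = (\<lambda>r. (C / A) powr (1 / B) * ln (T r) powr (1 / B))"
  have p: "0 < 1 / B" "0 < C' / A" using AB C by auto
  have main: "eventually (\<lambda>r. r \<notin> E \<longrightarrow> T r \<le> N r + P r + (1 + \<eta>) * ln (T r)) at_top" if \<eta>: "0 < \<eta>" for \<eta>
  proof -
    obtain K' where K': "eventually (\<lambda>r. r \<notin> E \<longrightarrow>
        \<phi> r - (C' / A * ln (\<phi> r)) powr (1 / B) - (1 + \<eta>/2) * ln (\<phi> r) - K' \<le> N r) at_top"
      using low[of "\<eta>/2"] \<eta> by auto
    have negl: "eventually (\<lambda>r. (C' / A * ln (\<phi> r)) powr (1 / B) + (1 + \<eta>/2) * ln (\<phi> r) + K' \<le> \<phi> r / 2) at_top"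
      using log_power_negligible[OF p(2,1)] \<phi> by (rule eventually_compose_filterlim)
    have lnT: "filterlim (\<lambda>r. ln (T r)) at_top at_top"
      using ln_at_top T by (rule filterlim_compose)
    have T1: "eventually (\<lambda>r. 1 \<le> T r) at_top" using T by (simp add: filterlim_at_top)
    have \<phi>1: "eventually (\<lambda>r. 1 \<le> \<phi> r) at_top" using \<phi> by (simp add: filterlim_at_top)
    have big1: "eventually (\<lambda>r. C' * ln 2 / (C - C') \<le> ln (T r)) at_top"
      using lnT by (simp add: filterlim_at_top)
    have big2: "eventually (\<lambda>r. ((1 + \<eta>/2) * ln 2 + K' + K) / (\<eta>/2) \<le> ln (T r)) at_top"
      using lnT by (simp add: filterlim_at_top)
    show ?thesis using K' negl T1 \<phi>1 big1 big2 up
    proof eventually_elim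
      case (elim r)
      show ?case
      proof
        assume "r \<notin> E"
        then have N: "\<phi> r - (C' / A * ln (\<phi> r)) powr (1 / B) - (1 + \<eta>/2) * ln (\<phi> r) - K' \<le> N r"
          using elim(1) by blast
        have lnT0: "0 \<le> ln (T r)" using elim(3) by simp
        have P0: "0 \<le> P r" by (simp add: P_def)
        show "T r \<le> N r + P r + (1 + \<eta>) * ln (T r)"
        proof (cases "2 * T r \<le> \<phi> r")
          case True
          have "T r \<le> N r" using N elim(2) True by linarith
          moreover have "0 \<le> (1 + \<eta>) * ln (T r)" using lnT0 \<eta> by simp
          ultimately show ?thesis using P0 by linarith
        next
          case False
          have "ln (\<phi> r) \<le> ln (2 * T r)" using False elim(3,4) by (subst ln_le_cancel_iff) auto
          then have ln\<phi>: "ln (\<phi> r) \<le> ln 2 + ln (T r)" using elim(3) by (simp add: ln_mult)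
          have "C' * ln 2 \<le> (C - C') * ln (T r)" using elim(5) C by (simp add: field_simps)
          then have "C' * ln (\<phi> r) \<le> C * ln (T r)"
            using mult_left_mono[OF ln\<phi>, of C'] C by (simp add: algebra_simps)
          then have "C' / A * ln (\<phi> r) \<le> C / A * ln (T r)" using AB by (simp add: divide_right_mono)
          then have "(C' / A * ln (\<phi> r)) powr (1 / B) \<le> (C / A * ln (T r)) powr (1 / B)"
            using p elim(4) AB C by (intro powr_mono2) (auto intro!: divide_nonneg_pos mult_nonneg_nonneg)
          also have "\<dots> = P r" unfolding P_def by (rule powr_mult)
          finally have a: "(C' / A * ln (\<phi> r)) powr (1 / B) \<le> P r" .
          have "(1 + \<eta>/2) * ln 2 + K' + K \<le> \<eta>/2 * ln (T r)" using elim(6) \<eta> by (simp add: field_simps)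
          moreover have "(1 + \<eta>/2) * ln (\<phi> r) \<le> (1 + \<eta>/2) * (ln 2 + ln (T r))"
            using ln\<phi> \<eta> by (intro mult_left_mono) auto
          ultimately have "(1 + \<eta>/2) * ln (\<phi> r) + K' + K \<le> (1 + \<eta>) * ln (T r)"
            by (simp add: algebra_simps)
          then show ?thesis using a N elim(7) by linarith
        qed
      qed
    qed
  qed
  define \<epsilon> where "\<epsilon> = (\<lambda>r. if r \<in> E then 0 else max 0 ((T r - N r - P r) / ln (T r) - 1))"
  have lnT1: "eventually (\<lambda>r. 0 < ln (T r)) at_top"
    using filterlim_compose[OF ln_at_top T] by (simp add: filterlim_at_top_dense)
  show thesis
  proof (rule that[of \<epsilon>])
    show "(\<epsilon> \<longlongrightarrow> 0) at_top"
    proof (rule tendstoI)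
      fix e :: real assume e: "0 < e"
      then have "0 < e / 2" by simp
      show "eventually (\<lambda>r. dist (\<epsilon> r) 0 < e) at_top"
        using main[OF \<open>0 < e / 2\<close>] lnT1
      proof eventually_elim
        case (elim r)
        have "0 \<le> \<epsilon> r" by (simp add: \<epsilon>_def)
        moreover have "\<epsilon> r \<le> e / 2"
        proof (cases "r \<in> E")
          case False
          then have "T r - N r - P r \<le> (1 + e/2) * ln (T r)" using elim by linarith
          then have "(T r - N r - P r) / ln (T r) \<le> 1 + e/2" using elim by (simp add: divide_le_eq)
          then have "max 0 ((T r - N r - P r) / ln (T r) - 1) \<le> e / 2" using e by (intro max.boundedI) linarith+
          then show ?thesis using False by (simp add: \<epsilon>_def)
        qed (use e in \<open>simp add: \<epsilon>_def\<close>)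
        ultimately show ?case using e by simp
      qed
    qed
    show "eventually (\<lambda>r. r \<notin> E \<longrightarrow>
      T r \<le> N r + (C / A) powr (1 / B) * ln (T r) powr (1 / B) + (1 + \<epsilon> r) * ln (T r)) at_top"
      using lnT1
    proof eventually_elim
      case (elim r)
      show ?case
      proof
        assume "r \<notin> E"
        then have "(T r - N r - P r) / ln (T r) \<le> 1 + \<epsilon> r" by (simp add: \<epsilon>_def)
        then have "T r - N r - P r \<le> (1 + \<epsilon> r) * ln (T r)" using elim by (simp add: divide_le_eq)
        then show "T r \<le> N r + (C / A) powr (1 / B) * ln (T r) powr (1 / B) + (1 + \<epsilon> r) * ln (T r)"
          by (simp add: P_def)
      qed
    qed
  qed
qed

section \<open>Almost sure properties of the coefficients\<close>

text \<open>Chebyshev's inequality gives tail probabilities \<open>1 / j\<^sup>2\<close>, and the Borel-Cantelli lemma applies.\<close>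
lemma (in prob_space) AE_linear_growth:
  fixes X :: "nat \<Rightarrow> 'a \<Rightarrow> complex"
  assumes meas: "\<And>j. X j \<in> borel_measurable M"
    and var: "\<And>j. has_bochner_integral M (\<lambda>\<omega>. (cmod (X j \<omega>))\<^sup>2) 1"
  shows "AE \<omega> in M. \<exists>K\<ge>0. \<forall>j>0. cmod (X j \<omega>) \<le> K * real j"
proof -
  have [measurable]: "\<And>j. X j \<in> borel_measurable M" by (rule meas)
  define A where "A = (\<lambda>j. {\<omega> \<in> space M. (real (Suc j))\<^sup>2 \<le> (cmod (X (Suc j) \<omega>))\<^sup>2})"
  have meas_A: "A j \<in> sets M" for j unfolding A_def by measurable
  have P: "measure M (A j) \<le> 1 / (real (Suc j))\<^sup>2" for j
  proof -
    have "measure M (A j) \<le> (\<integral>\<omega>. (cmod (X (Suc j) \<omega>))\<^sup>2 \<partial>M) / (real (Suc j))\<^sup>2"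
      unfolding A_def
      by (rule integral_Markov_inequality_measure[where A="space M"])
         (use var[of "Suc j"] in \<open>auto simp: has_bochner_integral_iff\<close>)
    then show ?thesis using var[of "Suc j"] by (simp add: has_bochner_integral_iff)
  qed
  have "summable (\<lambda>j. 1 / (real (Suc j))\<^sup>2)"
    using inverse_power_summable[of 2, where 'a=real] by (subst summable_Suc_iff) (simp add: field_simps)
  then have "summable (\<lambda>j. measure M (A j))"
    by (rule summable_comparison_test'[where N=0]) (use P in auto)
  then have "AE \<omega> in M. eventually (\<lambda>j. \<omega> \<in> space M - A j) sequentially"
    by (intro borel_cantelli_AE1 meas_A) (auto simp: emeasure_eq_measure)
  then show ?thesis
  proof (rule AE_mp, intro AE_I2 impI)
    fix \<omega> assume "\<omega> \<in> space M" and "eventually (\<lambda>j. \<omega> \<in> space M - A j) sequentially"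
    then obtain J where J: "\<And>j. J \<le> j \<Longrightarrow> \<omega> \<in> space M - A j" by (auto simp: eventually_sequentially)
    define K where "K = 1 + (\<Sum>j\<le>J. cmod (X j \<omega>))"
    have K1: "1 \<le> K" unfolding K_def by (simp add: sum_nonneg)
    show "\<exists>K\<ge>0. \<forall>j>0. cmod (X j \<omega>) \<le> K * real j"
    proof (intro exI[of _ K] conjI allI impI)
      fix j :: nat assume j: "0 < j"
      show "cmod (X j \<omega>) \<le> K * real j"
      proof (cases "j \<le> J")
        case True
        then have "cmod (X j \<omega>) \<le> (\<Sum>j\<le>J. cmod (X j \<omega>))" by (intro member_le_sum) auto
        also have "\<dots> \<le> K * 1" by (simp add: K_def)
        also have "\<dots> \<le> K * real j" using j K1 by (intro mult_left_mono) auto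
        finally show ?thesis .
      next
        case False
        then obtain i where i: "j = Suc i" "J \<le> i" using j by (cases j) auto
        have "cmod (X j \<omega>) < real j" using J[OF i(2)] by (auto simp: A_def i(1) not_le)
        also have "\<dots> \<le> K * real j" using K1 j by simp
        finally show ?thesis by simp
      qed
    qed (use K1 in simp)
  qed
qed

text \<open>A variable of variance 1 vanishes with probability \<open>p < 1\<close>, and any \<open>n\<close> of the independent variables
  vanish simultaneously with probability \<open>p ^ n\<close>.\<close>
lemma (in prob_space) AE_some_nonzero:
  fixes X :: "nat \<Rightarrow> 'a \<Rightarrow> complex"
  assumes indep: "indep_vars (\<lambda>_. borel) X UNIV"
    and ident: "\<And>i j. distr M borel (X i) = distr M borel (X j)"
    and var: "\<And>j. has_bochner_integral M (\<lambda>\<omega>. (cmod (X j \<omega>))\<^sup>2) 1"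
    and S: "infinite S"
  shows "AE \<omega> in M. \<exists>j\<in>S. X j \<omega> \<noteq> 0"
proof -
  have meas [measurable]: "X j \<in> borel_measurable M" for j
    using indep by (simp add: indep_vars_def2)
  define Z where "Z = (\<lambda>j. X j -` {0} \<inter> space M)"
  define p where "p = prob (Z 0)"
  have Zm: "Z j \<in> events" for j unfolding Z_def by measurable
  have pj: "prob (Z j) = p" for j
  proof -
    have "prob (Z j) = measure (distr M borel (X j)) {0}" unfolding Z_def by (subst measure_distr) auto
    also have "\<dots> = measure (distr M borel (X 0)) {0}" by (simp only: ident[of j 0])
    also have "\<dots> = p" unfolding p_def Z_def by (subst measure_distr) auto
    finally show ?thesis .
  qed
  have p1: "p < 1"
  proof (rule ccontr)
    assume "\<not> p < 1"
    then have "prob (Z 0) = 1" unfolding p_def using prob_le_1[of "Z 0"] by linarith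
    then have "AE \<omega> in M. \<omega> \<in> Z 0" using Zm by (simp add: prob_eq_1)
    then have "AE \<omega> in M. (cmod (X 0 \<omega>))\<^sup>2 = 0" by (auto simp: Z_def)
    then have "(\<integral>\<omega>. (cmod (X 0 \<omega>))\<^sup>2 \<partial>M) = (\<integral>\<omega>. 0 \<partial>M)" by (intro integral_cong_AE) auto
    then show False using var[of 0] by (simp add: has_bochner_integral_iff)
  qed
  define N where "N = (\<Inter>j\<in>S. Z j)"
  have Nm: "N \<in> events" unfolding N_def using S Zm by (intro sets.countable_INT') (auto intro: infinite_imp_nonempty)
  have "prob N \<le> p ^ n" for n
  proof (cases "n = 0")
    case False
    obtain J where J: "finite J" "card J = n" "J \<subseteq> S"
      using infinite_arbitrarily_large[OF S] by blast
    then have J0: "J \<noteq> {}" using False by auto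
    have "prob N \<le> prob (\<Inter>j\<in>J. Z j)"
      using J J0 Zm by (intro finite_measure_mono sets.finite_INT) (auto simp: N_def)
    also have "\<dots> = (\<Prod>j\<in>J. prob (Z j))"
      using indep J J0 unfolding indep_vars_def2 by (intro indep_setsD[where I=UNIV]) (auto simp: Z_def)
    also have "\<dots> = p ^ n" using J by (simp add: pj)
    finally show ?thesis .
  qed simp
  moreover have "(\<lambda>n. p ^ n) \<longlonglongrightarrow> 0" using p1 by (intro LIMSEQ_realpow_zero) (auto simp: p_def)
  ultimately have "prob N \<le> 0" by (intro LIMSEQ_le_const[of "\<lambda>n. p ^ n"]) auto
  then have "N \<in> null_sets M" using Nm by (intro null_setsI) (auto simp: emeasure_eq_measure measure_le_0_iff)
  then have "AE \<omega> in M. \<omega> \<notin> N" by (rule AE_not_in)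
  then show ?thesis by (rule AE_mp) (use S in \<open>auto simp: N_def Z_def infinite_imp_nonempty intro!: AE_I2\<close>)
qed

lemma log_mean_measurable:
  assumes [measurable]: "\<And>j. X j \<in> borel_measurable M"
  shows "log_mean X b r \<in> borel_measurable M"
proof -
  have "(\<lambda>\<omega>. LBINT \<theta>:{0..2*pi}. \<bar>ln (cmod (normalized_series X b \<omega> (of_real r * cis \<theta>)))\<bar>) \<in> borel_measurable M"
    unfolding set_lebesgue_integral_def normalized_series_def random_series_def norm_mult norm_of_real norm_cis mult_1_right
    by (rule lborel.borel_measurable_lebesgue_integral) measurable
  then show ?thesis unfolding log_mean_def by measurable
qed

text \<open>Markov's inequality for the exponential moment bounds the probability of the complementary event by
  a multiple of \<open>n powr - C\<close>, which is summable exactly because \<open>C > 1\<close>.\<close>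
lemma (in prob_space) AE_log_mean_le:
  fixes X :: "nat \<Rightarrow> 'a \<Rightarrow> complex"
  assumes meas: "\<And>j. X j \<in> borel_measurable M"
    and Y: "condition_Y M X b A B" and C: "1 < C"
    and R: "filterlim R at_top sequentially"
  shows "AE \<omega> in M. eventually (\<lambda>n. \<bar>log_mean X b (R n) \<omega>\<bar> \<le> (C / A * ln (real n)) powr (1 / B)) sequentially"
proof -
  have AB: "0 < A" "0 < B" using Y by (auto simp: condition_Y_def)
  obtain K where K: "eventually (\<lambda>r. exp_moment M X b A B r \<le> ennreal K) at_top"
    using Y by (auto simp: condition_Y_def)
  have lm [measurable]: "log_mean X b r \<in> borel_measurable M" for r by (rule log_mean_measurable[OF meas])
  let ?u = "\<lambda>n \<omega>. ennreal (exp (A * \<bar>log_mean X b (R n) \<omega>\<bar> powr B))"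
  define F where "F = (\<lambda>n. {\<omega> \<in> space M. 1 \<le> ennreal (real n powr - C) * ?u n \<omega>})"
  have Fm: "F n \<in> events" for n unfolding F_def by measurable
  have "eventually (\<lambda>n. measure M (F n) \<le> real n powr - C * max 0 K) sequentially"
    using eventually_compose_filterlim[OF K R]
  proof eventually_elim
    case (elim n)
    have "emeasure M (F n) \<le> ennreal (real n powr - C) * (\<integral>\<^sup>+\<omega>. ?u n \<omega> * indicator (space M) \<omega> \<partial>M)"
      unfolding F_def by (rule nn_integral_Markov_inequality) measurable
    also have "(\<integral>\<^sup>+\<omega>. ?u n \<omega> * indicator (space M) \<omega> \<partial>M) = exp_moment M X b A B (R n)"
      unfolding exp_moment_def by (intro nn_integral_cong) simp
    also have "ennreal (real n powr - C) * \<dots> \<le> ennreal (real n powr - C) * ennreal (max 0 K)"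
      using elim by (intro mult_left_mono order_trans[OF elim] ennreal_leI) auto
    also have "\<dots> = ennreal (real n powr - C * max 0 K)" by (subst ennreal_mult) auto
    finally show ?case by (simp add: emeasure_eq_measure)
  qed
  moreover have "summable (\<lambda>n. real n powr - C * max 0 K)"
    using C by (intro summable_mult2) (simp add: summable_real_powr_iff)
  ultimately have "summable (\<lambda>n. measure M (F n))"
    by (intro summable_comparison_test_ev[of "\<lambda>n. measure M (F n)" "\<lambda>n. real n powr - C * max 0 K"]) auto
  then have "AE \<omega> in M. eventually (\<lambda>n. \<omega> \<in> space M - F n) sequentially"
    by (intro borel_cantelli_AE1 Fm) (auto simp: emeasure_eq_measure)
  then show ?thesis
  proof (rule AE_mp, intro AE_I2 impI)
    fix \<omega> assume "\<omega> \<in> space M" and "eventually (\<lambda>n. \<omega> \<in> space M - F n) sequentially"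
    with eventually_gt_at_top[of 0]
    show "eventually (\<lambda>n. \<bar>log_mean X b (R n) \<omega>\<bar> \<le> (C / A * ln (real n)) powr (1 / B)) sequentially"
    proof (elim eventually_elim2)
      fix n :: nat assume n: "0 < n" and "\<omega> \<in> space M - F n"
      define x where "x = \<bar>log_mean X b (R n) \<omega>\<bar>"
      have "ennreal (real n powr - C) * ?u n \<omega> < 1"
        using \<open>\<omega> \<in> space M - F n\<close> by (auto simp: F_def not_le)
      then have "ennreal (real n powr - C * exp (A * x powr B)) < 1"
        by (simp add: ennreal_mult x_def)
      then have "real n powr - C * exp (A * x powr B) < 1" by (simp add: ennreal_less_one_iff)
      then have "exp (A * x powr B) < real n powr C"
        using n by (simp add: powr_minus field_simps)
      also have "\<dots> = exp (C * ln (real n))" using n by (simp add: powr_def)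
      finally have "x powr B \<le> C / A * ln (real n)" using AB by (simp add: field_simps)
      then have "(x powr B) powr (1 / B) \<le> (C / A * ln (real n)) powr (1 / B)"
        using AB by (intro powr_mono2) auto
      then show "\<bar>log_mean X b (R n) \<omega>\<bar> \<le> (C / A * ln (real n)) powr (1 / B)"
        using AB by (simp add: powr_powr x_def)
    qed
  qed
qed

section \<open>The inequalities for one sample and almost surely\<close>

lemma log_mean_eq_circle_mean:
  assumes G: "G holomorphic_on UNIV" "\<And>z. random_series X b \<omega> z = G z" and r: "0 < r"
  shows "log_mean X b r \<omega> = (\<integral>\<theta>. \<bar>ln (cmod (G (of_real r * cis \<theta>) / of_real (sigma r b)))\<bar> \<partial>circ)"
proof -
  have [measurable]: "(\<lambda>\<theta>. G (of_real r * cis \<theta>)) \<in> borel_measurable borel"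
    by (rule entire_circle_measurable[OF G(1)])
  show ?thesis unfolding log_mean_def normalized_series_def G(2)
    using r by (subst integral_circ) (auto simp: norm_mult)
qed

text \<open>The deterministic part of the argument: everything that is used of the sample point \<open>\<omega>\<close> is the
  growth of the coefficients, one nonvanishing coefficient and the bound for the logarithmic means
  along \<open>\<rho> n\<close>.\<close>
lemma characteristic_bounds_of_sample:
  fixes X :: "nat \<Rightarrow> 'w \<Rightarrow> complex" and a :: "nat \<Rightarrow> complex" and \<rho> :: "real \<Rightarrow> real"
  defines "b \<equiv> \<lambda>j. of_nat j * a j"
  assumes a: "entire_coeffs a" and m: "a m \<noteq> 0" "0 < m"
    and \<rho>: "\<And>y. 0 < \<rho> y" "\<And>y. sigma (\<rho> y) b = exp y"
    and K: "0 \<le> K" "\<And>j. 0 < j \<Longrightarrow> cmod (X j \<omega>) \<le> K * real j"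
    and nz: "0 < l" "X l \<omega> * a l \<noteq> 0"
    and lm: "eventually (\<lambda>n. \<bar>log_mean X b (\<rho> (real n)) \<omega>\<bar> \<le> (C' / A * ln (real n)) powr (1 / B)) sequentially"
    and AB: "0 < A" "0 < B" and C: "1 < C'" "C' < C"
    and f: "\<And>z. f z = (\<Sum>j. a j * z ^ j)"
  shows "\<exists>r1 \<epsilon>1 \<epsilon>2. (\<epsilon>1 \<longlongrightarrow> 0) at_top \<and> (\<epsilon>2 \<longlongrightarrow> 0) at_top \<and>
        (\<forall>r>r1. r \<notin> exceptional_set \<rho> \<longrightarrow>
          nevanlinna_T r f
            \<le> nevanlinna_N r c (random_series X a \<omega>)
               + (C / A) powr (1 / B) * ln (nevanlinna_T r f) powr (1 / B)
               + (1 + \<epsilon>1 r) * ln (nevanlinna_T r f) \<and>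
          nevanlinna_T r (random_series X a \<omega>)
            \<le> nevanlinna_N r c (random_series X a \<omega>)
               + (C / A) powr (1 / B) * ln (nevanlinna_T r (random_series X a \<omega>)) powr (1 / B)
               + (1 + \<epsilon>2 r) * ln (nevanlinna_T r (random_series X a \<omega>)))"
proof -
  define d where "d = (\<lambda>j. X j \<omega> * a j)"
  define g where "g = (\<lambda>z. \<Sum>j. d j * z ^ j)"
  have f_eq: "f = (\<lambda>z. \<Sum>j. a j * z ^ j)" using f by auto
  have g_eq: "random_series X a \<omega> = g" by (simp add: fun_eq_iff random_series_def g_def d_def)
  have b: "entire_coeffs b" unfolding b_def by (rule entire_coeffs_index_mult[OF a])
  have bm: "b m \<noteq> 0" using m by (simp add: b_def)
  have d: "entire_coeffs d"
  proof (rule entire_coeffs_dominated[OF a])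
    fix j
    have "cmod (X j \<omega>) \<le> (K + cmod (X 0 \<omega>)) * 2 ^ j"
    proof (cases "j = 0")
      case False
      then have "cmod (X j \<omega>) \<le> K * real j" using K by simp
      also have "\<dots> \<le> (K + cmod (X 0 \<omega>)) * 2 ^ j"
        using K(1) of_nat_le_two_power by (intro mult_mono) auto
      finally show ?thesis .
    qed (use K in simp)
    then show "cmod (d j) \<le> (K + cmod (X 0 \<omega>)) * 2 ^ j * cmod (a j)"
      by (simp add: d_def norm_mult mult_right_mono)
  qed
  have db: "cmod (d j) \<le> K * cmod (b j)" if "0 < j" for j
    using mult_right_mono[OF K(2)[OF that], of "cmod (a j)"] by (simp add: d_def b_def norm_mult mult_ac)
  have ab: "cmod (a j) \<le> 1 * cmod (b j)" if "0 < j" for j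
    using that mult_right_mono[of 1 "real j" "cmod (a j)"] by (simp add: b_def norm_mult)
  have dl: "d l \<noteq> 0" using nz by (simp add: d_def)
  have g: "g holomorphic_on UNIV" unfolding g_def by (rule powser_entire(1)[OF d])
  have G: "random_series X b \<omega> z = z * deriv g z" for z
    unfolding g_def powser_entire(2)[OF d] by (simp add: random_series_def b_def d_def mult_ac)
  have holG: "(\<lambda>z. z * deriv g z) holomorphic_on UNIV"
    using g by (intro holomorphic_intros holomorphic_deriv) auto
  define \<phi> where "\<phi> = (\<lambda>r. ln (sigma r b))"
  have mono: "sigma r b \<le> sigma s b" if "0 \<le> r" "r \<le> s" for r s
    using sigma_strict_mono[OF b bm m(2), of r s] that by (cases "r = s") auto
  have \<phi>_ge: "y \<le> \<phi> r" if "\<rho> y \<le> r" for y r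
  proof -
    have "exp y \<le> sigma r b" using mono[of "\<rho> y" r] \<rho>[of y] that by simp
    then have "ln (exp y) \<le> \<phi> r" unfolding \<phi>_def by (subst ln_le_cancel_iff) (auto intro: less_le_trans[OF exp_gt_zero])
    then show ?thesis by simp
  qed
  have \<phi>_lim: "filterlim \<phi> at_top at_top"
    unfolding filterlim_at_top by (intro allI eventually_mono[OF eventually_ge_at_top] \<phi>_ge)
  have \<rho>_ge: "eventually (\<lambda>n. 1 \<le> \<rho> (real n)) sequentially"
  proof -
    have "eventually (\<lambda>n. \<phi> 1 < real n) sequentially" using filterlim_real_sequentially by (simp add: filterlim_at_top_dense)
    then show ?thesis
    proof eventually_elim
      case (elim n)
      show ?case
      proof (rule ccontr)
        assume "\<not> 1 \<le> \<rho> (real n)"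
        then have "real n \<le> \<phi> 1" by (intro \<phi>_ge) simp
        then show False using elim by simp
      qed
    qed
  qed
  have \<phi>1: "eventually (\<lambda>r. 1 \<le> \<phi> r) at_top" using \<phi>_lim by (simp add: filterlim_at_top)
  have sig1: "1 \<le> sigma r b" if "1 \<le> \<phi> r" "0 < r" for r
  proof -
    have "0 < sigma r b" using sigma_strict_mono[OF b bm m(2), of 0 r] sigma_nonneg[OF b, of 0] that by simp
    then have "sigma r b = exp (\<phi> r)" by (simp add: \<phi>_def)
    also have "\<dots> \<ge> exp 0" using that by (subst exp_le_cancel_iff) simp
    finally show ?thesis by simp
  qed
  have up: "\<exists>K. eventually (\<lambda>r. nevanlinna_T r (\<lambda>z. \<Sum>j. e j * z ^ j) \<le> \<phi> r + K) at_top"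
    if "entire_coeffs e" "0 \<le> L" "\<And>j. 0 < j \<Longrightarrow> cmod (e j) \<le> L * cmod (b j)" for e L
  proof (intro exI)
    show "eventually (\<lambda>r. nevanlinna_T r (\<lambda>z. \<Sum>j. e j * z ^ j) \<le> \<phi> r + 1/2 * ln (1 + (cmod (e 0))\<^sup>2 + L\<^sup>2)) at_top"
      using \<phi>1 eventually_gt_at_top[of 0]
    proof eventually_elim
      case (elim r)
      then have "1 \<le> sigma r b" by (rule sig1)
      then show ?case unfolding \<phi>_def
        using elim by (intro nevanlinna_T_upper_bound that b) auto
    qed
  qed
  have low: "\<exists>K'. eventually (\<lambda>r. r \<notin> exceptional_set \<rho> \<longrightarrow>
      \<phi> r - (C' / A * ln (\<phi> r)) powr (1 / B) - (1 + \<eta>) * ln (\<phi> r) - K' \<le> nevanlinna_N r c g) at_top"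
    if \<eta>: "0 < \<eta>" for \<eta>
  proof -
    obtain w where w: "w * deriv (\<lambda>z. \<Sum>j. d j * z ^ j) w \<noteq> 0" using powser_deriv_nonzero[OF d dl nz(1)] .
    show ?thesis
    proof (rule nevanlinna_N_lower_bound[OF b bm m(2) \<rho> d K(1) db w \<eta>, of c], goal_cases)
      case 1
      then show ?case .
    next
      case bound: (2 K')
      have floor: "filterlim (\<lambda>r. nat \<lfloor>\<phi> r\<rfloor>) sequentially at_top"
        unfolding filterlim_at_top
      proof
        fix N :: nat
        have "eventually (\<lambda>r. real N \<le> \<phi> r) at_top" using \<phi>_lim by (simp add: filterlim_at_top)
        then show "eventually (\<lambda>r. N \<le> nat \<lfloor>\<phi> r\<rfloor>) at_top"
          by eventually_elim (simp add: le_nat_floor)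
      qed
      have "eventually (\<lambda>r. r \<notin> exceptional_set \<rho> \<longrightarrow>
        \<phi> r - (C' / A * ln (\<phi> r)) powr (1 / B) - (1 + \<eta>) * ln (\<phi> r) - K' \<le> nevanlinna_N r c g) at_top"
        using \<phi>1 eventually_gt_at_top[of 0] eventually_compose_filterlim[OF \<rho>_ge floor]
          eventually_compose_filterlim[OF lm floor]
      proof eventually_elim
        case (elim r)
        show ?case
        proof
          assume rE: "r \<notin> exceptional_set \<rho>"
          define n where "n = nat \<lfloor>\<phi> r\<rfloor>"
          have \<phi>_r: "ln (sigma r b) = \<phi> r" by (simp add: \<phi>_def)
          have n1: "1 \<le> n" using elim(1) by (simp add: n_def le_nat_floor)
          have n\<phi>: "real n \<le> \<phi> r" using elim(1) unfolding n_def by linarith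
          have "log_mean X b (\<rho> n) \<omega> = (\<integral>\<theta>. \<bar>ln (cmod (of_real (\<rho> n) * cis \<theta> * deriv g (of_real (\<rho> n) * cis \<theta>) / of_real (exp n)))\<bar> \<partial>circ)"
            using log_mean_eq_circle_mean[OF holG G \<rho>(1)[of n]] \<rho>(2)[of n] by simp
          moreover have "\<bar>log_mean X b (\<rho> n) \<omega>\<bar> \<le> (C' / A * ln (real n)) powr (1 / B)"
            using elim(4) by (simp add: n_def)
          moreover have "(C' / A * ln (real n)) powr (1 / B) \<le> (C' / A * ln (\<phi> r)) powr (1 / B)"
            using AB C n1 n\<phi> by (intro powr_mono2 mult_left_mono) (auto intro!: divide_nonneg_pos mult_nonneg_nonneg)
          ultimately have "(\<integral>\<theta>. \<bar>ln (cmod (of_real (\<rho> n) * cis \<theta> * deriv g (of_real (\<rho> n) * cis \<theta>) / of_real (exp n)))\<bar> \<partial>circ)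
              \<le> (C' / A * ln (\<phi> r)) powr (1 / B)" by linarith
          moreover have "ln (sigma r b) - (\<integral>\<theta>. \<bar>ln (cmod (of_real (\<rho> n) * cis \<theta> * deriv g (of_real (\<rho> n) * cis \<theta>) / of_real (exp n)))\<bar> \<partial>circ)
            - (1 + \<eta>) * ln (ln (sigma r b)) - K' \<le> nevanlinna_N r c g"
            unfolding g_def
            by (rule bound[OF rE elim(2) _ n1]) (use elim(3) in \<open>simp_all add: n_def \<phi>_def\<close>)
          ultimately show "\<phi> r - (C' / A * ln (\<phi> r)) powr (1 / B) - (1 + \<eta>) * ln (\<phi> r) - K' \<le> nevanlinna_N r c g"
            unfolding \<phi>_r by linarith
        qed
      qed
      then show ?case by blast
    qed
  qed
  obtain Kf where Kf: "eventually (\<lambda>r. nevanlinna_T r f \<le> \<phi> r + Kf) at_top"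
    using up[OF a _ ab] unfolding f_eq by auto
  obtain Kg where Kg: "eventually (\<lambda>r. nevanlinna_T r g \<le> \<phi> r + Kg) at_top"
    using up[OF d K(1) db] unfolding g_def by auto
  have Tf: "filterlim (\<lambda>r. nevanlinna_T r f) at_top at_top"
    unfolding f_eq by (rule nevanlinna_T_at_top[OF a m])
  have Tg: "filterlim (\<lambda>r. nevanlinna_T r g) at_top at_top"
    unfolding g_def by (rule nevanlinna_T_at_top[OF d dl nz(1)])
  obtain \<epsilon>1 where \<epsilon>1: "(\<epsilon>1 \<longlongrightarrow> 0) at_top"
    "eventually (\<lambda>r. r \<notin> exceptional_set \<rho> \<longrightarrow> nevanlinna_T r f \<le> nevanlinna_N r c g
      + (C / A) powr (1 / B) * ln (nevanlinna_T r f) powr (1 / B) + (1 + \<epsilon>1 r) * ln (nevanlinna_T r f)) at_top"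
    using characteristic_bound_of_lower_bound[OF AB C \<phi>_lim Tf Kf low] by blast
  obtain \<epsilon>2 where \<epsilon>2: "(\<epsilon>2 \<longlongrightarrow> 0) at_top"
    "eventually (\<lambda>r. r \<notin> exceptional_set \<rho> \<longrightarrow> nevanlinna_T r g \<le> nevanlinna_N r c g
      + (C / A) powr (1 / B) * ln (nevanlinna_T r g) powr (1 / B) + (1 + \<epsilon>2 r) * ln (nevanlinna_T r g)) at_top"
    using characteristic_bound_of_lower_bound[OF AB C \<phi>_lim Tg Kg low] by blast
  obtain r1 where "\<And>r. r1 < r \<Longrightarrow> r \<notin> exceptional_set \<rho> \<Longrightarrow>
      nevanlinna_T r f \<le> nevanlinna_N r c g
        + (C / A) powr (1 / B) * ln (nevanlinna_T r f) powr (1 / B) + (1 + \<epsilon>1 r) * ln (nevanlinna_T r f) \<and>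
      nevanlinna_T r g \<le> nevanlinna_N r c g
        + (C / A) powr (1 / B) * ln (nevanlinna_T r g) powr (1 / B) + (1 + \<epsilon>2 r) * ln (nevanlinna_T r g)"
    using eventually_conj[OF \<epsilon>1(2) \<epsilon>2(2)] unfolding eventually_at_top_dense by blast
  with \<epsilon>1(1) \<epsilon>2(1) show ?thesis unfolding g_eq by blast
qed

theorem corollary3p6:
  fixes M :: "'w measure"
    and X :: "nat \<Rightarrow> 'w \<Rightarrow> complex"
    and a :: "nat \<Rightarrow> complex"
    and f :: "complex \<Rightarrow> complex"
    and A B C :: real
  assumes "prob_space M"
    and "prob_space.indep_vars M (\<lambda>_. borel) X UNIV"
    and "\<And>i j. distr M borel (X i) = distr M borel (X j)"
    and "\<And>j. has_bochner_integral M (X j) 0"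
    and "\<And>j. has_bochner_integral M (\<lambda>\<omega>. (cmod (X j \<omega>))\<^sup>2) 1"
    and "transcendental_entire f"
    and "\<And>z. (\<lambda>j. a j * z ^ j) sums f z"
    and "A > 0" and "B > 0"
    and "condition_Y M X a A B"
    and "condition_Y M X (\<lambda>j. of_nat j * a j) A B"
    and "C > 1"
  shows "\<exists>E. finite_log_measure E \<and>
    (\<forall>c. AE \<omega> in M.
      \<exists>r1 \<epsilon>1 \<epsilon>2. (\<epsilon>1 \<longlongrightarrow> 0) at_top \<and> (\<epsilon>2 \<longlongrightarrow> 0) at_top \<and>
        (\<forall>r>r1. r \<notin> E \<longrightarrow>
          nevanlinna_T r f
            \<le> nevanlinna_N r c (random_series X a \<omega>)
               + (C / A) powr (1 / B) * ln (nevanlinna_T r f) powr (1 / B)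
               + (1 + \<epsilon>1 r) * ln (nevanlinna_T r f) \<and>
          nevanlinna_T r (random_series X a \<omega>)
            \<le> nevanlinna_N r c (random_series X a \<omega>)
               + (C / A) powr (1 / B) * ln (nevanlinna_T r (random_series X a \<omega>)) powr (1 / B)
               + (1 + \<epsilon>2 r) * ln (nevanlinna_T r (random_series X a \<omega>))))"
proof -
  interpret prob_space M by fact
  have meas: "X j \<in> borel_measurable M" for j
    using assms(4)[of j] by (simp add: has_bochner_integral_iff borel_measurable_integrable)
  let ?b = "\<lambda>j. of_nat j * a j"
  have a: "entire_coeffs a" by (rule entire_coeffs_of_sums[OF assms(7)])
  have S: "infinite ({j. a j \<noteq> 0} - {0})"
    using transcendental_coeffs_nonzero[OF assms(6,7)] by simp
  then obtain m where "m \<in> {j. a j \<noteq> 0} - {0}" using infinite_imp_nonempty by blast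
  then have m: "a m \<noteq> 0" "0 < m" by auto
  have b: "entire_coeffs ?b" by (rule entire_coeffs_index_mult[OF a])
  obtain \<rho> where \<rho>: "\<And>y. 0 < \<rho> y" "\<And>y. sigma (\<rho> y) ?b = exp y"
    by (rule sigma_attains_exp[OF b, of m]) (use m in auto)
  have \<rho>_lim: "filterlim (\<lambda>n. \<rho> (real n)) at_top sequentially"
    unfolding filterlim_at_top
  proof
    fix R :: real
    have "eventually (\<lambda>n. ln (sigma (max R 1) ?b) < real n) sequentially"
      using filterlim_real_sequentially by (simp add: filterlim_at_top_dense)
    then show "eventually (\<lambda>n. R \<le> \<rho> (real n)) sequentially"
    proof eventually_elim
      case (elim n)
      show ?case
      proof (rule ccontr)
        assume "\<not> R \<le> \<rho> (real n)"
        then have "sigma (\<rho> (real n)) ?b < sigma (max R 1) ?b"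
          using \<rho>(1)[of n] m by (intro sigma_strict_mono[OF b, of m]) auto
        then have "exp (real n) < sigma (max R 1) ?b" by (simp add: \<rho>(2))
        then have "real n < ln (sigma (max R 1) ?b)" by (metis exp_gt_zero ln_exp ln_less_cancel_iff order_less_trans)
        then show False using elim by simp
      qed
    qed
  qed
  \<comment> \<open>Any number strictly between 1 and \<open>C\<close>: above 1 for the Borel-Cantelli lemma, below \<open>C\<close> to absorb constants.\<close>
  define C' where "C' = (1 + C) / 2"
  have C': "1 < C'" "C' < C" using assms(12) by (auto simp: C'_def)
  have f: "f z = (\<Sum>j. a j * z ^ j)" for z using assms(7) by (rule sums_unique)
  have "AE \<omega> in M. \<exists>K\<ge>0. \<forall>j>0. cmod (X j \<omega>) \<le> K * real j"
    by (rule AE_linear_growth[OF meas assms(5)])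
  moreover have "AE \<omega> in M. \<exists>j\<in>{j. a j \<noteq> 0} - {0}. X j \<omega> \<noteq> 0"
    by (rule AE_some_nonzero[OF assms(2,3,5) S])
  moreover have "AE \<omega> in M. eventually (\<lambda>n. \<bar>log_mean X ?b (\<rho> (real n)) \<omega>\<bar> \<le> (C' / A * ln (real n)) powr (1 / B)) sequentially"
    by (rule AE_log_mean_le[OF meas assms(11) C'(1) \<rho>_lim])
  ultimately have "AE \<omega> in M. \<forall>c.
      \<exists>r1 \<epsilon>1 \<epsilon>2. (\<epsilon>1 \<longlongrightarrow> 0) at_top \<and> (\<epsilon>2 \<longlongrightarrow> 0) at_top \<and>
        (\<forall>r>r1. r \<notin> exceptional_set \<rho> \<longrightarrow>
          nevanlinna_T r f
            \<le> nevanlinna_N r c (random_series X a \<omega>)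
               + (C / A) powr (1 / B) * ln (nevanlinna_T r f) powr (1 / B)
               + (1 + \<epsilon>1 r) * ln (nevanlinna_T r f) \<and>
          nevanlinna_T r (random_series X a \<omega>)
            \<le> nevanlinna_N r c (random_series X a \<omega>)
               + (C / A) powr (1 / B) * ln (nevanlinna_T r (random_series X a \<omega>)) powr (1 / B)
               + (1 + \<epsilon>2 r) * ln (nevanlinna_T r (random_series X a \<omega>)))"
  proof eventually_elim
    case (elim \<omega>)
    obtain K where K: "0 \<le> K" "\<And>j. 0 < j \<Longrightarrow> cmod (X j \<omega>) \<le> K * real j" using elim(1) by auto
    obtain l where l: "0 < l" "X l \<omega> * a l \<noteq> 0" using elim(2) by auto
    show ?case
      by (intro allI characteristic_bounds_of_sample[OF a m \<rho> K l elim(3) assms(8,9) C' f])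
  qed
  then show ?thesis
    using finite_log_measure_exceptional_set[OF \<rho>(1)] by (intro exI[of _ "exceptional_set \<rho>"]) auto
qed

end
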